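(* Let $F$ be a field of characteristic $0$, $V$ an $n$-dimensional $F$-vector space, $G \le \mathrm{GL}(V)$ a finite group generated by pseudo-reflections, $M$ an $r$-dimensional $F[G]$-module, and $\chi\colon G\to F^\times$ a one-dimensional character. Let $f_1,\dots,f_n$ be basic invariants of $G$, let $\Delta_\chi$ be the generator of $\mathrm{S}(V^* )^\chi$ over $\mathrm{S}(V^* )^G$, and let $d_1^*,\dots,d_r^*$ be the operators on $\mathrm{S}(V^* )\otimes\wedge M^*$ defined in the context. Suppose $J_{M^*}$ divides $\Delta_\chi$ in $\mathrm{S}(V^* )$. Then each of the two sets \[ \{f_1^{a_1}\cdots f_n^{a_n}\, d_{i_1}^*\cdots d_{i_k}^*\Delta_\chi : 0\le k\le r,\ 1\le i_1<\cdots<i_k\le r,\ a_j\in\mathbb{Z}_{\ge 0}\} \] and \[ \{d_{i_1}^*\cdots d_{i_k}^*\, f_1^{a_1}\cdots f_n^{a_n}\Delta_\chi : 0\le k\le r,\ 1\le i_1<\cdots<i_k\le r,\ a_j\in\mathbb{Z}_{\ge 0}\} \] is an $F$-basis of $(\mathrm{S}(V^* )\otimes\wedge M^* )^\chi$.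
   Context: A pseudo-reflection is $g\in\mathrm{GL}(V)$ with $\dim\ker(g-I)=n-1$. $\mathrm{S}(W)$ denotes the symmetric algebra and $\wedge W$ the exterior algebra of a vector space $W$. $G$ acts on $V^*$ and $M^*$ contragrediently ($g\lambda=\lambda\circ g^{-1}$), hence on $\mathrm{S}(V),\mathrm{S}(V^* ),\wedge M,\wedge M^*$, and diagonally on their tensor products; $\mathrm{S}(V^* )\otimes\wedge M^*$ is bigraded by (polynomial degree, exterior degree). For a $G$-module $W$, $W^G$ denotes invariants and $W^\chi=\{w\in W: gw=\chi(g)w\ \forall g\in G\}$. Basic invariants: $\mathrm{S}(V^* )^G=F[f_1,\dots,f_n]$ with $f_i$ algebraically independent and homogeneous. $\mathrm{S}(V^* )^\chi$ is a free $\mathrm{S}(V^* )^G$-module of rank one; $\Delta_\chi$ denotes a homogeneous generator (unique up to nonzero scalar). For a $G$-module $N$ of dimension $r$: $(\mathrm{S}(V^* )\otimes N^* )^G$ is a free $\mathrm{S}(V^* )^G$-module with a homogeneous basis $\omega_1^N,\dots,\omega_r^N$ ("basic derivations"); writing $\omega_i^N=\sum_j J^N_{ij}\otimes\nu_j$ for a basis $\nu_1,\dots,\nu_r$ of $N^*$, the Jacobian is $J_N=\det(J^N_{ij})\in\mathrm{S}(V^* )$ (well-defined up to nonzero scalar). Here $J_{M^*}$ is this with $N=M^*$ (so $\omega_i^{M^*}\in(\mathrm{S}(V^* )\otimes M)^G$). Likewise $(\mathrm{S}(V)\otimes M^* )^G$ is a free $\mathrm{S}(V)^G$-module with homogeneous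 basis $\tilde\omega_1^{M^*},\dots,\tilde\omega_r^{M^*}$. For $s\in\mathrm{S}(V)$, $\partial_s$ is the constant-coefficient differential operator on $\mathrm{S}(V^* )$: for $v\in V$, $\partial_v$ is the derivation with $\partial_v\lambda=\lambda(v)$ for $\lambda\in V^*$, and $s\mapsto\partial_s$ is the algebra homomorphism extending this. For $\mu\in\wedge M^*$, $\epsilon_\mu$ is left exterior multiplication by $\mu$. If $\tilde\omega_i^{M^*}=\sum_j s_j\otimes\mu_j$ ($s_j\in\mathrm{S}(V)$, $\mu_j\in M^*$), then $d_i^*:=\sum_j\partial_{s_j}\otimes\epsilon_{\mu_j}$ acting on $\mathrm{S}(V^* )\otimes\wedge M^*$. *)

theory Defs
  imports "Jordan_Normal_Form.Matrix_Kernel" "Jordan_Normal_Form.Determinant"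
    "HOL-Library.Poly_Mapping"
begin

(* Coordinates: V = F^n with standard basis e_0..e_{n-1}; V* has the dual basis x_0..x_{n-1}.
   S(V* ) is the polynomial ring in x_0..x_{n-1}; S(V) the polynomial ring in y_0..y_{n-1}
   (y_k = e_k).  Both are represented as finitely supported functions from monomials
   (nat =>0 nat) to coefficients, restricted to variables < n.
   M = F^r with basis m_0..m_{r-1}, M* with dual basis eps_0..eps_{r-1}; the group acts on M by
   the matrices rho g.  An element of S(V* ) (x) /\M* is a function  nat set => poly , where the
   value at I is the coefficient of eps_I = eps_{i1} /\ ... /\ eps_{ik} (i1 < ... < ik). *)

type_synonym 'a pm = "(nat \<Rightarrow>\<^sub>0 nat) \<Rightarrow>\<^sub>0 'a"

definition Var :: "nat \<Rightarrow> 'a::comm_semiring_1 pm" where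
  "Var i = Poly_Mapping.single (Poly_Mapping.single i 1) 1"

definition Const :: "'a::comm_semiring_1 \<Rightarrow> 'a pm" where
  "Const c = Poly_Mapping.single 0 c"

definition in_vars :: "nat \<Rightarrow> 'a::zero pm \<Rightarrow> bool" where
  "in_vars n p \<longleftrightarrow> (\<forall>m\<in>Poly_Mapping.keys p. Poly_Mapping.keys m \<subseteq> {..<n})"

definition mdeg :: "(nat \<Rightarrow>\<^sub>0 nat) \<Rightarrow> nat" where
  "mdeg m = sum (Poly_Mapping.lookup m) (Poly_Mapping.keys m)"

definition homog_deg :: "nat \<Rightarrow> 'a::zero pm \<Rightarrow> bool" where
  "homog_deg d p \<longleftrightarrow> (\<forall>m\<in>Poly_Mapping.keys p. mdeg m = d)"

definition homogeneous :: "'a::zero pm \<Rightarrow> bool" where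
  "homogeneous p \<longleftrightarrow> (\<exists>d. homog_deg d p)"

definition psubst :: "(nat \<Rightarrow> 'a::comm_semiring_1 pm) \<Rightarrow> 'a pm \<Rightarrow> 'a pm" where
  "psubst \<sigma> p = (\<Sum>m\<in>Poly_Mapping.keys p. Const (Poly_Mapping.lookup p m) * (\<Prod>i\<in>Poly_Mapping.keys m. \<sigma> i ^ Poly_Mapping.lookup m i))"

definition lin_act :: "'a::comm_semiring_1 mat \<Rightarrow> 'a pm \<Rightarrow> 'a pm" where
  "lin_act A p = psubst (\<lambda>j. \<Sum>k<dim_col A. Const (A $$ (j,k)) * Var k) p"

definition ginv :: "nat \<Rightarrow> 'a::semiring_1 mat set \<Rightarrow> 'a mat \<Rightarrow> 'a mat" where
  "ginv n G g = (THE h. h \<in> G \<and> g * h = 1\<^sub>m n)"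

(* action of g on S(V* ):  g x_j = x_j o g^{-1} = \<Sum>_k (g^{-1})_{jk} x_k *)
definition act_SVd :: "nat \<Rightarrow> 'a::comm_ring_1 mat set \<Rightarrow> 'a mat \<Rightarrow> 'a pm \<Rightarrow> 'a pm" where
  "act_SVd n G g p = lin_act (ginv n G g) p"

(* action of g on S(V):  g y_j = g e_j = \<Sum>_k g_{kj} y_k *)
definition act_SV :: "'a::comm_ring_1 mat \<Rightarrow> 'a pm \<Rightarrow> 'a pm" where
  "act_SV g p = lin_act (transpose_mat g) p"

definition pseudo_reflection :: "nat \<Rightarrow> 'a::field mat \<Rightarrow> bool" where
  "pseudo_reflection n g \<longleftrightarrow> g \<in> carrier_mat n n \<and> kernel_dim (g - 1\<^sub>m n) = n - 1"

inductive_set mat_gen :: "nat \<Rightarrow> 'a::semiring_1 mat set \<Rightarrow> 'a mat set" for n X where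
  one: "1\<^sub>m n \<in> mat_gen n X"
| gen: "x \<in> X \<Longrightarrow> x \<in> mat_gen n X"
| mult: "a \<in> mat_gen n X \<Longrightarrow> b \<in> mat_gen n X \<Longrightarrow> a * b \<in> mat_gen n X"

definition finite_mat_group :: "nat \<Rightarrow> 'a::field mat set \<Rightarrow> bool" where
  "finite_mat_group n G \<longleftrightarrow> finite G \<and> G \<subseteq> carrier_mat n n \<and> 1\<^sub>m n \<in> G \<and>
     (\<forall>a\<in>G. \<forall>b\<in>G. a * b \<in> G) \<and> (\<forall>g\<in>G. \<exists>h\<in>G. g * h = 1\<^sub>m n)"

definition generated_by_pseudo_reflections :: "nat \<Rightarrow> 'a::field mat set \<Rightarrow> bool" where
  "generated_by_pseudo_reflections n G \<longleftrightarrow>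
     G = mat_gen n {g\<in>G. pseudo_reflection n g}"

definition representation :: "nat \<Rightarrow> nat \<Rightarrow> 'a::field mat set \<Rightarrow> ('a mat \<Rightarrow> 'a mat) \<Rightarrow> bool" where
  "representation n r G \<rho> \<longleftrightarrow> (\<forall>g\<in>G. \<rho> g \<in> carrier_mat r r) \<and> \<rho> (1\<^sub>m n) = 1\<^sub>m r \<and>
     (\<forall>a\<in>G. \<forall>b\<in>G. \<rho> (a * b) = \<rho> a * \<rho> b)"

definition linear_character :: "'a::field mat set \<Rightarrow> ('a mat \<Rightarrow> 'a) \<Rightarrow> bool" where
  "linear_character G \<chi> \<longleftrightarrow> (\<forall>g\<in>G. \<chi> g \<noteq> 0) \<and> (\<forall>a\<in>G. \<forall>b\<in>G. \<chi> (a * b) = \<chi> a * \<chi> b)"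

definition inv_SVd :: "nat \<Rightarrow> 'a::field mat set \<Rightarrow> 'a pm set" where
  "inv_SVd n G = {p. in_vars n p \<and> (\<forall>g\<in>G. act_SVd n G g p = p)}"

definition semi_inv_SVd :: "nat \<Rightarrow> 'a::field mat set \<Rightarrow> ('a mat \<Rightarrow> 'a) \<Rightarrow> 'a pm set" where
  "semi_inv_SVd n G \<chi> = {p. in_vars n p \<and> (\<forall>g\<in>G. act_SVd n G g p = Const (\<chi> g) * p)}"

definition inv_SV :: "nat \<Rightarrow> 'a::field mat set \<Rightarrow> 'a pm set" where
  "inv_SV n G = {p. in_vars n p \<and> (\<forall>g\<in>G. act_SV g p = p)}"

definition basic_invariants :: "nat \<Rightarrow> 'a::field mat set \<Rightarrow> (nat \<Rightarrow> 'a pm) \<Rightarrow> bool" where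
  "basic_invariants n G f \<longleftrightarrow>
     (\<forall>i<n. homogeneous (f i) \<and> in_vars n (f i)) \<and>
     (\<forall>Q. in_vars n Q \<and> psubst f Q = 0 \<longrightarrow> Q = 0) \<and>
     inv_SVd n G = {psubst f Q | Q. in_vars n Q}"

definition semi_inv_generator :: "nat \<Rightarrow> 'a::field mat set \<Rightarrow> ('a mat \<Rightarrow> 'a) \<Rightarrow> 'a pm \<Rightarrow> bool" where
  "semi_inv_generator n G \<chi> \<Delta> \<longleftrightarrow> homogeneous \<Delta> \<and>
     semi_inv_SVd n G \<chi> = {q * \<Delta> | q. q \<in> inv_SVd n G} \<and>
     (\<forall>q\<in>inv_SVd n G. q * \<Delta> = 0 \<longrightarrow> q = 0)"

definition homogeneous_vec :: "nat \<Rightarrow> (nat \<Rightarrow> 'a::zero pm) \<Rightarrow> bool" where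
  "homogeneous_vec r w \<longleftrightarrow> (\<exists>d. \<forall>j<r. homog_deg d (w j))"

definition homog_free_basis ::
    "nat \<Rightarrow> 'a::comm_ring_1 pm set \<Rightarrow> (nat \<Rightarrow> 'a pm) set \<Rightarrow> (nat \<Rightarrow> nat \<Rightarrow> 'a pm) \<Rightarrow> bool" where
  "homog_free_basis r R X \<omega> \<longleftrightarrow> (\<forall>i<r. \<omega> i \<in> X \<and> homogeneous_vec r (\<omega> i)) \<and>
     (\<forall>w\<in>X. \<exists>!q. (\<forall>i<r. q i \<in> R) \<and> (\<forall>i\<ge>r. q i = 0) \<and>
                   (\<forall>j<r. w j = (\<Sum>i<r. q i * \<omega> i j)))"

(* (S(V* ) \<otimes> M)^G : w = \<Sum>_k w_k \<otimes> m_k,  g(p \<otimes> m_k) = g p \<otimes> \<Sum>_j (\<rho> g)_{jk} m_j *)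
definition inv_SVd_M :: "nat \<Rightarrow> nat \<Rightarrow> 'a::field mat set \<Rightarrow> ('a mat \<Rightarrow> 'a mat) \<Rightarrow> (nat \<Rightarrow> 'a pm) set" where
  "inv_SVd_M n r G \<rho> = {w. (\<forall>j. in_vars n (w j)) \<and> (\<forall>j\<ge>r. w j = 0) \<and>
     (\<forall>g\<in>G. \<forall>j<r. (\<Sum>k<r. Const (\<rho> g $$ (j,k)) * act_SVd n G g (w k)) = w j)}"

(* (S(V) \<otimes> M* )^G : w = \<Sum>_j w_j \<otimes> eps_j,  g eps_j = \<Sum>_k (\<rho> g^{-1})_{jk} eps_k *)
definition inv_SV_Mdual :: "nat \<Rightarrow> nat \<Rightarrow> 'a::field mat set \<Rightarrow> ('a mat \<Rightarrow> 'a mat) \<Rightarrow> (nat \<Rightarrow> 'a pm) set" where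
  "inv_SV_Mdual n r G \<rho> = {w. (\<forall>j. in_vars n (w j)) \<and> (\<forall>j\<ge>r. w j = 0) \<and>
     (\<forall>g\<in>G. \<forall>k<r. (\<Sum>j<r. Const (\<rho> (ginv n G g) $$ (j,k)) * act_SV g (w j)) = w k)}"

(* Jacobian J_N = det (J_{ij}) where \<omega>_i = \<Sum>_j J_{ij} \<otimes> \<nu>_j *)
definition jacobian :: "nat \<Rightarrow> (nat \<Rightarrow> nat \<Rightarrow> 'a::comm_ring_1 pm) \<Rightarrow> 'a pm" where
  "jacobian r \<omega> = det (mat r r (\<lambda>(i,j). \<omega> i j))"

definition ext_sign :: "nat set \<Rightarrow> nat set \<Rightarrow> 'a::comm_ring_1" where
  "ext_sign I J = (- 1) ^ card {(i,j). i \<in> I \<and> j \<in> J \<and> j < i}"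

(* product in S(V* ) \<otimes> /\M*:  eps_I /\ eps_J = ext_sign I J eps_{I \<union> J} if disjoint, else 0 *)
definition ext_mult :: "(nat set \<Rightarrow> 'a::comm_ring_1 pm) \<Rightarrow> (nat set \<Rightarrow> 'a pm) \<Rightarrow> (nat set \<Rightarrow> 'a pm)" where
  "ext_mult a b = (\<lambda>K. \<Sum>I\<in>Pow K. Const (ext_sign I (K - I)) * a I * b (K - I))"

definition ext_one :: "nat set \<Rightarrow> 'a::comm_ring_1 pm" where
  "ext_one = (\<lambda>K. if K = {} then 1 else 0)"

definition ext_gen :: "nat \<Rightarrow> nat set \<Rightarrow> 'a::comm_ring_1 pm" where
  "ext_gen j = (\<lambda>K. if K = {j} then 1 else 0)"

definition ext_lin :: "nat \<Rightarrow> (nat \<Rightarrow> 'a::comm_ring_1) \<Rightarrow> nat set \<Rightarrow> 'a pm" where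
  "ext_lin r c = (\<lambda>K. \<Sum>k<r. if K = {k} then Const (c k) else 0)"

(* image of eps_I under the map eps_j \<mapsto> \<Sum>_k B_{jk} eps_k *)
definition ext_basis_act :: "'a::comm_ring_1 mat \<Rightarrow> nat set \<Rightarrow> nat set \<Rightarrow> 'a pm" where
  "ext_basis_act B I = foldr (\<lambda>i w. ext_mult (ext_lin (dim_col B) (\<lambda>k. B $$ (i,k))) w)
      (sorted_list_of_set I) ext_one"

definition act_tens :: "nat \<Rightarrow> nat \<Rightarrow> 'a::field mat set \<Rightarrow> ('a mat \<Rightarrow> 'a mat) \<Rightarrow> 'a mat
    \<Rightarrow> (nat set \<Rightarrow> 'a pm) \<Rightarrow> (nat set \<Rightarrow> 'a pm)" where
  "act_tens n r G \<rho> g w = (\<lambda>K. \<Sum>I\<in>Pow {..<r}.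
      act_SVd n G g (w I) * ext_basis_act (\<rho> (ginv n G g)) I K)"

definition tensor_space :: "nat \<Rightarrow> nat \<Rightarrow> (nat set \<Rightarrow> 'a::zero pm) set" where
  "tensor_space n r = {w. (\<forall>I. w I \<noteq> 0 \<longrightarrow> I \<subseteq> {..<r}) \<and> (\<forall>I. in_vars n (w I))}"

definition chi_part :: "nat \<Rightarrow> nat \<Rightarrow> 'a::field mat set \<Rightarrow> ('a mat \<Rightarrow> 'a mat) \<Rightarrow> ('a mat \<Rightarrow> 'a)
    \<Rightarrow> (nat set \<Rightarrow> 'a pm) set" where
  "chi_part n r G \<rho> \<chi> = {w \<in> tensor_space n r.
      \<forall>g\<in>G. act_tens n r G \<rho> g w = (\<lambda>K. Const (\<chi> g) * w K)}"

definition pdiff :: "nat \<Rightarrow> 'a::comm_semiring_1 pm \<Rightarrow> 'a pm" where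
  "pdiff k p = (\<Sum>m\<in>Poly_Mapping.keys p. Poly_Mapping.single (m - Poly_Mapping.single k 1)
                                 (of_nat (Poly_Mapping.lookup m k) * Poly_Mapping.lookup p m))"

definition diff_mono :: "(nat \<Rightarrow>\<^sub>0 nat) \<Rightarrow> 'a::comm_semiring_1 pm \<Rightarrow> 'a pm" where
  "diff_mono m p = foldr (\<lambda>k q. (pdiff k ^^ Poly_Mapping.lookup m k) q) (sorted_list_of_set (Poly_Mapping.keys m)) p"

definition diff_op :: "'a::comm_semiring_1 pm \<Rightarrow> 'a pm \<Rightarrow> 'a pm" where
  "diff_op s p = (\<Sum>m\<in>Poly_Mapping.keys s. Const (Poly_Mapping.lookup s m) * diff_mono m p)"

(* d_i^* = \<Sum>_j \<partial>_{s_j} \<otimes> \<epsilon>_{eps_j}  where \<omega>~_i = \<Sum>_j s_j \<otimes> eps_j *)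
definition dstar :: "nat \<Rightarrow> (nat \<Rightarrow> nat \<Rightarrow> 'a::comm_ring_1 pm) \<Rightarrow> nat
    \<Rightarrow> (nat set \<Rightarrow> 'a pm) \<Rightarrow> (nat set \<Rightarrow> 'a pm)" where
  "dstar r \<omega>t i w = (\<lambda>K. \<Sum>j<r. ext_mult (ext_gen j) (\<lambda>I. diff_op (\<omega>t i j) (w I)) K)"

definition dstar_seq :: "nat \<Rightarrow> (nat \<Rightarrow> nat \<Rightarrow> 'a::comm_ring_1 pm) \<Rightarrow> nat set
    \<Rightarrow> (nat set \<Rightarrow> 'a pm) \<Rightarrow> (nat set \<Rightarrow> 'a pm)" where
  "dstar_seq r \<omega>t I w = foldr (dstar r \<omega>t) (sorted_list_of_set I) w"

definition emb :: "'a::comm_ring_1 pm \<Rightarrow> nat set \<Rightarrow> 'a pm" where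
  "emb p = (\<lambda>K. if K = {} then p else 0)"

definition fmon :: "nat \<Rightarrow> (nat \<Rightarrow> 'a::comm_semiring_1 pm) \<Rightarrow> (nat \<Rightarrow> nat) \<Rightarrow> 'a pm" where
  "fmon n f a = (\<Prod>i<n. f i ^ a i)"

definition exponents :: "nat \<Rightarrow> (nat \<Rightarrow> nat) set" where
  "exponents n = {a. \<forall>i\<ge>n. a i = 0}"

definition F_basis :: "(nat set \<Rightarrow> 'a::field pm) set \<Rightarrow> 'i set \<Rightarrow> ('i \<Rightarrow> nat set \<Rightarrow> 'a pm) \<Rightarrow> bool" where
  "F_basis W X b \<longleftrightarrow> b ` X \<subseteq> W \<and> inj_on b X \<and>
     (\<forall>T c. finite T \<and> T \<subseteq> X \<and> (\<lambda>K. \<Sum>t\<in>T. Const (c t) * b t K) = (\<lambda>K. 0)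
              \<longrightarrow> (\<forall>t\<in>T. c t = 0)) \<and>
     (\<forall>w\<in>W. \<exists>T c. finite T \<and> T \<subseteq> X \<and> w = (\<lambda>K. \<Sum>t\<in>T. Const (c t) * b t K))"

end

theory Submission
  imports Defs "HOL-Analysis.Continuum_Not_Denumerable"
    "HOL-Computational_Algebra.Fundamental_Theorem_Algebra" "HOL-Combinatorics.Permutations"
begin

text \<open>
  Contraction with the products \<open>\<omega>\<^sub>L\<close> of basic derivations sends a \<open>\<chi>\<close>-semi-invariant form to a tuple in
  \<open>S(V*)\<^sup>\<chi> = S(V*)\<^sup>G \<Delta>\<close>, injectively since the Jacobian \<open>J\<close> does not vanish; this bounds the graded dimensions
  from above. The basic derivations of \<open>M\<close> and of \<open>M*\<close> have the same degrees, because the graded pieces of the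
  two modules are dual under the differentiation pairing, so each of the two sets has as many elements in
  bounded degree as the bound allows, and only linear independence remains.

  Let \<open>J'\<close> be the Jacobian of the dual basis. A relation \<open>\<Sum> d\<^sub>I(p\<^sub>I \<Delta>) = 0\<close> is reduced to \<open>\<partial>\<^bsub>J'\<^esub>(p \<Delta>) = 0\<close> by applying
  the operators complementary to a smallest \<open>I\<close>. Over the complex numbers an invariant Hermitian form gives a
  conjugate-linear equivariant map \<open>\<theta>\<close> with \<open>\<theta>(u)(\<partial>)u\<close> positive, and \<open>\<theta>(J)\<close> is a multiple of \<open>J'\<close>; as \<open>J\<close> divides
  \<open>\<Delta>\<close>, this forces \<open>p \<Delta> = 0\<close>. A relation \<open>\<Sum> p\<^sub>I d\<^sub>I\<Delta> = 0\<close> is excluded because the \<open>d\<^sub>I\<Delta>\<close> are harmonic, and by the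
  same positivity no nonzero harmonic polynomial lies in the ideal of the invariants of positive degree.
  For general \<open>F\<close> the finitely many coefficients involved lie in a subfield that embeds into the complex numbers.
\<close>

text \<open>Positivity needs a conjugation, which \<open>F\<close> does not have, and the conjugate
  of a Jacobian exists only after the embedding. Over \<open>F\<close> it is therefore phrased by
  annihilation: \<open>u\<close> is killed by the Jacobians of all tuples of equivariant vectors of
  the dual side with prescribed degrees, a condition that passes to complex combinations. The count
  replaces every spanning argument: up to a given degree a form has as many coordinates as a family
  has members, so independence alone makes the linear system for the coordinates solvable. For the
  second set this also yields forms v_L whose contraction with \<open>\<omega>\<^sub>L\<close> is
  \<open>\<Delta>\<close> and whose other contractions vanish. The first set depends on them: in a
  relation between the \<open>p\<^sub>I d\<^sub>I\<Delta>\<close>, the coefficients of lowest degree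
  give constants \<open>c\<^sub>I\<close> for which
  \<open>\<Sum> c\<^sub>I d\<^sub>I\<Delta>\<close> has coordinates without constant term, and
  expanding in the v_L puts its coefficients in the ideal of the invariants of positive
  degree.\<close>

abbreviation "lk \<equiv> Poly_Mapping.lookup"
abbreviation "sg \<equiv> Poly_Mapping.single"
abbreviation "keys \<equiv> Poly_Mapping.keys"

section \<open>Polynomials as finitely supported coefficient functions\<close>

lemma lk_Const_mult [simp]: "lk (Const c * p) m = c * lk p m"
  unfolding Const_def mult_map_scale_conv_mult[symmetric]
  by (simp add: Poly_Mapping.map.rep_eq when_def)

lemma lk_Const: "lk (Const c) m = (c when m = 0)"
  unfolding Const_def lookup_single by (auto simp: when_def)

lemma Const_0 [simp]: "Const 0 = 0" and Const_1 [simp]: "Const 1 = 1"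
  unfolding Const_def by simp_all

lemma Const_add: "Const (a + b) = Const a + Const b"
  unfolding Const_def by (simp add: single_add)

lemma Const_mult: "Const (a * b) = Const a * Const b"
  unfolding Const_def by (simp add: mult_single)

lemma Const_uminus: "Const (- a) = - Const (a :: 'a :: comm_ring_1)"
  unfolding Const_def by (simp add: single_uminus)

lemma Const_sum: "Const (sum f S) = (\<Sum>i\<in>S. Const (f i))"
  by (induction S rule: infinite_finite_induct) (auto simp: Const_add)

lemma Const_prod: "Const (prod f S) = (\<Prod>i\<in>S. Const (f i))"
  by (induction S rule: infinite_finite_induct) (auto simp: Const_mult)

lemma Const_power: "Const (c ^ k) = Const c ^ k"
  by (induction k) (auto simp: Const_mult)

lemma Const_eq_0 [simp]: "Const c = 0 \<longleftrightarrow> c = 0"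
  unfolding Const_def by (metis lookup_single_eq lookup_zero single_zero)

lemma single_eq_Const_mult: "sg m c = Const c * sg m (1 :: 'a :: comm_semiring_1)"
  unfolding Const_def by (simp add: mult_single)

lemma pm_sum_single: "p = (\<Sum>m\<in>keys p. sg m (lk p m))" for p :: "'b \<Rightarrow>\<^sub>0 'a::comm_monoid_add"
  by (rule poly_mapping_eqI)
     (auto simp: lookup_sum lookup_single when_def sum.delta in_keys_iff)

lemma pm_sum_single_superset:
  assumes "finite S" "keys p \<subseteq> S"
  shows "p = (\<Sum>m\<in>S. sg m (lk p m))"
proof -
  have "(\<Sum>m\<in>S. sg m (lk p m)) = (\<Sum>m\<in>keys p. sg m (lk p m))"
    using assms by (intro sum.mono_neutral_right) (auto simp: in_keys_iff)
  then show ?thesis using pm_sum_single[of p, symmetric] by simp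
qed

lemma mdeg_superset: "finite S \<Longrightarrow> keys m \<subseteq> S \<Longrightarrow> mdeg m = sum (lk m) S"
  unfolding mdeg_def by (rule sum.mono_neutral_left) (auto simp: in_keys_iff)

lemma keys_add_nat: "keys (m + m' :: 'b \<Rightarrow>\<^sub>0 nat) = keys m \<union> keys m'"
  by (auto simp: in_keys_iff lookup_add)

lemma mdeg_add: "mdeg (m + m') = mdeg m + mdeg m'"
proof -
  let ?S = "keys m \<union> keys m'"
  have "mdeg (m + m') = sum (lk (m + m')) ?S" "mdeg m = sum (lk m) ?S" "mdeg m' = sum (lk m') ?S"
    by (rule mdeg_superset; simp add: keys_add_nat)+
  then show ?thesis by (simp add: lookup_add sum.distrib)
qed

lemma mdeg_0 [simp]: "mdeg 0 = 0" unfolding mdeg_def by simp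

lemma mdeg_single [simp]: "mdeg (sg i k) = k"
  unfolding mdeg_def by simp

lemma mdeg_eq_0_iff: "mdeg m = 0 \<longleftrightarrow> m = 0"
proof
  assume "mdeg m = 0"
  then have "\<forall>i\<in>keys m. lk m i = 0" unfolding mdeg_def by simp
  then show "m = 0" by (metis in_keys_iff keys_eq_empty all_not_in_conv)
qed simp

definition vars_in :: "nat set \<Rightarrow> 'a::zero pm \<Rightarrow> bool" where
  "vars_in V p \<longleftrightarrow> (\<forall>m\<in>keys p. keys m \<subseteq> V)"

lemma in_vars_vars_in: "in_vars n p \<longleftrightarrow> vars_in {..<n} p"
  unfolding in_vars_def vars_in_def ..

lemma vars_in_UNIV [simp]: "vars_in UNIV p" unfolding vars_in_def by simp

text \<open>Monomials are peeled one variable at a time, by induction on the degree, so an inductive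
  proof needs no case for the product of two arbitrary polynomials. The set \<open>V\<close> lets
  one argument serve both \<open>n\<close> variables and all variables.\<close>

lemma pm_induct_aux:
  fixes p :: "'a::comm_semiring_1 pm"
  assumes "vars_in V p"
    and C: "\<And>c. P (Const c)"
    and A: "\<And>p q. P p \<Longrightarrow> P q \<Longrightarrow> P (p + q)"
    and M: "\<And>p i. P p \<Longrightarrow> i \<in> V \<Longrightarrow> P (Var i * p)"
  shows "P p"
proof -
  have mono: "P (sg m c)" if "mdeg m = k" "keys m \<subseteq> V" for m c k
    using that
  proof (induction k arbitrary: m)
    case 0
    then have "m = 0" by (simp add: mdeg_eq_0_iff)
    then show ?case using C[of c] by (simp add: Const_def)
  next
    case (Suc k)
    then obtain i where i: "i \<in> keys m" by (metis keys_eq_empty all_not_in_conv mdeg_0 Zero_not_Suc)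
    define m' where "m' = m - sg i 1"
    have m: "m = sg i 1 + m'"
      using i unfolding m'_def
      by (intro poly_mapping_eqI) (auto simp: lookup_add lookup_minus lookup_single when_def in_keys_iff)
    have "mdeg m' = k" using Suc.prems m by (simp add: mdeg_add)
    moreover have "keys m' \<subseteq> V" using Suc.prems m by (simp add: keys_add_nat)
    ultimately have "P (sg m' c)" using Suc.IH by blast
    then have "P (Var i * sg m' c)" using M i Suc.prems by blast
    then show ?case using m by (simp add: Var_def mult_single)
  qed
  have "P (\<Sum>m\<in>S. sg m (lk p m))" if "finite S" "S \<subseteq> keys p" for S
    using that
  proof (induction S rule: finite_induct)
    case empty show ?case using C[of 0] by simp
  next
    case (insert m S)
    then have IH: "P (\<Sum>m\<in>S. sg m (lk p m))" by auto
    have "keys m \<subseteq> V" using assms(1) insert.prems unfolding vars_in_def by auto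
    then have "P (sg m (lk p m))" using mono[OF refl] by simp
    then show ?case using insert.hyps A[OF _ IH] by simp
  qed
  from this[of "keys p"] show ?thesis using pm_sum_single[of p, symmetric] by simp
qed

lemma in_vars_induct [consumes 1, case_names Const add mult]:
  fixes p :: "'a::comm_semiring_1 pm"
  assumes "in_vars n p" "\<And>c. P (Const c)" "\<And>p q. P p \<Longrightarrow> P q \<Longrightarrow> P (p + q)"
    "\<And>p i. P p \<Longrightarrow> i < n \<Longrightarrow> P (Var i * p)"
  shows "P p"
  by (rule pm_induct_aux[of "{..<n}" p P]) (use assms in \<open>simp_all add: in_vars_vars_in\<close>)

lemma pm_induct [case_names Const add mult]:
  fixes p :: "'a::comm_semiring_1 pm"
  assumes "\<And>c. P (Const c)" "\<And>p q. P p \<Longrightarrow> P q \<Longrightarrow> P (p + q)"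
    "\<And>p i. P p \<Longrightarrow> P (Var i * p)"
  shows "P p"
  by (rule pm_induct_aux[of UNIV p P]) (use assms in simp_all)

lemma in_vars_0 [simp]: "in_vars n 0" unfolding in_vars_def by simp
lemma in_vars_Const [simp]: "in_vars n (Const c)" unfolding in_vars_def Const_def by simp
lemma in_vars_1 [simp]: "in_vars n (1 :: 'a :: comm_semiring_1 pm)"
  unfolding in_vars_def by simp
lemma in_vars_Var [simp]: "i < n \<Longrightarrow> in_vars n (Var i)" unfolding in_vars_def Var_def by simp
lemma in_vars_add: "in_vars n p \<Longrightarrow> in_vars n q \<Longrightarrow> in_vars n (p + q)"
  unfolding in_vars_def using keys_add[of p q] by blast
lemma in_vars_uminus: "in_vars n p \<Longrightarrow> in_vars n (- p)" for p :: "'a::ab_group_add pm"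
  unfolding in_vars_def by (simp add: in_keys_iff)
lemma in_vars_diff: "in_vars n p \<Longrightarrow> in_vars n q \<Longrightarrow> in_vars n (p - q)" for p :: "'a::ab_group_add pm"
  using in_vars_add[of n p "- q"] in_vars_uminus[of n q] by simp
lemma in_vars_mult: "in_vars n p \<Longrightarrow> in_vars n q \<Longrightarrow> in_vars n (p * q)"
  unfolding in_vars_def using keys_mult[of p q] by (fastforce simp: keys_add_nat)
lemma in_vars_sum: "(\<And>i. i \<in> S \<Longrightarrow> in_vars n (f i)) \<Longrightarrow> in_vars n (sum f S)"
  by (induction S rule: infinite_finite_induct) (auto simp: in_vars_add)
lemma in_vars_single: "keys m \<subseteq> {..<n} \<Longrightarrow> in_vars n (sg m c)"
  unfolding in_vars_def by simp

lemma homog_deg_0 [simp]: "homog_deg d 0" unfolding homog_deg_def by simp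
lemma homog_deg_add: "homog_deg d p \<Longrightarrow> homog_deg d q \<Longrightarrow> homog_deg d (p + q)"
  unfolding homog_deg_def using keys_add[of p q] by blast
lemma homog_deg_mult: "homog_deg d p \<Longrightarrow> homog_deg e q \<Longrightarrow> homog_deg (d + e) (p * q)"
  unfolding homog_deg_def using keys_mult[of p q] by (fastforce simp: mdeg_add)
lemma homog_deg_Const: "homog_deg 0 (Const c)" unfolding homog_deg_def Const_def by simp
lemma homog_deg_Const_mult: "homog_deg d p \<Longrightarrow> homog_deg d (Const c * p)"
  using homog_deg_mult[OF homog_deg_Const, of d p c] by simp
lemma homog_deg_sum: "(\<And>i. i \<in> S \<Longrightarrow> homog_deg d (f i)) \<Longrightarrow> homog_deg d (sum f S)"
  by (induction S rule: infinite_finite_induct) (auto simp: homog_deg_add)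
lemma homog_deg_Var: "homog_deg 1 (Var i)" unfolding homog_deg_def Var_def by simp
lemma homog_deg_1: "homog_deg 0 (1 :: 'a :: comm_semiring_1 pm)" unfolding homog_deg_def by simp
lemma homog_deg_power: "homog_deg d p \<Longrightarrow> homog_deg (k * d) (p ^ k)" for p :: "'a::comm_semiring_1 pm"
  by (induction k) (auto simp: homog_deg_mult homog_deg_1)
lemma homog_deg_prod: "finite S \<Longrightarrow> (\<And>i. i \<in> S \<Longrightarrow> homog_deg (d i) (f i)) \<Longrightarrow> homog_deg (sum d S) (prod f S)"
  for f :: "_ \<Rightarrow> 'a::comm_semiring_1 pm"
  by (induction S rule: finite_induct) (auto simp: homog_deg_mult homog_deg_1)
lemma homog_deg_single: "homog_deg (mdeg m) (sg m c)" unfolding homog_deg_def by simp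
lemma homog_deg_lk: "homog_deg d p \<longleftrightarrow> (\<forall>m. lk p m \<noteq> 0 \<longrightarrow> mdeg m = d)"
  unfolding homog_deg_def by (auto simp: in_keys_iff)

section \<open>Substitution homomorphisms and linear changes of variables\<close>

definition ev :: "(nat \<Rightarrow> 'a::comm_semiring_1 pm) \<Rightarrow> (nat \<Rightarrow>\<^sub>0 nat) \<Rightarrow> 'a pm" where
  "ev \<sigma> m = (\<Prod>i\<in>keys m. \<sigma> i ^ lk m i)"

lemma ev_superset: "finite S \<Longrightarrow> keys m \<subseteq> S \<Longrightarrow> ev \<sigma> m = (\<Prod>i\<in>S. \<sigma> i ^ lk m i)"
  unfolding ev_def by (rule prod.mono_neutral_left) (auto simp: in_keys_iff)

lemma ev_add: "ev \<sigma> (m + m') = ev \<sigma> m * ev \<sigma> m'"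
proof -
  let ?S = "keys m \<union> keys m'"
  have "ev \<sigma> (m + m') = (\<Prod>i\<in>?S. \<sigma> i ^ lk (m + m') i)"
    "ev \<sigma> m = (\<Prod>i\<in>?S. \<sigma> i ^ lk m i)" "ev \<sigma> m' = (\<Prod>i\<in>?S. \<sigma> i ^ lk m' i)"
    by (rule ev_superset; simp add: keys_add_nat)+
  then show ?thesis by (simp add: lookup_add power_add prod.distrib)
qed

lemma psubst_superset:
  "finite S \<Longrightarrow> keys p \<subseteq> S \<Longrightarrow> psubst \<sigma> p = (\<Sum>m\<in>S. Const (lk p m) * ev \<sigma> m)"
  unfolding psubst_def ev_def[symmetric]
  by (rule sum.mono_neutral_left) (auto simp: in_keys_iff)

lemma psubst_add: "psubst \<sigma> (p + q) = psubst \<sigma> p + psubst \<sigma> q"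
proof -
  let ?S = "keys p \<union> keys q"
  have "psubst \<sigma> (p + q) = (\<Sum>m\<in>?S. Const (lk (p + q) m) * ev \<sigma> m)"
    "psubst \<sigma> p = (\<Sum>m\<in>?S. Const (lk p m) * ev \<sigma> m)"
    "psubst \<sigma> q = (\<Sum>m\<in>?S. Const (lk q m) * ev \<sigma> m)"
    by (rule psubst_superset; simp add: keys_add)+
  then show ?thesis by (simp add: lookup_add Const_add sum.distrib algebra_simps)
qed

lemma psubst_single: "psubst \<sigma> (sg m c) = Const c * ev \<sigma> m"
  by (cases "c = 0") (auto simp: psubst_def ev_def)

lemma psubst_0 [simp]: "psubst \<sigma> 0 = 0" by (simp add: psubst_def)
lemma psubst_sum: "psubst \<sigma> (sum f S) = (\<Sum>i\<in>S. psubst \<sigma> (f i))"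
  by (induction S rule: infinite_finite_induct) (auto simp: psubst_add)
lemma psubst_Const [simp]: "psubst \<sigma> (Const c) = Const c"
  unfolding Const_def psubst_single by (simp add: ev_def Const_def)
lemma psubst_1 [simp]: "psubst \<sigma> 1 = 1" using psubst_Const[of \<sigma> 1] by simp
lemma psubst_Var [simp]: "psubst \<sigma> (Var i) = \<sigma> i"
  unfolding Var_def psubst_single by (simp add: ev_def)

lemma psubst_mult: "psubst \<sigma> (p * q) = psubst \<sigma> p * psubst \<sigma> q"
proof -
  have "psubst \<sigma> (p * q) = psubst \<sigma> ((\<Sum>m\<in>keys p. sg m (lk p m)) * (\<Sum>m\<in>keys q. sg m (lk q m)))"
    using pm_sum_single[of p, symmetric] pm_sum_single[of q, symmetric] by simp
  also have "\<dots> = (\<Sum>m\<in>keys p. \<Sum>m'\<in>keys q. psubst \<sigma> (sg m (lk p m) * sg m' (lk q m')))"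
    by (simp add: sum_product psubst_sum)
  also have "\<dots> = (\<Sum>m\<in>keys p. \<Sum>m'\<in>keys q. (Const (lk p m) * ev \<sigma> m) * (Const (lk q m') * ev \<sigma> m'))"
    by (simp add: mult_single psubst_single Const_mult ev_add algebra_simps)
  also have "\<dots> = psubst \<sigma> p * psubst \<sigma> q"
    by (simp add: psubst_def ev_def[symmetric] sum_product)
  finally show ?thesis .
qed

lemma psubst_hom: "comm_ring_hom (psubst \<sigma> :: 'a::comm_ring_1 pm \<Rightarrow> 'a pm)"
  by unfold_locales (auto simp: psubst_add psubst_mult)

lemma psubst_compose: "psubst \<sigma> (psubst \<tau> p) = psubst (\<lambda>i. psubst \<sigma> (\<tau> i)) p"
  by (induction p rule: pm_induct) (auto simp: psubst_add psubst_mult)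

lemma psubst_cong: "in_vars n p \<Longrightarrow> (\<And>i. i < n \<Longrightarrow> \<sigma> i = \<tau> i) \<Longrightarrow> psubst \<sigma> p = psubst \<tau> p"
  by (induction p rule: in_vars_induct) (auto simp: psubst_add psubst_mult)

lemma psubst_id: "psubst Var p = p"
  by (induction p rule: pm_induct) (auto simp: psubst_add psubst_mult)

lemma in_vars_psubst: "(\<And>i. in_vars n (\<sigma> i)) \<Longrightarrow> in_vars n (psubst \<sigma> p)"
  by (induction p rule: pm_induct) (auto simp: psubst_add psubst_mult in_vars_add in_vars_mult)

lemma homog_deg_psubst:
  assumes "\<And>i. homog_deg 1 (\<sigma> i)" "homog_deg d p"
  shows "homog_deg d (psubst \<sigma> p)"
proof -
  have "homog_deg d (Const (lk p m) * ev \<sigma> m)" if "m \<in> keys p" for m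
  proof -
    have "homog_deg (\<Sum>i\<in>keys m. lk m i * 1) (ev \<sigma> m)" unfolding ev_def
      by (intro homog_deg_prod homog_deg_power assms) auto
    then show ?thesis using that assms(2) unfolding homog_deg_def[of d p]
      by (intro homog_deg_Const_mult) (auto simp: mdeg_def)
  qed
  then show ?thesis unfolding psubst_def ev_def[symmetric] by (rule homog_deg_sum)
qed

text \<open>Row \<open>j\<close> of \<open>A\<close> holds the image of variable \<open>j\<close>.
  The number \<open>N\<close> of target variables is independent of the source, so a substitution
  may pass to more variables.\<close>

definition lsub :: "nat \<Rightarrow> (nat \<Rightarrow> nat \<Rightarrow> 'a::comm_semiring_1) \<Rightarrow> 'a pm \<Rightarrow> 'a pm" where
  "lsub N A = psubst (\<lambda>j. \<Sum>k<N. Const (A j k) * Var k)"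

lemma lin_act_lsub: "lin_act M = lsub (dim_col M) (\<lambda>j k. M $$ (j, k))"
  by (auto simp: lin_act_def lsub_def)

lemma lsub_hom: "comm_ring_hom (lsub N A :: 'a::comm_ring_1 pm \<Rightarrow> 'a pm)"
  unfolding lsub_def by (rule psubst_hom)

lemma lsub_add: "lsub N A (p + q) = lsub N A p + lsub N A q"
  and lsub_mult: "lsub N A (p * q) = lsub N A p * lsub N A q"
  and lsub_Const [simp]: "lsub N A (Const c) = Const c"
  and lsub_0 [simp]: "lsub N A 0 = 0"
  and lsub_sum: "lsub N A (sum f S) = (\<Sum>i\<in>S. lsub N A (f i))"
  and lsub_Var: "lsub N A (Var j) = (\<Sum>k<N. Const (A j k) * Var k)"
  unfolding lsub_def by (auto simp: psubst_add psubst_mult psubst_sum)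

lemma in_vars_lsub [simp]: "in_vars N (lsub N A p)"
  unfolding lsub_def by (rule in_vars_psubst) (auto intro!: in_vars_sum in_vars_mult)

lemma homog_deg_lsub: "homog_deg d p \<Longrightarrow> homog_deg d (lsub N A p)"
  unfolding lsub_def by (rule homog_deg_psubst) (auto intro!: homog_deg_sum homog_deg_Const_mult homog_deg_Var[unfolded One_nat_def])

lemma lsub_cong:
  "in_vars n p \<Longrightarrow> (\<And>i k. i < n \<Longrightarrow> k < N \<Longrightarrow> A i k = B i k) \<Longrightarrow> lsub N A p = lsub N B p"
  unfolding lsub_def by (rule psubst_cong) auto

text \<open>With images listed by rows, the outer substitution is the right-hand factor of the
  matrix product. This is the origin of the reversed order in \<open>a_mul\<close> and
  \<open>a'_mul\<close>.\<close>

lemma lsub_compose: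
  assumes "in_vars n p"
  shows "lsub N A (lsub K B p) = lsub N (\<lambda>j k. \<Sum>l<K. B j l * A l k) p"
proof -
  have "lsub N A (\<Sum>k<K. Const (B j k) * Var k) = (\<Sum>k<N. Const (\<Sum>l<K. B j l * A l k) * Var k)" for j
    by (simp add: lsub_sum lsub_mult lsub_Var Const_sum sum_distrib_left sum_distrib_right
        Const_mult mult.assoc) (rule sum.swap)
  then show ?thesis unfolding lsub_def[of K] lsub_def[of N "\<lambda>j k. \<Sum>l<K. B j l * A l k"]
    by (simp add: lsub_def psubst_compose)
qed

lemma lsub_id:
  assumes "in_vars n p" "\<And>i k. i < n \<Longrightarrow> k < n \<Longrightarrow> A i k = (if i = k then 1 else 0)"
  shows "lsub n A p = p"
proof -
  have "(\<Sum>k<n. Const (A i k) * Var k) = Var i" if "i < n" for i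
  proof -
    have "(\<Sum>k<n. Const (A i k) * Var k) = (\<Sum>k<n. if k = i then Var k else 0)"
      using that assms(2) by (intro sum.cong) auto
    then show ?thesis using that by simp
  qed
  then have "lsub n A p = psubst Var p" unfolding lsub_def
    by (intro psubst_cong[OF assms(1)]) auto
  then show ?thesis by (simp add: psubst_id)
qed

lemma lk_0_Var_mult: "lk (Var k * q) 0 = 0"
proof (rule ccontr)
  assume "lk (Var k * q) 0 \<noteq> 0"
  then have "0 \<in> keys (Var k * q)" by (simp add: in_keys_iff)
  then obtain a b where ab: "0 = a + b" "a \<in> keys (Var k :: 'a pm)" using keys_mult[of "Var k" q] by blast
  then have "a = sg k 1" by (auto simp: Var_def split: if_splits)
  then have "mdeg (0 :: nat \<Rightarrow>\<^sub>0 nat) = 1 + mdeg b" by (simp only: ab(1) mdeg_add mdeg_single)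
  then show False by simp
qed

subsection \<open>Differential operators and the pairing\<close>

lemma lk_pdiff: "lk (pdiff k p) m = of_nat (lk m k + 1) * lk p (m + sg k 1)"
proof -
  have eq: "m' - sg k 1 = m \<and> lk m' k \<noteq> 0 \<longleftrightarrow> m' = m + sg k 1" for m'
    by (auto simp: poly_mapping_eq_iff fun_eq_iff lookup_add lookup_minus lookup_single when_def
        split: if_splits)
  have "lk (pdiff k p) m =
      (\<Sum>m'\<in>keys p. if m' - sg k 1 = m then of_nat (lk m' k) * lk p m' else 0)"
    unfolding pdiff_def by (simp add: lookup_sum lookup_single when_def)
  also have "\<dots> = (\<Sum>m'\<in>keys p. if m' = m + sg k 1 then of_nat (lk m' k) * lk p m' else 0)"
  proof (rule sum.cong[OF refl])
    fix m'
    show "(if m' - sg k 1 = m then of_nat (lk m' k) * lk p m' else 0) =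
      (if m' = m + sg k 1 then of_nat (lk m' k) * lk p m' else 0)"
    proof (cases "lk m' k = 0")
      case False
      then show ?thesis using eq[of m'] by argo
    qed simp
  qed
  also have "\<dots> = of_nat (lk m k + 1) * lk p (m + sg k 1)"
    by (auto simp: in_keys_iff lookup_add)
  finally show ?thesis .
qed

lemma lk_pdiff_power:
  "lk ((pdiff k ^^ e) p) m = pochhammer (of_nat (lk m k) + 1) e * lk p (m + sg k e)"
proof (induction e arbitrary: m)
  case 0 then show ?case by simp
next
  case (Suc e)
  have "m + sg k 1 + sg k e = m + sg k (Suc e)"
    by (simp add: add.assoc single_add[symmetric])
  then show ?case using Suc by (simp add: lk_pdiff pochhammer_rec lookup_add add.commute algebra_simps)
qed

text \<open>The factor produced by differentiation: applying the monomial operator \<open>m\<close>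
  to the monomial \<open>m + m'\<close> gives \<open>dc m m'\<close> times \<open>m'\<close>. In
  each variable it is a rising factorial starting above the remaining exponent.\<close>

definition dc :: "(nat \<Rightarrow>\<^sub>0 nat) \<Rightarrow> (nat \<Rightarrow>\<^sub>0 nat) \<Rightarrow> 'a::comm_semiring_1" where
  "dc m m' = (\<Prod>i\<in>keys m. pochhammer (of_nat (lk m' i) + 1) (lk m i))"

lemma dc_superset:
  "finite S \<Longrightarrow> keys m \<subseteq> S \<Longrightarrow> dc m m' = (\<Prod>i\<in>S. pochhammer (of_nat (lk m' i) + 1) (lk m i))"
  unfolding dc_def by (rule prod.mono_neutral_left) (auto simp: in_keys_iff)

lemma lk_diff_mono: "lk (diff_mono m p) m' = dc m m' * lk p (m + m')"
proof -
  have *: "lk (foldr (\<lambda>k q. (pdiff k ^^ lk m k) q) ks p) m' =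
     (\<Prod>i\<in>set ks. pochhammer (of_nat (lk m' i) + 1) (lk m i)) * lk p (m' + (\<Sum>i\<in>set ks. sg i (lk m i)))"
    if "distinct ks" for ks m'
    using that
  proof (induction ks arbitrary: m')
    case Nil then show ?case by simp
  next
    case (Cons k ks)
    have l: "lk (m' + sg k (lk m k)) i = lk m' i" if "i \<in> set ks" for i
      using Cons.prems that by (auto simp: lookup_add lookup_single when_def)
    have "lk (foldr (\<lambda>k q. (pdiff k ^^ lk m k) q) (k # ks) p) m' =
       pochhammer (of_nat (lk m' k) + 1) (lk m k) *
        ((\<Prod>i\<in>set ks. pochhammer (of_nat (lk m' i) + 1) (lk m i))
         * lk p (m' + sg k (lk m k) + (\<Sum>i\<in>set ks. sg i (lk m i))))"
      using Cons by (simp add: lk_pdiff_power l cong: prod.cong)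
    then show ?case using Cons.prems by (simp add: algebra_simps)
  qed
  have m: "(\<Sum>i\<in>keys m. sg i (lk m i)) = m" using pm_sum_single[of m, symmetric] by simp
  show ?thesis unfolding diff_mono_def dc_def
    by (subst *) (auto simp: m add.commute)
qed

lemma dc_add: "dc (m1 + m2) m' = dc m1 m' * (dc m2 (m1 + m') :: 'a::comm_semiring_1)"
proof -
  let ?S = "keys m1 \<union> keys m2"
  have "dc (m1 + m2) m' = (\<Prod>i\<in>?S. pochhammer (of_nat (lk m' i) + 1 :: 'a) (lk (m1 + m2) i))"
    "dc m1 m' = (\<Prod>i\<in>?S. pochhammer (of_nat (lk m' i) + 1 :: 'a) (lk m1 i))"
    "dc m2 (m1 + m') = (\<Prod>i\<in>?S. pochhammer (of_nat (lk (m1 + m') i) + 1 :: 'a) (lk m2 i))"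
    by (rule dc_superset; simp add: keys_add_nat)+
  moreover have "pochhammer (x + 1) (a + b) = pochhammer (x + 1) a * pochhammer (of_nat a + x + 1) b"
    for x :: 'a and a b
    by (simp add: pochhammer_product' add.commute add.left_commute)
  ultimately show ?thesis by (simp add: lookup_add prod.distrib)
qed

lemma lk_diff_op_superset:
  assumes "finite S" "keys s \<subseteq> S"
  shows "lk (diff_op s p) m' = (\<Sum>m\<in>S. lk s m * dc m m' * lk p (m + m'))"
proof -
  have "lk (diff_op s p) m' = (\<Sum>m\<in>keys s. lk s m * dc m m' * lk p (m + m'))"
    unfolding diff_op_def by (simp add: lookup_sum lk_diff_mono mult.assoc)
  also have "\<dots> = (\<Sum>m\<in>S. lk s m * dc m m' * lk p (m + m'))"
    using assms by (intro sum.mono_neutral_left) (auto simp: in_keys_iff)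
  finally show ?thesis .
qed

lemmas lk_diff_op = lk_diff_op_superset[OF finite_keys order_refl]

lemma diff_op_add_left: "diff_op (s + t) p = diff_op s p + diff_op t p"
proof (rule poly_mapping_eqI)
  fix m'
  let ?S = "keys s \<union> keys t"
  have "lk (diff_op (s + t) p) m' = (\<Sum>m\<in>?S. lk (s + t) m * dc m m' * lk p (m + m'))"
    "lk (diff_op s p) m' = (\<Sum>m\<in>?S. lk s m * dc m m' * lk p (m + m'))"
    "lk (diff_op t p) m' = (\<Sum>m\<in>?S. lk t m * dc m m' * lk p (m + m'))"
    by (rule lk_diff_op_superset; simp add: keys_add)+
  then show "lk (diff_op (s + t) p) m' = lk (diff_op s p + diff_op t p) m'"
    by (simp add: lookup_add sum.distrib algebra_simps)
qed

lemma diff_op_add_right: "diff_op s (p + q) = diff_op s p + diff_op s q"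
  by (rule poly_mapping_eqI) (simp add: lk_diff_op lookup_add sum.distrib algebra_simps)

lemma diff_op_0_left [simp]: "diff_op 0 p = 0" by (simp add: diff_op_def)
lemma diff_op_0_right [simp]: "diff_op s 0 = 0" by (rule poly_mapping_eqI) (simp add: lk_diff_op)
lemma diff_op_sum_left: "diff_op (sum f S) p = (\<Sum>i\<in>S. diff_op (f i) p)"
  by (induction S rule: infinite_finite_induct) (auto simp: diff_op_add_left)
lemma diff_op_sum_right: "diff_op s (sum f S) = (\<Sum>i\<in>S. diff_op s (f i))"
  by (induction S rule: infinite_finite_induct) (auto simp: diff_op_add_right)
lemma diff_op_single: "diff_op (sg m c) p = Const c * diff_mono m p"
  by (cases "c = 0") (auto simp: diff_op_def)
lemma diff_op_Const_left [simp]: "diff_op (Const c) p = Const c * p"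
  unfolding Const_def[of c] diff_op_single by (simp add: diff_mono_def Const_def)
lemma diff_op_1_left [simp]: "diff_op 1 p = p"
  using diff_op_Const_left[of 1 p] by simp
lemma diff_op_Const_mult_right: "diff_op s (Const c * p) = Const c * diff_op s p"
  by (rule poly_mapping_eqI) (simp add: lk_diff_op sum_distrib_left mult.left_commute)

lemma diff_mono_add: "diff_mono (m1 + m2) p = diff_mono m1 (diff_mono m2 p)"
  by (rule poly_mapping_eqI) (simp add: lk_diff_mono dc_add algebra_simps)

lemma diff_mono_Const_mult: "diff_mono m (Const c * p) = Const c * diff_mono m p"
  by (rule poly_mapping_eqI) (simp add: lk_diff_mono mult.left_commute)

lemma diff_mono_sum: "diff_mono m (sum f S) = (\<Sum>i\<in>S. diff_mono m (f i))"
  by (rule poly_mapping_eqI) (simp add: lk_diff_mono lookup_sum sum_distrib_left)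

text \<open>On monomials this is the multiplicativity \<open>dc_add\<close> of the differentiation
  factors. All later commutations of constant-coefficient operators come from it.\<close>

lemma diff_op_mult: "diff_op (s * t) p = diff_op s (diff_op t p)"
proof -
  have "diff_op (s * t) p = diff_op ((\<Sum>m\<in>keys s. sg m (lk s m)) * (\<Sum>m\<in>keys t. sg m (lk t m))) p"
    using pm_sum_single[of s, symmetric] pm_sum_single[of t, symmetric] by simp
  also have "\<dots> = (\<Sum>m\<in>keys s. \<Sum>m'\<in>keys t. diff_op (sg m (lk s m) * sg m' (lk t m')) p)"
    by (simp only: sum_product diff_op_sum_left)
  also have "\<dots> = (\<Sum>m\<in>keys s. diff_op (sg m (lk s m)) (\<Sum>m'\<in>keys t. diff_op (sg m' (lk t m')) p))"
    by (simp add: mult_single diff_op_single diff_mono_add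
        Const_mult diff_mono_Const_mult diff_mono_sum sum_distrib_left mult.assoc)
  also have "\<dots> = diff_op (\<Sum>m\<in>keys s. sg m (lk s m)) (diff_op (\<Sum>m'\<in>keys t. sg m' (lk t m')) p)"
    by (simp add: diff_op_sum_left)
  also have "\<dots> = diff_op s (diff_op t p)"
    using pm_sum_single[of s, symmetric] pm_sum_single[of t, symmetric] by simp
  finally show ?thesis .
qed

lemma diff_op_commute: "diff_op s (diff_op t p) = diff_op t (diff_op s p)"
  by (metis diff_op_mult mult.commute)

lemma diff_op_Var: "diff_op (Var k) p = pdiff k p"
  by (rule poly_mapping_eqI) (auto simp: Var_def diff_op_single lk_diff_mono lk_pdiff dc_def add.commute)

lemma in_vars_diff_op:
  assumes "in_vars n p" shows "in_vars n (diff_op s p)"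
  unfolding in_vars_def
proof
  fix m' assume "m' \<in> keys (diff_op s p)"
  then have "(\<Sum>m\<in>keys s. lk s m * dc m m' * lk p (m + m')) \<noteq> 0"
    by (simp add: in_keys_iff lk_diff_op)
  then obtain m where "lk s m * dc m m' * lk p (m + m') \<noteq> 0"
    by (rule sum.not_neutral_contains_not_neutral)
  then have "lk p (m + m') \<noteq> 0" by (metis mult_zero_right)
  then have "m + m' \<in> keys p" by (auto simp: in_keys_iff)
  then have "keys (m + m') \<subseteq> {..<n}" using assms by (auto simp: in_vars_def)
  then show "keys m' \<subseteq> {..<n}" by (simp add: keys_add_nat)
qed

lemma diff_op_homog:
  assumes "homog_deg d s" "homog_deg e p" "lk (diff_op s p) m \<noteq> 0"
  shows "d + mdeg m = e"
proof -
  obtain m' where "m' \<in> keys s" "lk s m' * dc m' m * lk p (m' + m) \<noteq> 0"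
    using assms(3) by (auto simp: lk_diff_op elim!: sum.not_neutral_contains_not_neutral)
  then have "lk s m' \<noteq> 0" "lk p (m' + m) \<noteq> 0" by (auto simp: in_keys_iff)
  then have "mdeg m' = d" "mdeg (m' + m) = e" using assms(1,2) by (simp_all add: homog_deg_lk)
  then show ?thesis by (simp add: mdeg_add)
qed

text \<open>The pairing of the symmetric algebras of V and of its dual by differentiation. It is
  diagonal on monomials with the factorials \<open>mfact m\<close> as entries, hence nondegenerate
  in characteristic zero, and by \<open>br_mult\<close> multiplication by \<open>t\<close> is
  adjoint to \<open>diff_op t\<close>.\<close>

definition br :: "'a::comm_semiring_1 pm \<Rightarrow> 'a pm \<Rightarrow> 'a" where
  "br s p = lk (diff_op s p) 0"

lemma br_mult: "br (s * t) p = br s (diff_op t p)"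
  unfolding br_def by (simp add: diff_op_mult)

lemma br_add_left: "br (s + t) p = br s p + br t p"
  and br_add_right: "br s (p + q) = br s p + br s q"
  and br_sum_left: "br (sum f S) p = (\<Sum>i\<in>S. br (f i) p)"
  and br_sum_right: "br s (sum f' S) = (\<Sum>i\<in>S. br s (f' i))"
  and br_Const_left: "br (Const c * s) p = c * br s p"
  and br_Const_right: "br s (Const c * p) = c * br s p"
  and br_0_left [simp]: "br 0 p = 0"
  and br_0_right [simp]: "br s 0 = 0"
  unfolding br_def
  by (simp_all add: diff_op_add_left diff_op_add_right diff_op_sum_left diff_op_sum_right
      lookup_add lookup_sum diff_op_mult diff_op_Const_mult_right)

definition mfact :: "(nat \<Rightarrow>\<^sub>0 nat) \<Rightarrow> nat" where "mfact m = (\<Prod>i\<in>keys m. fact (lk m i))"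

lemma mfact_pos: "mfact m > 0" unfolding mfact_def by (simp add: prod_pos)

lemma dc_0: "dc m 0 = (of_nat (mfact m) :: 'a::comm_semiring_1)"
  using pochhammer_of_nat[of 1, where ?'a = 'a]
  unfolding dc_def mfact_def by (simp add: pochhammer_fact)

lemma br_eq: "br s p = (\<Sum>m\<in>keys s. lk s m * of_nat (mfact m) * lk p m)"
  unfolding br_def by (simp add: lk_diff_op dc_0)

lemma br_single: "br (sg m c) p = c * of_nat (mfact m) * lk p m"
  by (cases "c = 0") (auto simp: br_eq)

lemma pdiff_add: "pdiff k (p + q) = pdiff k p + pdiff k q"
  by (simp add: diff_op_Var[symmetric] diff_op_add_right)

lemma pdiff_Const_mult: "pdiff k (Const c * p) = Const c * pdiff k p"
  by (simp add: diff_op_Var[symmetric] diff_op_Const_mult_right)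

lemma pdiff_sum: "pdiff k (sum f S) = (\<Sum>i\<in>S. pdiff k (f i))"
  by (simp add: diff_op_Var[symmetric] diff_op_sum_right)

lemma pdiff_Const [simp]: "pdiff k (Const c) = 0"
proof (rule poly_mapping_eqI)
  fix m
  have "mdeg (m + sg k 1) \<noteq> 0" by (simp add: mdeg_add)
  then have "m + sg k 1 \<noteq> 0" by (metis mdeg_0)
  then show "lk (pdiff k (Const c)) m = lk 0 m" by (simp add: lk_pdiff lk_Const when_def)
qed

lemma pdiff_single: "pdiff k (sg m c) = sg (m - sg k 1) (of_nat (lk m k) * c)"
  by (cases "c = 0") (auto simp: pdiff_def)

lemma pdiff_Var_mult: "pdiff k (Var i * p) = (if k = i then p else 0) + Var i * pdiff k p"
proof -
  have mono: "pdiff k (Var i * sg m c) = (if k = i then sg m c else 0) + Var i * pdiff k (sg m c)" for m c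
  proof (cases "lk m k = 0")
    case True
    then have "sg i 1 + m - sg k 1 = m" if "k = i" using that by simp
    then show ?thesis using True
      by (auto simp: Var_def mult_single pdiff_single lookup_add lookup_single when_def)
  next
    case False
    then have "sg i 1 + m - sg k 1 = sg i 1 + (m - sg k 1)"
      by (intro poly_mapping_eqI) (auto simp: lookup_add lookup_minus lookup_single when_def)
    moreover have "sg i 1 + m - sg k 1 = m" if "k = i" using that by simp
    ultimately show ?thesis
      by (auto simp: Var_def mult_single pdiff_single lookup_add lookup_single when_def
          single_add[symmetric] algebra_simps)
  qed
  have "pdiff k (Var i * (\<Sum>m\<in>keys p. sg m (lk p m))) =
     (if k = i then (\<Sum>m\<in>keys p. sg m (lk p m)) else 0) + Var i * pdiff k (\<Sum>m\<in>keys p. sg m (lk p m))"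
    by (simp add: sum_distrib_left pdiff_sum mono sum.distrib)
  then show ?thesis using pm_sum_single[of p, symmetric] by simp
qed

text \<open>The chain rule. The coefficient is cut off at \<open>N\<close> because only variables
  below \<open>N\<close> occur in the image.\<close>

lemma pdiff_lsub:
  assumes "in_vars n u"
  shows "pdiff i (lsub N A u) = (\<Sum>k<n. Const (if i < N then A k i else 0) * lsub N A (pdiff k u))"
  using assms
proof (induction u rule: in_vars_induct)
  case (Const c) then show ?case by simp
next
  case (add p q)
  then show ?case by (simp add: lsub_add pdiff_add sum.distrib algebra_simps)
next
  case (mult p j)
  have L: "pdiff i ((\<Sum>k<N. Const (A j k) * Var k) * p) =
      Const (if i < N then A j i else 0) * p + (\<Sum>k<N. Const (A j k) * Var k) * pdiff i p" for p :: "'a pm"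
  proof -
    have "pdiff i ((\<Sum>k<N. Const (A j k) * Var k) * p) =
      (\<Sum>k<N. Const (A j k) * ((if i = k then p else 0) + Var k * pdiff i p))"
      by (simp add: sum_distrib_right pdiff_sum mult.assoc pdiff_Const_mult pdiff_Var_mult)
    also have "\<dots> = (\<Sum>k<N. if i = k then Const (A j k) * p else 0) + (\<Sum>k<N. Const (A j k) * Var k) * pdiff i p"
      by (simp add: distrib_left sum.distrib sum_distrib_right mult.assoc if_distrib[of "\<lambda>x. _ * x"] cong: if_cong)
    finally show ?thesis by auto
  qed
  have "(\<Sum>k<n. Const (if i < N then A k i else 0) * lsub N A (pdiff k (Var j * p))) =
     (\<Sum>k<n. if k = j then Const (if i < N then A k i else 0) * lsub N A p else 0) +
     (\<Sum>k<N. Const (A j k) * Var k) * (\<Sum>k<n. Const (if i < N then A k i else 0) * lsub N A (pdiff k p))"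
    by (simp add: pdiff_Var_mult lsub_add lsub_mult lsub_Var distrib_left sum.distrib sum_distrib_left
         mult.left_commute if_distrib[of "\<lambda>x. _ * x"] if_distrib[of "lsub N A"] cong: if_cong)
  then show ?case using mult by (simp add: lsub_mult lsub_Var L)
qed

text \<open>A substitution is adjoint to the transposed one. Splitting a variable off
  \<open>s\<close> turns it into a derivative on the other side, which the chain rule carries
  through the transposed substitution.\<close>

lemma br_lsub:
  assumes "in_vars n s" "in_vars N u"
  shows "br (lsub N A s) u = br s (lsub n (\<lambda>j k. A k j) u)"
  using assms
proof (induction s arbitrary: u rule: in_vars_induct)
  case (Const c)
  \<comment> \<open>Pairing with a constant sees only the constant term, which a linear substitution
    preserves.\<close>
  have "lk (lsub n B u) 0 = lk u 0" for B :: "nat \<Rightarrow> nat \<Rightarrow> 'a"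
    using Const
  proof (induction u rule: in_vars_induct)
    case (mult p i)
    then show ?case by (simp add: lsub_mult lsub_Var sum_distrib_right lookup_sum mult.assoc lk_0_Var_mult)
  qed (auto simp: lsub_add lookup_add)
  then show ?case by (simp add: br_def)
next
  case (add p q)
  then show ?case by (simp add: lsub_add br_add_left)
next
  case (mult p i)
  have "br (lsub N A (Var i * p)) u = (\<Sum>k<N. A i k * br (lsub N A p) (pdiff k u))"
  proof -
    have "br (lsub N A (Var i * p)) u = br (\<Sum>k<N. Const (A i k) * (lsub N A p * Var k)) u"
      by (simp add: lsub_mult lsub_Var sum_distrib_left sum_distrib_right mult_ac)
    also have "\<dots> = (\<Sum>k<N. A i k * br (lsub N A p) (pdiff k u))"
      unfolding br_sum_left br_Const_left unfolding br_mult diff_op_Var ..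
    finally show ?thesis .
  qed
  also have "\<dots> = (\<Sum>k<N. A i k * br p (lsub n (\<lambda>j k. A k j) (pdiff k u)))"
    using mult.IH in_vars_diff_op[OF mult.prems, of "Var _"] by (simp add: diff_op_Var)
  also have "\<dots> = br p (pdiff i (lsub n (\<lambda>j k. A k j) u))"
    using mult by (simp add: pdiff_lsub[of N] br_sum_right br_Const_right)
  also have "\<dots> = br (p * Var i) (lsub n (\<lambda>j k. A k j) u)"
    unfolding br_mult diff_op_Var ..
  finally show ?case by (simp add: mult.commute)
qed

lemma br_nondegenerate:
  fixes p q :: "'a::field_char_0 pm"
  assumes "\<And>m. keys m \<subseteq> {..<n} \<Longrightarrow> br (sg m 1) p = br (sg m 1) q" "in_vars n p" "in_vars n q"
  shows "p = q"
proof (rule poly_mapping_eqI)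
  fix m
  show "lk p m = lk q m"
  proof (cases "keys m \<subseteq> {..<n}")
    case True
    then show ?thesis using assms(1)[of m] mfact_pos[of m] by (simp add: br_single)
  next
    case False
    then have "m \<notin> keys p" "m \<notin> keys q" using assms unfolding in_vars_def by blast+
    then show ?thesis by (simp add: in_keys_iff)
  qed
qed

text \<open>Differentiation is equivariant for contragredient actions: \<open>AB\<close> and
  \<open>BA\<close> say that \<open>B\<close> is the inverse transpose of \<open>A\<close>. Both
  sides are tested against monomials, where adjointness reduces the claim to the invariance of
  \<open>br\<close>.\<close>

lemma diff_op_lsub:
  fixes s u :: "'a::field_char_0 pm"
  assumes s: "in_vars n s" and u: "in_vars n u"
    and AB: "\<And>i k. i < n \<Longrightarrow> k < n \<Longrightarrow> (\<Sum>l<n. A i l * B k l) = (if i = k then 1 else 0)"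
    and BA: "\<And>i k. i < n \<Longrightarrow> k < n \<Longrightarrow> (\<Sum>l<n. A l i * B l k) = (if i = k then 1 else 0)"
  shows "diff_op (lsub n B s) (lsub n A u) = lsub n A (diff_op s u)"
proof (rule br_nondegenerate)
  fix m :: "nat \<Rightarrow>\<^sub>0 nat" assume m: "keys m \<subseteq> {..<n}"
  let ?t = "sg m (1::'a)" and ?AT = "\<lambda>j k. A k j"
  have t: "in_vars n ?t" using m by (rule in_vars_single)
  have inv: "br (lsub n B p) (lsub n A v) = br p v" if "in_vars n p" "in_vars n v" for p v :: "'a pm"
  proof -
    have "lsub n (\<lambda>j k. B k j) (lsub n A v) = v"
      unfolding lsub_compose[OF that(2)] by (rule lsub_id[OF that(2)]) (rule AB)
    then show ?thesis using that by (simp add: br_lsub[of n])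
  qed
  \<comment> \<open>The test monomial is written as an image under \<open>B\<close>, so that its
    product with \<open>lsub n B s\<close> is again such an image and the invariance of the pairing
    applies.\<close>
  have T: "lsub n B (lsub n ?AT ?t) = ?t"
    unfolding lsub_compose[OF t] by (rule lsub_id[OF t]) (rule BA)
  have "br ?t (diff_op (lsub n B s) (lsub n A u)) = br (lsub n B (lsub n ?AT ?t * s)) (lsub n A u)"
    by (simp add: br_mult[symmetric] lsub_mult T)
  also have "\<dots> = br (lsub n ?AT ?t * s) u" using s u by (intro inv) (auto intro: in_vars_mult)
  also have "\<dots> = br ?t (lsub n A (diff_op s u))"
    unfolding br_mult using in_vars_diff_op[OF u] t by (simp add: br_lsub[of n])
  finally show "br ?t (diff_op (lsub n B s) (lsub n A u)) = br ?t (lsub n A (diff_op s u))" .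
qed (use u in \<open>auto intro: in_vars_diff_op\<close>)

subsection \<open>Homogeneous components\<close>

definition hcomp :: "nat \<Rightarrow> 'a::comm_monoid_add pm \<Rightarrow> 'a pm" where
  "hcomp d p = (\<Sum>m\<in>keys p. if mdeg m = d then sg m (lk p m) else 0)"

lemma lk_hcomp: "lk (hcomp d p) m = (if mdeg m = d then lk p m else 0)"
proof -
  have "lk (hcomp d p) m = (\<Sum>m'\<in>keys p. if m' = m then (if mdeg m = d then lk p m else 0) else 0)"
    unfolding hcomp_def lookup_sum by (rule sum.cong) (auto simp: lookup_single when_def)
  then show ?thesis by (auto simp: in_keys_iff)
qed

lemma hcomp_add: "hcomp d (p + q) = hcomp d p + hcomp d q"
  by (rule poly_mapping_eqI) (simp add: lk_hcomp lookup_add)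
lemma hcomp_0 [simp]: "hcomp d 0 = 0" by (rule poly_mapping_eqI) (simp add: lk_hcomp)
lemma hcomp_sum: "hcomp d (sum f S) = (\<Sum>i\<in>S. hcomp d (f i))"
  by (induction S rule: infinite_finite_induct) (auto simp: hcomp_add)
lemma homog_deg_hcomp [simp]: "homog_deg d (hcomp d p)" by (auto simp: homog_deg_lk lk_hcomp)
lemma in_vars_hcomp: "in_vars n p \<Longrightarrow> in_vars n (hcomp d p)"
  by (auto simp: in_vars_def in_keys_iff lk_hcomp split: if_splits)
lemma hcomp_homog: "homog_deg e p \<Longrightarrow> hcomp d p = (if d = e then p else 0)"
  by (rule poly_mapping_eqI) (auto simp: lk_hcomp homog_deg_lk)
lemma hcomp_eq_0_imp: "(\<And>d. hcomp d p = 0) \<Longrightarrow> p = 0"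
  by (rule poly_mapping_eqI) (metis lk_hcomp lookup_zero)

lemma sum_hcomp:
  assumes "\<And>m. m \<in> keys p \<Longrightarrow> mdeg m < D"
  shows "p = (\<Sum>d<D. hcomp d p)"
proof (rule poly_mapping_eqI)
  fix m
  have "(\<Sum>d<D. lk (hcomp d p) m) = (\<Sum>d<D. if d = mdeg m then lk p m else 0)"
    by (rule sum.cong) (auto simp: lk_hcomp)
  also have "\<dots> = lk p m" using assms[of m] by (auto simp: in_keys_iff)
  finally show "lk p m = lk (\<Sum>d<D. hcomp d p) m" by (simp add: lookup_sum)
qed

lemma mdeg_bound: "\<exists>D. \<forall>m\<in>keys p. mdeg m < D"
proof (intro exI ballI)
  fix m assume "m \<in> keys p"
  then show "mdeg m < Suc (Max (mdeg ` keys p))" by (simp add: less_Suc_eq_le)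
qed

lemma hcomp_mult_homog:
  assumes "homog_deg e q"
  shows "hcomp d (p * q) = (if e \<le> d then hcomp (d - e) p * q else 0)"
proof -
  obtain D where D: "\<forall>m\<in>keys p. mdeg m < D" using mdeg_bound[of p] by blast
  define D' where "D' = D + d + 1"
  have p: "p = (\<Sum>j<D'. hcomp j p)" using D by (intro sum_hcomp) (auto simp: D'_def)
  have "hcomp d (p * q) = (\<Sum>j<D'. hcomp d (hcomp j p * q))"
    by (subst p) (simp add: sum_distrib_right hcomp_sum)
  also have "\<dots> = (\<Sum>j<D'. if j + e = d then hcomp j p * q else 0)"
    by (rule sum.cong) (auto simp: hcomp_homog[OF homog_deg_mult[OF homog_deg_hcomp assms]])
  also have "\<dots> = (\<Sum>j<D'. if j = d - e then (if e \<le> d then hcomp (d - e) p * q else 0) else 0)"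
    by (rule sum.cong) auto
  also have "\<dots> = (if e \<le> d then hcomp (d - e) p * q else 0)"
    using less_imp_diff_less[of d D' e] by (simp add: D'_def)
  finally show ?thesis .
qed

lemma hcomp_lsub: "hcomp d (lsub N A p) = lsub N A (hcomp d p)"
proof -
  obtain D where D: "\<forall>m\<in>keys p. mdeg m < D" using mdeg_bound[of p] by blast
  define D' where "D' = D + d + 1"
  have p: "p = (\<Sum>j<D'. hcomp j p)" using D by (intro sum_hcomp) (auto simp: D'_def)
  have "hcomp d (lsub N A p) = (\<Sum>j<D'. hcomp d (lsub N A (hcomp j p)))"
    by (subst p) (simp add: lsub_sum hcomp_sum)
  also have "\<dots> = (\<Sum>j<D'. if j = d then lsub N A (hcomp d p) else 0)"
    by (rule sum.cong) (auto simp: hcomp_homog[OF homog_deg_lsub[OF homog_deg_hcomp]])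
  also have "\<dots> = lsub N A (hcomp d p)" by (simp add: D'_def)
  finally show ?thesis .
qed

subsection \<open>Exterior multiplication and contraction\<close>

text \<open>The sign of moving eps_j to its place in eps_K. Only elements below \<open>j\<close>
  count, so it does not change when \<open>j\<close> itself is inserted or removed, and the same
  formula serves the multiplication \<open>eps\<close> and the contraction
  \<open>inn\<close>.\<close>

definition esgn :: "nat \<Rightarrow> nat set \<Rightarrow> 'a::comm_ring_1" where
  "esgn j K = (- 1) ^ card {x \<in> K. x < j}"

lemma esgn_insert: "i \<notin> K \<Longrightarrow> esgn j (insert i K) = (if i < j then - esgn j K else esgn j K)"
proof -
  assume i: "i \<notin> K"
  have "finite {x \<in> K. x < j}" by (rule finite_subset[of _ "{..<j}"]) auto
  moreover have "{x \<in> insert i K. x < j} = (if i < j then insert i {x \<in> K. x < j} else {x \<in> K. x < j})"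
    by auto
  ultimately show ?thesis using i by (simp add: esgn_def)
qed

lemma esgn_square [simp]: "esgn j K * esgn j K = 1"
  unfolding esgn_def by (simp flip: power_add)

lemma Const_esgn_square [simp]: "Const (esgn j K) * (Const (esgn j K) * x) = x"
  by (simp add: mult.assoc[symmetric] Const_mult[symmetric])

lemma esgn_empty [simp]: "esgn j {} = 1" by (simp add: esgn_def)

definition eps :: "nat \<Rightarrow> (nat set \<Rightarrow> 'a::comm_ring_1 pm) \<Rightarrow> nat set \<Rightarrow> 'a pm" where
  "eps j w K = (if j \<in> K then Const (esgn j K) * w (K - {j}) else 0)"

definition inn :: "nat \<Rightarrow> (nat set \<Rightarrow> 'a::comm_ring_1 pm) \<Rightarrow> nat set \<Rightarrow> 'a pm" where
  "inn j w K = (if j \<in> K then 0 else Const (esgn j K) * w (insert j K))"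

lemma esgn_remove: "j \<in> K \<Longrightarrow> (esgn i (K - {j}) :: 'a::comm_ring_1) = (if j < i then - esgn i K else esgn i K)"
  using esgn_insert[of j "K - {j}" i, where 'a = 'a] by (simp add: insert_absorb)

lemma esgn_remove_same [simp]: "esgn j (K - {j}) = esgn j K"
  by (cases "j \<in> K") (auto simp: esgn_remove)

lemma esgn_insert_same [simp]: "esgn j (insert j K) = esgn j K"
  by (cases "j \<in> K") (auto simp: esgn_insert insert_absorb)

lemma eps_eps: "eps i (eps j w) K = - eps j (eps i w) K"
proof (cases "i \<in> K \<and> j \<in> K \<and> i \<noteq> j")
  case True
  then have "K - {i} - {j} = K - {j} - {i}" by auto
  with True show ?thesis by (auto simp: eps_def esgn_remove Const_uminus mult_ac)
qed (auto simp: eps_def)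

lemma inn_inn: "inn i (inn j w) K = - inn j (inn i w) K"
  by (auto simp: inn_def esgn_insert Const_uminus insert_commute mult_ac)

text \<open>The Clifford relation. Together with the vanishing of contractions on polynomials it
  determines contraction, which is how \<open>Tact_inn\<close> uses it.\<close>

lemma inn_eps: "inn i (eps j w) K = (if i = j then w K else 0) - eps j (inn i w) K"
proof (cases "i = j")
  case True
  then show ?thesis by (auto simp: inn_def eps_def insert_absorb)
next
  case False
  show ?thesis
  proof (cases "i \<notin> K \<and> j \<in> K")
    case True
    then have "insert i K - {j} = insert i (K - {j})" using False by auto
    then show ?thesis using True False
      by (auto simp: inn_def eps_def esgn_remove esgn_insert Const_uminus mult_ac)
  qed (use False in \<open>auto simp: inn_def eps_def\<close>)
qed

lemma eps_add: "eps j (\<lambda>K. v K + w K) = (\<lambda>K. eps j v K + eps j w K)"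
  and eps_mult: "eps j (\<lambda>K. p * w K) = (\<lambda>K. p * eps j w K)"
  and eps_0 [simp]: "eps j (\<lambda>K. 0) = (\<lambda>K. 0)"
  and inn_add: "inn j (\<lambda>K. v K + w K) = (\<lambda>K. inn j v K + inn j w K)"
  and inn_mult: "inn j (\<lambda>K. p * w K) = (\<lambda>K. p * inn j w K)"
  and inn_0 [simp]: "inn j (\<lambda>K. 0) = (\<lambda>K. 0)"
  by (auto simp: eps_def inn_def fun_eq_iff algebra_simps)

lemma eps_sum: "eps j (\<lambda>K. \<Sum>t\<in>T. f t K) = (\<lambda>K. \<Sum>t\<in>T. eps j (f t) K)"
  and inn_sum: "inn j (\<lambda>K. \<Sum>t\<in>T. f t K) = (\<lambda>K. \<Sum>t\<in>T. inn j (f t) K)"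
  by (auto simp: eps_def inn_def fun_eq_iff sum_distrib_left)

lemma eps_diff_op: "eps j (\<lambda>K. diff_op s (w K)) = (\<lambda>K. diff_op s (eps j w K))"
  by (auto simp: eps_def fun_eq_iff diff_op_Const_mult_right)

lemma ext_sign_singleton: "ext_sign {j} K = (esgn j K :: 'a::comm_ring_1)"
proof -
  have "{(i, x). i \<in> {j} \<and> x \<in> K \<and> x < i} = Pair j ` {x \<in> K. x < j}" by auto
  then have "card {(i, x). i \<in> {j} \<and> x \<in> K \<and> x < i} = card {x \<in> K. x < j}"
    by (simp add: card_image inj_on_def)
  then show ?thesis by (simp add: ext_sign_def esgn_def)
qed

lemma ext_mult_ext_lin:
  assumes "finite K"
  shows "ext_mult (ext_lin r c) w K = (\<Sum>k<r. Const (c k) * eps k w K)"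
proof -
  have "ext_mult (ext_lin r c) w K =
     (\<Sum>I\<in>Pow K. \<Sum>k<r. if I = {k} then Const (c k) * eps k w K else 0)"
    unfolding ext_mult_def ext_lin_def sum_distrib_left sum_distrib_right
    by (intro sum.cong) (auto simp: ext_sign_singleton eps_def mult_ac)
  also have "\<dots> = (\<Sum>k<r. \<Sum>I\<in>Pow K. if I = {k} then Const (c k) * eps k w K else 0)"
    by (rule sum.swap)
  also have "\<dots> = (\<Sum>k<r. Const (c k) * eps k w K)"
    using assms by (intro sum.cong) (auto simp: eps_def)
  finally show ?thesis .
qed

text \<open>For infinite \<open>K\<close> the sum over \<open>Pow K\<close> in
  \<open>ext_mult\<close> is 0 by convention while \<open>eps\<close> need not vanish, hence the
  assumption on infinite sets.\<close>

lemma ext_mult_ext_gen: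
  assumes "\<And>K. infinite K \<Longrightarrow> w K = 0"
  shows "ext_mult (ext_gen j) w = eps j w"
proof
  fix K
  show "ext_mult (ext_gen j) w K = eps j w K"
  proof (cases "finite K")
    case True
    have "ext_mult (ext_gen j) w K = (\<Sum>I\<in>Pow K. if I = {j} then eps j w K else 0)"
      unfolding ext_mult_def ext_gen_def
      by (intro sum.cong) (auto simp: ext_sign_singleton eps_def mult_ac)
    then show ?thesis using True by (auto simp: eps_def)
  next
    case False
    then have "infinite (Pow K)" "infinite (K - {j})" by auto
    then show ?thesis using assms by (simp add: ext_mult_def eps_def)
  qed
qed

subsection \<open>Products of anticommuting operators\<close>

text \<open>The common core of \<open>epsl\<close>, \<open>dst\<close> and \<open>iot\<close>:
  ordered products multiply like exterior monomials. Linearity is demanded over constants only,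
  because \<open>dst\<close> differentiates polynomial factors.\<close>

locale anticommuting =
  fixes op :: "nat \<Rightarrow> (nat set \<Rightarrow> 'a::field_char_0 pm) \<Rightarrow> nat set \<Rightarrow> 'a pm"
  assumes smult: "op i (\<lambda>K. Const c * w K) = (\<lambda>K. Const c * op i w K)"
    and anti: "op i (op j w) = (\<lambda>K. - op j (op i w) K)"
begin

definition opseq :: "nat set \<Rightarrow> (nat set \<Rightarrow> 'a pm) \<Rightarrow> nat set \<Rightarrow> 'a pm" where
  "opseq I w = foldr op (sorted_list_of_set I) w"

lemma opseq_empty [simp]: "opseq {} w = w" by (simp add: opseq_def)

lemma op_0 [simp]: "op i (\<lambda>K. 0) = (\<lambda>K. 0)"
  using smult[of i 0 "\<lambda>K. 0"] by simp

text \<open>An operator anticommutes with itself, and an element equal to its negative is 0 in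
  characteristic zero.\<close>

lemma square: "op i (op i w) = (\<lambda>K. 0)"
proof
  fix K
  have "op i (op i w) K = - op i (op i w) K" using anti[of i i w] by metis
  then have "lk (op i (op i w) K) m = - lk (op i (op i w) K) m" for m
    by (metis lookup_uminus)
  then show "op i (op i w) K = 0" by (intro poly_mapping_eqI) simp
qed

lemma opseq_insert_Min: "finite I \<Longrightarrow> (\<And>x. x \<in> I \<Longrightarrow> j < x) \<Longrightarrow> opseq (insert j I) w = op j (opseq I w)"
proof -
  assume I: "finite I" "\<And>x. x \<in> I \<Longrightarrow> j < x"
  then have "sorted_list_of_set (insert j I) = j # sorted_list_of_set I"
    by (subst sorted_list_of_set_insert) (auto simp: insort_is_Cons less_imp_le)
  then show ?thesis by (simp add: opseq_def)
qed

text \<open>The least element \<open>i\<close> of \<open>I\<close> decides. Below it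
  \<open>op j\<close> is already in order, at it a square appears, and above it \<open>op j\<close>
  moves past \<open>op i\<close> at the cost of a sign, which is the one that \<open>i\<close>
  contributes to \<open>esgn j I\<close>.\<close>

lemma op_opseq:
  assumes "finite I"
  shows "op j (opseq I w) = (if j \<in> I then (\<lambda>K. 0) else (\<lambda>K. Const (esgn j I) * opseq (insert j I) w K))"
  using assms
proof (induction "card I" arbitrary: I)
  case 0
  then show ?case using opseq_insert_Min[of "{}" j w] by simp
next
  case (Suc k)
  define i where "i = Min I"
  define I' where "I' = I - {i}"
  have iI: "i \<in> I" using Suc.hyps(2) Suc.prems unfolding i_def by (intro Min_in) auto
  have I: "I = insert i I'" "i \<notin> I'" "finite I'" using iI Suc.prems by (auto simp: I'_def)
  have lt: "i < x" if "x \<in> I'" for x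
    using that Suc.prems unfolding I'_def i_def by (metis DiffE Min_le insertCI order_le_neq_trans)
  have k: "k = card I'" using Suc.hyps(2) I by simp
  have seqI: "opseq I w = op i (opseq I' w)" unfolding I(1) using I lt by (intro opseq_insert_Min) auto
  consider "j < i" | "j = i" | "i < j" by linarith
  then show ?case
  proof cases
    case 1
    then have "j < x" if "x \<in> I" for x using that lt I(1) by (auto intro: less_trans)
    then have "opseq (insert j I) w = op j (opseq I w)" "{x \<in> I. x < j} = {}" "j \<notin> I"
      using Suc.prems opseq_insert_Min[of I j w] by fastforce+
    moreover from this(2) have "esgn j I = (1 :: 'a)" by (simp only: esgn_def card.empty power_0)
    ultimately show ?thesis by simp
  next
    case 2
    then show ?thesis using seqI square iI by simp
  next
    case 3
    have *: "op j (opseq I w) = (\<lambda>K. - op i (op j (opseq I' w)) K)"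
      unfolding seqI by (rule anti)
    show ?thesis
    proof (cases "j \<in> I")
      case True
      then have "op j (opseq I' w) = (\<lambda>K. 0)" using Suc.hyps(1)[OF k I(3)] I 3 by auto
      then show ?thesis using True * by simp
    next
      case False
      then have jI': "j \<notin> I'" using I by simp
      then have "op j (opseq I' w) = (\<lambda>K. Const (esgn j I') * opseq (insert j I') w K)"
        using Suc.hyps(1)[OF k I(3)] by simp
      then have **: "op j (opseq I w) = (\<lambda>K. - (Const (esgn j I') * op i (opseq (insert j I') w) K))"
        unfolding * by (simp add: smult)
      have "opseq (insert i (insert j I')) w = op i (opseq (insert j I') w)"
        using I lt 3 by (intro opseq_insert_Min) auto
      moreover have "insert i (insert j I') = insert j I" using I by auto
      moreover have "esgn j I = - (esgn j I' :: 'a)" unfolding I(1) using I(2) 3 by (simp add: esgn_insert)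
      ultimately show ?thesis using ** False by (simp add: Const_uminus)
    qed
  qed
qed

text \<open>Words arise in any order and with repetitions; each collapses to zero or to an ordered
  product. That the constant is nonzero is what the cancellation of complementary products
  requires.\<close>

lemma foldr_op_opseq:
  assumes "finite B"
  shows "if distinct xs \<and> set xs \<inter> B = {}
     then \<exists>c. c \<noteq> 0 \<and> foldr op xs (opseq B w) = (\<lambda>K. Const c * opseq (set xs \<union> B) w K)
     else foldr op xs (opseq B w) = (\<lambda>K. 0)"
proof (induction xs)
  case Nil
  then show ?case by (auto intro: exI[of _ 1])
next
  case (Cons x xs)
  show ?case
  proof (cases "distinct xs \<and> set xs \<inter> B = {}")
    case False
    then show ?thesis using Cons by auto
  next
    case True
    then obtain c where c: "c \<noteq> 0" "foldr op xs (opseq B w) = (\<lambda>K. Const c * opseq (set xs \<union> B) w K)"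
      using Cons by auto
    have fin: "finite (set xs \<union> B)" using assms by simp
    have eq: "foldr op (x # xs) (opseq B w) = (\<lambda>K. Const c * op x (opseq (set xs \<union> B) w) K)"
      by (simp add: c(2) smult)
    show ?thesis
    proof (cases "x \<in> set xs \<union> B")
      case True
      then show ?thesis using eq op_opseq[OF fin, of x w] by auto
    next
      case False
      have "esgn x (set xs \<union> B) \<noteq> (0 :: 'a)" unfolding esgn_def by simp
      moreover have "foldr op (x # xs) (opseq B w) =
          (\<lambda>K. Const (c * esgn x (set xs \<union> B)) * opseq (set (x # xs) \<union> B) w K)"
        using eq op_opseq[OF fin, of x w] False by (simp add: Const_mult mult.assoc)
      ultimately show ?thesis using False True c(1) by (metis Int_insert_left Un_iff
         distinct.simps(2) list.simps(15) mult_eq_0_iff)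
    qed
  qed
qed

lemma opseq_opseq_disjoint:
  assumes "finite A" "finite B" "A \<inter> B = {}"
  obtains c where "c \<noteq> 0" "opseq A (opseq B w) = (\<lambda>K. Const c * opseq (A \<union> B) w K)"
  using foldr_op_opseq[OF assms(2), of "sorted_list_of_set A" w] assms
  by (auto simp: opseq_def[of A])

lemma opseq_opseq_overlap:
  assumes "finite A" "finite B" "A \<inter> B \<noteq> {}"
  shows "opseq A (opseq B w) = (\<lambda>K. 0)"
  using foldr_op_opseq[OF assms(2), of "sorted_list_of_set A" w] assms
  by (auto simp: opseq_def[of A])

lemma foldr_op_eq: "\<exists>c. foldr op xs w = (\<lambda>K. Const c * opseq (set xs) w K)"
  using foldr_op_opseq[of "{}" xs w] by (auto split: if_splits intro: exI[of _ 0])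

lemma opseq_invariant:
  "finite I \<Longrightarrow> P w \<Longrightarrow> (\<And>i v. i \<in> I \<Longrightarrow> P v \<Longrightarrow> P (op i v)) \<Longrightarrow> P (opseq I w)"
proof -
  assume *: "finite I" "P w" "\<And>i v. i \<in> I \<Longrightarrow> P v \<Longrightarrow> P (op i v)"
  have "P (foldr op xs w)" if "set xs \<subseteq> I" for xs
    using that by (induction xs) (auto simp: *)
  then show ?thesis unfolding opseq_def using *(1) by simp
qed

end

section \<open>The three anticommuting families: linear forms, the operators d_i^*,
  contractions\<close>

definition epsl :: "nat \<Rightarrow> (nat \<Rightarrow> nat \<Rightarrow> 'a::comm_ring_1) \<Rightarrow> nat \<Rightarrow> (nat set \<Rightarrow> 'a pm) \<Rightarrow> nat set \<Rightarrow> 'a pm" where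
  "epsl r c i w K = (\<Sum>k<r. Const (c i k) * eps k w K)"

lemma anticommuting_epsl: "anticommuting (epsl r c :: _ \<Rightarrow> (nat set \<Rightarrow> 'a::field_char_0 pm) \<Rightarrow> _)"
proof
  fix i j d and w :: "nat set \<Rightarrow> 'a pm"
  show "epsl r c i (\<lambda>K. Const d * w K) = (\<lambda>K. Const d * epsl r c i w K)"
    by (auto simp: epsl_def eps_mult sum_distrib_left mult_ac)
  have expand: "epsl r c i (epsl r c j w) K = (\<Sum>k<r. \<Sum>l<r. Const (c i k) * (Const (c j l) * eps k (eps l w) K))" for i j K
    by (simp add: epsl_def[of r c i] epsl_def[of r c j, abs_def] eps_sum eps_mult sum_distrib_left)
  show "epsl r c i (epsl r c j w) = (\<lambda>K. - epsl r c j (epsl r c i w) K)"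
  proof
    fix K
    have "epsl r c i (epsl r c j w) K = (\<Sum>l<r. \<Sum>k<r. Const (c i k) * (Const (c j l) * eps k (eps l w) K))"
      unfolding expand by (rule sum.swap)
    also have "\<dots> = - epsl r c j (epsl r c i w) K"
      unfolding expand sum_negf[symmetric]
      by (intro sum.cong refl, subst eps_eps) (simp add: mult_ac)
    finally show "epsl r c i (epsl r c j w) K = - epsl r c j (epsl r c i w) K" .
  qed
qed

text \<open>The operator d_i^* written through \<open>eps\<close>, so that its algebra has no
  finiteness conditions on index sets; \<open>dstar_seq_dst\<close> links it to
  \<open>dstar_seq\<close>.\<close>

definition dst :: "nat \<Rightarrow> (nat \<Rightarrow> nat \<Rightarrow> 'a::comm_ring_1 pm) \<Rightarrow> nat \<Rightarrow> (nat set \<Rightarrow> 'a pm) \<Rightarrow> nat set \<Rightarrow> 'a pm" where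
  "dst r \<tau> i w K = (\<Sum>j<r. eps j (\<lambda>I. diff_op (\<tau> i j) (w I)) K)"

lemma anticommuting_dst: "anticommuting (dst r \<tau> :: _ \<Rightarrow> (nat set \<Rightarrow> 'a::field_char_0 pm) \<Rightarrow> _)"
proof
  fix i j d and w :: "nat set \<Rightarrow> 'a pm"
  show "dst r \<tau> i (\<lambda>K. Const d * w K) = (\<lambda>K. Const d * dst r \<tau> i w K)"
    by (auto simp: dst_def diff_op_Const_mult_right eps_mult sum_distrib_left)
  have expand: "dst r \<tau> i (dst r \<tau> j w) K =
     (\<Sum>k<r. \<Sum>l<r. eps k (eps l (\<lambda>I. diff_op (\<tau> i k * \<tau> j l) (w I))) K)" for i j K
    by (simp add: dst_def[of r \<tau> i] dst_def[of r \<tau> j, abs_def] diff_op_sum_right eps_sum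
       eps_diff_op diff_op_mult)
  show "dst r \<tau> i (dst r \<tau> j w) = (\<lambda>K. - dst r \<tau> j (dst r \<tau> i w) K)"
  proof
    fix K
    have "dst r \<tau> i (dst r \<tau> j w) K = (\<Sum>l<r. \<Sum>k<r. eps k (eps l (\<lambda>I. diff_op (\<tau> i k * \<tau> j l) (w I))) K)"
      unfolding expand by (rule sum.swap)
    also have "\<dots> = - dst r \<tau> j (dst r \<tau> i w) K"
      unfolding expand sum_negf[symmetric]
    proof (intro sum.cong refl)
      fix k l
      show "eps l (eps k (\<lambda>I. diff_op (\<tau> i l * \<tau> j k) (w I))) K = - eps k (eps l (\<lambda>I. diff_op (\<tau> j k * \<tau> i l) (w I))) K"
        by (subst eps_eps) (simp add: mult.commute)
    qed
    finally show "dst r \<tau> i (dst r \<tau> j w) K = - dst r \<tau> j (dst r \<tau> i w) K" .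
  qed
qed

text \<open>Contraction with the element of the polynomial ring tensor M that row \<open>i\<close>
  of \<open>v\<close> describes. It lowers the exterior degree and, unlike \<open>dst\<close>, is
  linear over polynomials.\<close>

definition iot :: "nat \<Rightarrow> (nat \<Rightarrow> nat \<Rightarrow> 'a::comm_ring_1 pm) \<Rightarrow> nat \<Rightarrow> (nat set \<Rightarrow> 'a pm) \<Rightarrow> nat set \<Rightarrow> 'a pm" where
  "iot r v i w K = (\<Sum>j<r. v i j * inn j w K)"

lemma iot_mult: "iot r v i (\<lambda>K. p * w K) = (\<lambda>K. p * iot r v i w K)"
  by (auto simp: iot_def inn_mult sum_distrib_left mult_ac)

lemma iot_add: "iot r v i (\<lambda>K. x K + w K) = (\<lambda>K. iot r v i x K + iot r v i w K)"
  by (auto simp: iot_def inn_add sum.distrib algebra_simps)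

lemma anticommuting_iot: "anticommuting (iot r v :: _ \<Rightarrow> (nat set \<Rightarrow> 'a::field_char_0 pm) \<Rightarrow> _)"
proof
  fix i j d and w :: "nat set \<Rightarrow> 'a pm"
  show "iot r v i (\<lambda>K. Const d * w K) = (\<lambda>K. Const d * iot r v i w K)"
    by (rule iot_mult)
  have expand: "iot r v i (iot r v j w) K = (\<Sum>k<r. \<Sum>l<r. v i k * (v j l * inn k (inn l w) K))" for i j K
    by (simp add: iot_def[of r v i] iot_def[of r v j, abs_def] inn_sum inn_mult sum_distrib_left)
  show "iot r v i (iot r v j w) = (\<lambda>K. - iot r v j (iot r v i w) K)"
  proof
    fix K
    have "iot r v i (iot r v j w) K = (\<Sum>l<r. \<Sum>k<r. v i k * (v j l * inn k (inn l w) K))"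
      unfolding expand by (rule sum.swap)
    also have "\<dots> = - iot r v j (iot r v i w) K"
      unfolding expand sum_negf[symmetric]
      by (intro sum.cong refl, subst inn_inn) (simp add: mult_ac)
    finally show "iot r v i (iot r v j w) K = - iot r v j (iot r v i w) K" .
  qed
qed

lemma dstar_seq_dst:
  assumes "\<And>K. infinite K \<Longrightarrow> w K = 0"
  shows "dstar_seq r \<tau> I w = foldr (dst r \<tau>) (sorted_list_of_set I) w"
proof -
  have 1: "dstar r \<tau> i v = dst r \<tau> i v \<and> (\<forall>K. infinite K \<longrightarrow> dst r \<tau> i v K = 0)"
    if "\<And>K. infinite K \<Longrightarrow> v K = 0" for i v
  proof -
    have "dstar r \<tau> i v = dst r \<tau> i v" unfolding dstar_def dst_def
      using that by (subst ext_mult_ext_gen) auto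
    moreover have "dst r \<tau> i v K = 0" if "infinite K" for K
      unfolding dst_def eps_def using that \<open>\<And>K. infinite K \<Longrightarrow> v K = 0\<close> by (intro sum.neutral) auto
    ultimately show ?thesis by blast
  qed
  have "foldr (dstar r \<tau>) xs w = foldr (dst r \<tau>) xs w \<and> (\<forall>K. infinite K \<longrightarrow> foldr (dst r \<tau>) xs w K = 0)" for xs
    using assms by (induction xs) (auto simp: 1)
  then show ?thesis by (simp add: dstar_seq_def)
qed

lemma ext_basis_act_epsl:
  assumes "dim_col B = r"
  shows "ext_basis_act B I = foldr (epsl r (\<lambda>i k. B $$ (i, k))) (sorted_list_of_set I) ext_one"
proof -
  have 1: "ext_mult (ext_lin r (\<lambda>k. B $$ (i,k))) v = epsl r (\<lambda>i k. B $$ (i, k)) i v \<and>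
      (\<forall>K. infinite K \<longrightarrow> epsl r (\<lambda>i k. B $$ (i, k)) i v K = 0)"
    if v: "\<And>K. infinite K \<Longrightarrow> v K = 0" for i v
  proof -
    have inf: "epsl r (\<lambda>i k. B $$ (i, k)) i v K = 0" if "infinite K" for K
      unfolding epsl_def eps_def using that v by (intro sum.neutral) auto
    have "ext_mult (ext_lin r (\<lambda>k. B $$ (i,k))) v K = epsl r (\<lambda>i k. B $$ (i, k)) i v K" for K
    proof (cases "finite K")
      case True
      then show ?thesis by (simp add: ext_mult_ext_lin epsl_def)
    next
      case False
      then have "infinite (Pow K)" by simp
      then show ?thesis using inf[OF False] by (simp add: ext_mult_def)
    qed
    then show ?thesis using inf by auto
  qed
  have "foldr (\<lambda>i w. ext_mult (ext_lin r (\<lambda>k. B $$ (i,k))) w) xs ext_one =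
      foldr (epsl r (\<lambda>i k. B $$ (i, k))) xs ext_one \<and>
     (\<forall>K. infinite K \<longrightarrow> foldr (epsl r (\<lambda>i k. B $$ (i, k))) xs ext_one K = (0 :: 'a pm))" for xs
  proof (induction xs)
    case Nil
    then show ?case by (auto simp: ext_one_def)
  next
    case (Cons x xs)
    then show ?case using 1[of "foldr (epsl r (\<lambda>i k. B $$ (i, k))) xs ext_one" x] by simp
  qed
  then show ?thesis using assms by (simp add: ext_basis_act_def)
qed

subsection \<open>The action on polynomials with exterior coefficients\<close>

definition EB :: "nat \<Rightarrow> (nat \<Rightarrow> nat \<Rightarrow> 'a::field_char_0) \<Rightarrow> nat set \<Rightarrow> nat set \<Rightarrow> 'a pm" where
  "EB r c I = foldr (epsl r c) (sorted_list_of_set I) ext_one"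

text \<open>The action \<open>act_tens\<close> of one group element, given by two arrays:
  \<open>a\<close> for the coordinates of V and \<open>c\<close> for the eps_i. The identities below
  hold for arrays, without a group.\<close>

definition Tact :: "nat \<Rightarrow> nat \<Rightarrow> (nat \<Rightarrow> nat \<Rightarrow> 'a::field_char_0) \<Rightarrow> (nat \<Rightarrow> nat \<Rightarrow> 'a)
    \<Rightarrow> (nat set \<Rightarrow> 'a pm) \<Rightarrow> nat set \<Rightarrow> 'a pm" where
  "Tact n r a c w K = (\<Sum>I\<in>Pow {..<r}. lsub n a (w I) * EB r c I K)"

lemma EB_Const: "\<exists>d. EB r c I K = Const d"
proof -
  have "\<exists>d. foldr (epsl r c) xs ext_one K = Const d" for xs K
  proof (induction xs arbitrary: K)
    case Nil
    show ?case by (auto simp: ext_one_def intro: exI[of _ 1] exI[of _ 0])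
  next
    case (Cons x xs)
    then obtain d where d: "\<And>K. foldr (epsl r c) xs ext_one K = Const (d K)" by metis
    have "foldr (epsl r c) (x # xs) ext_one K =
       Const (\<Sum>k<r. c x k * (if k \<in> K then esgn k K * d (K - {k}) else 0))"
      unfolding Const_sum by (simp add: epsl_def eps_def d Const_mult cong: if_cong) (auto intro!: sum.cong simp: Const_mult)
    then show ?case by blast
  qed
  then show ?thesis unfolding EB_def by blast
qed

lemma epsl_EB:
  assumes "finite I"
  shows "epsl r c j (EB r c I) K = (if j \<in> I then 0 else Const (esgn j I) * EB r c (insert j I) K)"
proof -
  interpret anticommuting "epsl r c" by (rule anticommuting_epsl)
  show ?thesis using op_opseq[OF assms, of j ext_one] by (auto simp: opseq_def EB_def)
qed

lemma Tact_add: "Tact n r a c (\<lambda>K. v K + w K) = (\<lambda>K. Tact n r a c v K + Tact n r a c w K)"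
  by (auto simp: Tact_def lsub_add sum.distrib algebra_simps)

lemma Tact_mult: "Tact n r a c (\<lambda>K. p * w K) = (\<lambda>K. lsub n a p * Tact n r a c w K)"
  by (auto simp: Tact_def lsub_mult sum_distrib_left mult.assoc)

lemma Tact_0 [simp]: "Tact n r a c (\<lambda>K. 0) = (\<lambda>K. 0)"
  by (auto simp: Tact_def)

lemma Tact_sum: "finite T \<Longrightarrow> Tact n r a c (\<lambda>K. \<Sum>t\<in>T. f t K) = (\<lambda>K. \<Sum>t\<in>T. Tact n r a c (f t) K)"
  by (induction T rule: finite_induct) (auto simp: Tact_add)

lemma Tact_emb: "Tact n r a c (emb p) = emb (lsub n a p)"
proof
  fix K
  have "Tact n r a c (emb p) K = (\<Sum>I\<in>Pow {..<r}. if I = {} then lsub n a p * EB r c {} K else 0)"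
    unfolding Tact_def emb_def by (intro sum.cong) auto
  also have "\<dots> = lsub n a p * EB r c {} K" by simp
  finally show "Tact n r a c (emb p) K = emb (lsub n a p) K"
    by (auto simp: EB_def emb_def ext_one_def)
qed

text \<open>Index sets containing \<open>j\<close> are matched with those avoiding it. The sign in
  \<open>eps\<close> and the sign from putting the image of eps_j into its place agree, so their
  product is 1.\<close>

lemma Tact_eps:
  assumes "j < r"
  shows "Tact n r a c (eps j w) = epsl r c j (Tact n r a c w)"
proof
  fix K
  have "Tact n r a c (eps j w) K = (\<Sum>I\<in>{I\<in>Pow {..<r}. j \<in> I}. lsub n a (eps j w I) * EB r c I K)"
    unfolding Tact_def by (rule sum.mono_neutral_right) (auto simp: eps_def)
  also have "\<dots> = (\<Sum>I\<in>{I\<in>Pow {..<r}. j \<notin> I}. lsub n a (eps j w (insert j I)) * EB r c (insert j I) K)"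
    by (rule sum.reindex_bij_witness[of _ "insert j" "\<lambda>I. I - {j}"]) (use assms in \<open>auto simp: insert_absorb\<close>)
  also have "\<dots> = (\<Sum>I\<in>{I\<in>Pow {..<r}. j \<notin> I}. lsub n a (w I) * epsl r c j (EB r c I) K)"
    by (intro sum.cong refl) (auto simp: eps_def lsub_mult epsl_EB finite_subset[of _ "{..<r}"] mult_ac)
  also have "\<dots> = (\<Sum>I\<in>Pow {..<r}. lsub n a (w I) * epsl r c j (EB r c I) K)"
    by (rule sum.mono_neutral_left) (auto simp: epsl_EB finite_subset[of _ "{..<r}"])
  also have "\<dots> = epsl r c j (Tact n r a c w) K"
    unfolding epsl_def Tact_def[abs_def] eps_sum eps_mult sum_distrib_left sum_distrib_right
    by (subst sum.swap) (auto simp: mult_ac)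
  finally show "Tact n r a c (eps j w) K = epsl r c j (Tact n r a c w) K" .
qed

definition supp_in :: "nat \<Rightarrow> (nat set \<Rightarrow> 'a::zero pm) \<Rightarrow> bool" where
  "supp_in r w \<longleftrightarrow> (\<forall>I. w I \<noteq> 0 \<longrightarrow> I \<subseteq> {..<r})"

text \<open>Polynomials and the multiplications by eps_j generate all forms on the indices below
  \<open>r\<close>, so equivariance has to be checked for \<open>emb\<close> and \<open>eps\<close>
  only.\<close>

lemma supp_in_induct [consumes 1, case_names emb add eps]:
  fixes w :: "nat set \<Rightarrow> 'a::comm_ring_1 pm"
  assumes "supp_in r w" and E: "\<And>p. P (emb p)"
    and A: "\<And>v w. P v \<Longrightarrow> P w \<Longrightarrow> P (\<lambda>K. v K + w K)"
    and M: "\<And>w j. P w \<Longrightarrow> j < r \<Longrightarrow> P (eps j w)"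
  shows "P w"
proof -
  have single: "P (\<lambda>K. if K = K0 then p else 0)" if "K0 \<subseteq> {..<r}" for K0 p
    using finite_subset[OF that finite_lessThan] that
  proof (induction K0 arbitrary: p rule: finite_induct)
    case empty
    then show ?case using E[of p] by (simp add: emb_def)
  next
    case (insert j F)
    have "eps j (\<lambda>K. if K = F then Const (esgn j F) * p else 0) = (\<lambda>K. if K = insert j F then p else 0)"
      using insert.hyps by (auto simp: eps_def fun_eq_iff)
    then show ?case using M[OF insert.IH, of j "Const (esgn j F) * p"] insert.prems by simp
  qed
  have "P (\<lambda>K. if K \<in> S then w K else 0)" if "S \<subseteq> Pow {..<r}" for S
    using finite_subset[OF that finite_Pow_iff[THEN iffD2, OF finite_lessThan]] that
  proof (induction S rule: finite_induct)
    case empty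
    show ?case using E[of 0] by (simp add: emb_def cong: if_cong)
  next
    case (insert I S)
    then have "P (\<lambda>K. (if K = I then w I else 0) + (if K \<in> S then w K else 0))"
      using A[OF single[of I "w I"]] by simp
    moreover have "(\<lambda>K. (if K = I then w I else 0) + (if K \<in> S then w K else 0)) =
        (\<lambda>K. if K \<in> insert I S then w K else 0)"
      using insert.hyps by auto
    ultimately show ?case by simp
  qed
  from this[of "Pow {..<r}"] have "P (\<lambda>K. if K \<subseteq> {..<r} then w K else 0)" by simp
  moreover have "(\<lambda>K. if K \<subseteq> {..<r} then w K else 0) = w"
    using assms(1) unfolding supp_in_def by (intro ext) metis
  ultimately show ?thesis by simp
qed

text \<open>Since the m_j are dual to the eps_j, contractions change by the inverse array
  \<open>R\<close>. Contractions of polynomials vanish, and \<open>inn_eps\<close> carries the claim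
  through each multiplication by eps_i.\<close>

lemma Tact_inn:
  assumes "supp_in r w" "j < r"
    and inv: "\<And>i k. i < r \<Longrightarrow> k < r \<Longrightarrow> (\<Sum>l<r. c i l * R l k) = (if i = k then 1 else 0)"
  shows "Tact n r a c (inn j w) = (\<lambda>K. \<Sum>k<r. Const (R k j) * inn k (Tact n r a c w) K)"
  using assms(1)
proof (induction w rule: supp_in_induct)
  case (emb p)
  have "inn k (emb q) = (\<lambda>K. 0 :: 'a pm)" for k q by (auto simp: inn_def emb_def)
  then show ?case by (simp add: Tact_emb)
next
  case (add v w)
  then show ?case by (simp add: inn_add Tact_add sum.distrib algebra_simps)
next
  case (eps w i)
  let ?T = "Tact n r a c"
  have "?T (inn j (eps i w)) K = (\<Sum>k<r. Const (R k j) * inn k (?T (eps i w)) K)" for K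
  proof -
    have "inn j (eps i w) = (\<lambda>K. Const (if i = j then 1 else 0) * w K + Const (- 1) * eps i (inn j w) K)"
      by (auto simp: inn_eps fun_eq_iff Const_uminus)
    then have "?T (inn j (eps i w)) K = (if i = j then 1 else 0) * ?T w K - epsl r c i (?T (inn j w)) K"
      using eps.hyps by (simp only: Tact_add Tact_mult Tact_eps lsub_Const) (auto simp: Const_uminus)
    also have "epsl r c i (?T (inn j w)) K = (\<Sum>l<r. \<Sum>k<r. Const (c i l) * (Const (R k j) * eps l (inn k (?T w)) K))"
      by (simp add: eps.IH epsl_def eps_sum eps_mult sum_distrib_left)
    finally have 1: "?T (inn j (eps i w)) K = (if i = j then 1 else 0) * ?T w K -
      (\<Sum>l<r. \<Sum>k<r. Const (c i l) * (Const (R k j) * eps l (inn k (?T w)) K))" .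
    have "(\<Sum>k<r. Const (R k j) * inn k (?T (eps i w)) K) =
      (\<Sum>k<r. \<Sum>l<r. Const (R k j) * (Const (c i l) * ((if k = l then ?T w K else 0) - eps l (inn k (?T w)) K)))"
      by (simp add: Tact_eps eps.hyps epsl_def[abs_def] inn_sum inn_mult inn_eps sum_distrib_left)
    also have "\<dots> = (\<Sum>k<r. Const (R k j) * Const (c i k)) * ?T w K -
       (\<Sum>k<r. \<Sum>l<r. Const (R k j) * (Const (c i l) * eps l (inn k (?T w)) K))"
      by (simp add: right_diff_distrib sum_subtractf sum_distrib_right mult.assoc if_distrib[of "\<lambda>x. _ * x"] cong: if_cong)
    also have "(\<Sum>k<r. Const (R k j) * Const (c i k)) = (if i = j then 1 else 0 :: 'a pm)"
      using inv[OF eps.hyps assms(2)] by (auto simp: Const_mult[symmetric] Const_sum[symmetric] mult.commute)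
    also have "(\<Sum>k<r. \<Sum>l<r. Const (R k j) * (Const (c i l) * eps l (inn k (?T w)) K)) =
       (\<Sum>l<r. \<Sum>k<r. Const (c i l) * (Const (R k j) * eps l (inn k (?T w)) K))"
      by (subst sum.swap) (simp add: mult_ac)
    finally show ?thesis using 1 by simp
  qed
  then show ?case by blast
qed

text \<open>Assumption \<open>v\<close> is the invariance of row \<open>i\<close>; it absorbs the
  array \<open>R\<close> by which the contractions change.\<close>

lemma Tact_iot:
  assumes "supp_in r w"
    and inv: "\<And>i k. i < r \<Longrightarrow> k < r \<Longrightarrow> (\<Sum>l<r. c i l * R l k) = (if i = k then 1 else 0)"
    and v: "\<And>k. k < r \<Longrightarrow> (\<Sum>j<r. Const (R k j) * lsub n a (v i j)) = v i k"
  shows "Tact n r a c (iot r v i w) = iot r v i (Tact n r a c w)"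
proof
  fix K
  have "Tact n r a c (iot r v i w) K = (\<Sum>j<r. lsub n a (v i j) * Tact n r a c (inn j w) K)"
    by (simp add: iot_def[abs_def] Tact_sum Tact_mult)
  also have "\<dots> = (\<Sum>j<r. \<Sum>k<r. (Const (R k j) * lsub n a (v i j)) * inn k (Tact n r a c w) K)"
    using assms(1) inv by (simp add: Tact_inn[where R = R] sum_distrib_left mult_ac)
  also have "\<dots> = (\<Sum>k<r. (\<Sum>j<r. Const (R k j) * lsub n a (v i j)) * inn k (Tact n r a c w) K)"
    by (subst sum.swap) (simp add: sum_distrib_right)
  also have "\<dots> = iot r v i (Tact n r a c w) K"
    by (simp add: v iot_def)
  finally show "Tact n r a c (iot r v i w) K = iot r v i (Tact n r a c w) K" .
qed

lemma Tact_diff_op: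
  assumes "\<And>I. diff_op s' (lsub n a (w I)) = lsub n a (diff_op s (w I))"
  shows "Tact n r a c (\<lambda>I. diff_op s (w I)) = (\<lambda>I. diff_op s' (Tact n r a c w I))"
proof
  fix K
  have "diff_op s' (lsub n a (w I) * EB r c I K) = lsub n a (diff_op s (w I)) * EB r c I K" for I
    using EB_Const[of r c I K] assms by (auto simp: mult.commute diff_op_Const_mult_right)
  then show "Tact n r a c (\<lambda>I. diff_op s (w I)) K = diff_op s' (Tact n r a c w K)"
    by (simp add: Tact_def diff_op_sum_right)
qed

text \<open>The form part changes by \<open>c\<close> and the differential part by \<open>b\<close>;
  the invariance of row \<open>i\<close> makes the two changes cancel.\<close>

lemma Tact_dst:
  assumes D: "\<And>I j. j < r \<Longrightarrow> diff_op (lsub n b (\<tau> i j)) (lsub n a (w I)) = lsub n a (diff_op (\<tau> i j) (w I))"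
    and \<tau>: "\<And>k. k < r \<Longrightarrow> (\<Sum>j<r. Const (c j k) * lsub n b (\<tau> i j)) = \<tau> i k"
  shows "Tact n r a c (dst r \<tau> i w) = dst r \<tau> i (Tact n r a c w)"
proof
  fix K
  let ?T = "Tact n r a c"
  have "?T (dst r \<tau> i w) K = (\<Sum>j<r. epsl r c j (?T (\<lambda>I. diff_op (\<tau> i j) (w I))) K)"
    by (simp add: dst_def[abs_def] Tact_sum Tact_eps)
  also have "\<dots> = (\<Sum>j<r. epsl r c j (\<lambda>I. diff_op (lsub n b (\<tau> i j)) (?T w I)) K)"
    by (intro sum.cong refl) (simp add: Tact_diff_op[OF D])
  also have "\<dots> = (\<Sum>k<r. \<Sum>j<r. Const (c j k) * eps k (\<lambda>I. diff_op (lsub n b (\<tau> i j)) (?T w I)) K)"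
    unfolding epsl_def by (rule sum.swap)
  also have "\<dots> = (\<Sum>k<r. eps k (\<lambda>I. diff_op (\<Sum>j<r. Const (c j k) * lsub n b (\<tau> i j)) (?T w I)) K)"
    by (simp add: diff_op_sum_left diff_op_mult eps_sum eps_mult)
  also have "\<dots> = dst r \<tau> i (?T w) K" by (simp add: \<tau> dst_def)
  finally show "?T (dst r \<tau> i w) K = dst r \<tau> i (?T w) K" .
qed

lemma tensor_space_iff: "w \<in> tensor_space n r \<longleftrightarrow> supp_in r w \<and> (\<forall>I. in_vars n (w I))"
  unfolding tensor_space_def supp_in_def by blast

lemma supp_in_eps:
  assumes "supp_in r w" "j < r"
  shows "supp_in r (eps j w)"
  unfolding supp_in_def
proof (intro allI impI)
  fix I assume "eps j w I \<noteq> 0"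
  then have "w (I - {j}) \<noteq> 0" by (auto simp: eps_def split: if_splits)
  then have "I - {j} \<subseteq> {..<r}" using assms(1) unfolding supp_in_def by blast
  then show "I \<subseteq> {..<r}" using assms(2) by auto
qed

lemma supp_in_inn:
  assumes "supp_in r w"
  shows "supp_in r (inn j w)"
  unfolding supp_in_def
proof (intro allI impI)
  fix I assume "inn j w I \<noteq> 0"
  then have "w (insert j I) \<noteq> 0" by (auto simp: inn_def split: if_splits)
  then have "insert j I \<subseteq> {..<r}" using assms(1) unfolding supp_in_def by blast
  then show "I \<subseteq> {..<r}" by auto
qed

lemma supp_in_sum: "(\<And>t. t \<in> T \<Longrightarrow> supp_in r (f t)) \<Longrightarrow> supp_in r (\<lambda>K. \<Sum>t\<in>T. f t K)"
  unfolding supp_in_def by (metis (mono_tags, lifting) sum.neutral)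

lemma supp_in_map: "supp_in r w \<Longrightarrow> (\<And>I. w I = 0 \<Longrightarrow> v I = 0) \<Longrightarrow> supp_in r v"
  unfolding supp_in_def by metis

lemma dst_tensor_space:
  assumes "w \<in> tensor_space n r"
  shows "dst r \<tau> i w \<in> tensor_space n r"
proof -
  have "supp_in r (dst r \<tau> i w)" unfolding dst_def[abs_def]
    by (rule supp_in_sum, rule supp_in_eps, rule supp_in_map[of r w])
      (use assms in \<open>auto simp: tensor_space_iff\<close>)
  moreover have "in_vars n (dst r \<tau> i w K)" for K unfolding dst_def
    using assms by (auto simp: tensor_space_iff eps_def intro!: in_vars_sum in_vars_mult in_vars_diff_op)
  ultimately show ?thesis by (simp add: tensor_space_iff)
qed

lemma iot_tensor_space:
  assumes "w \<in> tensor_space n r" "\<And>j. j < r \<Longrightarrow> in_vars n (v i j)"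
  shows "iot r v i w \<in> tensor_space n r"
proof -
  have "supp_in r (iot r v i w)" unfolding iot_def[abs_def]
  proof (rule supp_in_sum)
    fix j
    show "supp_in r (\<lambda>K. v i j * inn j w K)"
      by (rule supp_in_map[OF supp_in_inn[of r w j]]) (use assms in \<open>auto simp: tensor_space_iff\<close>)
  qed
  moreover have "in_vars n (iot r v i w K)" for K unfolding iot_def
    using assms by (auto simp: tensor_space_iff inn_def intro!: in_vars_sum in_vars_mult)
  ultimately show ?thesis by (simp add: tensor_space_iff)
qed

text \<open>The adjugate expresses the Jacobian times each coordinate contraction through the contractions
  with the rows.\<close>

lemma iot_foldr_eq_0_imp:
  fixes v :: "nat \<Rightarrow> nat \<Rightarrow> 'a::field_char_0 pm"
  assumes J: "jacobian r v \<noteq> 0" and w: "supp_in r w"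
    and 0: "\<And>l. set l \<subseteq> {..<r} \<Longrightarrow> foldr (iot r v) l w {} = 0"
  shows "w = (\<lambda>K. 0)"
proof -
  define A where "A = mat r r (\<lambda>(i, j). v i j)"
  have A: "A \<in> carrier_mat r r" by (simp add: A_def)
  define B where "B = adj_mat A"
  have B: "B \<in> carrier_mat r r" "B * A = det A \<cdot>\<^sub>m 1\<^sub>m r" using adj_mat[OF A] by (auto simp: B_def)
  have BA: "(\<Sum>i<r. B $$ (j, i) * v i k) = (if j = k then det A else 0)" if "j < r" "k < r" for j k
  proof -
    have "(B * A) $$ (j, k) = (\<Sum>i<r. B $$ (j, i) * v i k)"
      using that A B(1) by (auto simp: scalar_prod_def A_def atLeast0LessThan intro!: sum.cong)
    from this[symmetric] show ?thesis using that B(2) by simp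
  qed
  \<comment> \<open>\<open>Z\<close> is closed under contraction with a coordinate followed by
    multiplication with \<open>det A\<close>. The coefficient at \<open>K\<close> is therefore
    reached by contracting the elements of \<open>K\<close> one by one, each time cancelling a
    nonzero factor.\<close>
  define Z where "Z = {w. \<forall>l. set l \<subseteq> {..<r} \<longrightarrow> foldr (iot r v) l w {} = 0}"
  have fold_lin: "foldr (iot r v) l (\<lambda>K. \<Sum>i<N. p i * f i K) = (\<lambda>K. \<Sum>i<N. p i * foldr (iot r v) l (f i) K)"
    for l p f and N :: nat
  proof (induction l)
    case (Cons x l)
    have "iot r v x (\<lambda>K. \<Sum>i<N. p i * f i K) = (\<lambda>K. \<Sum>i<N. p i * iot r v x (f i) K)" for f
    proof (induction N)
      case 0 then show ?case by (simp add: iot_def)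
    next
      case (Suc N) then show ?case by (simp add: iot_add iot_mult)
    qed
    then show ?case by (simp add: Cons)
  qed simp
  have Z1: "(\<lambda>K. det A * inn j w K) \<in> Z" if "w \<in> Z" "j < r" for w j
  proof -
    have eq: "(\<lambda>K. det A * inn j w K) = (\<lambda>K. \<Sum>i<r. B $$ (j, i) * iot r v i w K)"
    proof
      fix K
      have "(\<Sum>i<r. B $$ (j, i) * iot r v i w K) = (\<Sum>k<r. (\<Sum>i<r. B $$ (j, i) * v i k) * inn k w K)"
        unfolding iot_def sum_distrib_left sum_distrib_right by (subst sum.swap) (simp add: mult.assoc)
      also have "\<dots> = (\<Sum>k<r. if j = k then det A * inn j w K else 0)"
        using that by (intro sum.cong) (auto simp: BA)
      finally show "det A * inn j w K = (\<Sum>i<r. B $$ (j, i) * iot r v i w K)" using that by simp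
    qed
    have "foldr (iot r v) l (iot r v i w) {} = 0" if "set l \<subseteq> {..<r}" "i < r" for l i
      using \<open>w \<in> Z\<close> that unfolding Z_def by (auto dest!: spec[of _ "l @ [i]"])
    then show ?thesis unfolding eq Z_def by (auto simp: fold_lin intro!: sum.neutral)
  qed
  have J': "det A \<noteq> 0" using J by (simp add: jacobian_def A_def)
  have "w K = 0" if "w \<in> Z" "K \<subseteq> {..<r}" for w K
    using finite_subset[OF that(2) finite_lessThan] that
  proof (induction K arbitrary: w rule: finite_induct)
    case empty
    then show ?case unfolding Z_def by (auto dest!: spec[of _ "[]"])
  next
    case (insert j K)
    then have "det A * inn j w K = 0" using insert.IH[OF Z1, of w j] by simp
    then show ?case using J' insert.hyps by (simp add: inn_def esgn_def)
  qed
  moreover have "w \<in> Z" using 0 by (simp add: Z_def)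
  ultimately show ?thesis using w unfolding supp_in_def by blast
qed

subsection \<open>The determinant as a top-degree coefficient\<close>

lemma sorted_list_of_set_nth_card:
  assumes "finite K" "b < card K"
  shows "card {x \<in> K. x < sorted_list_of_set K ! b} = b"
proof -
  let ?k = "sorted_list_of_set K"
  have s: "sorted_wrt (<) ?k" "length ?k = card K" "set ?k = K" using assms(1) by auto
  have "{x \<in> K. x < ?k ! b} = (!) ?k ` {..<b}"
  proof safe
    fix x assume "x \<in> K" "x < ?k ! b"
    then obtain i where i: "i < card K" "x = ?k ! i" using s by (metis in_set_conv_nth)
    then have "i < b" using \<open>x < ?k ! b\<close> s assms(2) by (metis linorder_neqE_nat order_less_asym sorted_wrt_nth_less less_irrefl)
    then show "x \<in> (!) ?k ` {..<b}" using i by auto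
  next
    fix i assume "i < b"
    then show "?k ! i \<in> K" "?k ! i < ?k ! b" using s assms(2)
      by (metis nth_mem order_less_trans, auto intro: sorted_wrt_nth_less)
  qed
  moreover have "inj_on ((!) ?k) {..<b}"
    using assms s by (intro inj_on_nth) auto
  ultimately show ?thesis by (simp add: card_image)
qed

lemma sorted_list_of_set_remove_nth:
  assumes "finite K" "b < card K" "b' < card K - 1"
  shows "sorted_list_of_set (K - {sorted_list_of_set K ! b}) ! b' = sorted_list_of_set K ! (if b' < b then b' else Suc b')"
proof -
  let ?k = "sorted_list_of_set K"
  let ?t = "take b ?k @ drop (Suc b) ?k"
  have s: "sorted ?k" "distinct ?k" "length ?k = card K" "set ?k = K" using assms(1) by auto
  have id: "?k = take b ?k @ ?k ! b # drop (Suc b) ?k" using assms s by (simp add: id_take_nth_drop)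
  have d: "distinct (take b ?k @ ?k ! b # drop (Suc b) ?k)" "sorted (take b ?k @ ?k ! b # drop (Suc b) ?k)"
    using s id by metis+
  have st: "set (take b ?k @ ?k ! b # drop (Suc b) ?k) = K" using s id by metis
  have "sorted_list_of_set (K - {?k ! b}) = ?t"
    by (rule sorted_distinct_set_unique)
      (use assms(1) d st in \<open>auto simp: sorted_append\<close>)
  then show ?thesis using assms s by (auto simp: nth_append min_def)
qed

text \<open>Laplace expansion along the first row, which the operator applied last supplies. The
  signs \<open>esgn\<close> are those of the cofactors because the element of \<open>K\<close> in
  position \<open>b\<close> has exactly \<open>b\<close> smaller ones. General \<open>K\<close> are
  needed for the minors.\<close>

lemma foldr_dst_emb:
  fixes \<tau> :: "nat \<Rightarrow> nat \<Rightarrow> 'a::field_char_0 pm"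
  assumes "K \<subseteq> {..<r}" "i + card K = r"
  shows "foldr (dst r \<tau>) [i..<r] (emb u) K =
    diff_op (det (mat (card K) (card K) (\<lambda>(a, b). \<tau> (i + a) (sorted_list_of_set K ! b)))) u"
  using assms
proof (induction "card K" arbitrary: i K)
  case 0
  then have "K = {}" using finite_subset[OF 0(2)] by auto
  with 0 show ?case by (simp add: emb_def det_dim_zero)
next
  case (Suc m)
  have fin: "finite K" using finite_subset[OF Suc(3)] by auto
  let ?k = "sorted_list_of_set K"
  let ?A = "mat (card K) (card K) (\<lambda>(a, b). \<tau> (i + a) (?k ! b))"
  have k: "length ?k = card K" "set ?k = K" "distinct ?k" using fin by auto
  have D: "mat_delete ?A 0 b = mat m m (\<lambda>(a, b'). \<tau> (Suc i + a) (sorted_list_of_set (K - {?k ! b}) ! b'))"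
    if "b < card K" for b
    using that Suc(2) fin by (intro eq_matI) (auto simp: mat_delete_def sorted_list_of_set_remove_nth)
  have IH: "foldr (dst r \<tau>) [Suc i..<r] (emb u) (K - {?k ! b}) = diff_op (det (mat_delete ?A 0 b)) u"
    if "b < card K" for b
  proof -
    have "?k ! b \<in> K" using that k by (metis nth_mem)
    then have c: "card (K - {?k ! b}) = m" using Suc(2) fin by simp
    have "foldr (dst r \<tau>) [Suc i..<r] (emb u) (K - {?k ! b}) =
      diff_op (det (mat m m (\<lambda>(a, b'). \<tau> (Suc i + a) (sorted_list_of_set (K - {?k ! b}) ! b')))) u"
      using Suc(1)[of "K - {?k ! b}" "Suc i"] Suc(2-4) c by auto
    then show ?thesis using D[OF that] by simp
  qed
  have "[i..<r] = i # [Suc i..<r]" using Suc by (simp add: upt_conv_Cons)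
  then have "foldr (dst r \<tau>) [i..<r] (emb u) K = dst r \<tau> i (foldr (dst r \<tau>) [Suc i..<r] (emb u)) K" by simp
  also have "\<dots> = (\<Sum>j\<in>K. Const (esgn j K) * diff_op (\<tau> i j) (foldr (dst r \<tau>) [Suc i..<r] (emb u) (K - {j})))"
    unfolding dst_def eps_def using Suc(3) by (intro sum.mono_neutral_cong_right) auto
  also have "\<dots> = (\<Sum>b<card K. Const (esgn (?k ! b) K) * diff_op (\<tau> i (?k ! b)) (foldr (dst r \<tau>) [Suc i..<r] (emb u) (K - {?k ! b})))"
    using bij_betw_nth[of ?k "{..<card K}" K] k by (intro sum.reindex_bij_betw[symmetric]) auto
  also have "\<dots> = (\<Sum>b<card K. diff_op (?A $$ (0, b) * cofactor ?A 0 b) u)"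
  proof (intro sum.cong refl)
    fix b assume b: "b \<in> {..<card K}"
    have e: "((- 1) ^ b :: 'a pm) = Const ((- 1) ^ b)" by (simp add: Const_power Const_uminus)
    have "esgn (?k ! b) K = ((-1) ^ b :: 'a)" using b fin by (simp add: esgn_def sorted_list_of_set_nth_card)
    then show "Const (esgn (?k ! b) K) * diff_op (\<tau> i (?k ! b)) (foldr (dst r \<tau>) [Suc i..<r] (emb u) (K - {?k ! b}))
        = diff_op (?A $$ (0, b) * cofactor ?A 0 b) u"
      using b Suc(2) IH[of b] e by (simp add: cofactor_def diff_op_mult diff_op_Const_mult_right)
  qed
  also have "\<dots> = diff_op (\<Sum>b<card K. ?A $$ (0, b) * cofactor ?A 0 b) u"
    by (simp add: diff_op_sum_left)
  also have "(\<Sum>b<card K. ?A $$ (0, b) * cofactor ?A 0 b) = det ?A"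
    by (rule laplace_expansion_row[symmetric]) (use Suc(2) in auto)
  finally show ?case .
qed

lemma dst_top: "foldr (dst r \<tau>) [0..<r] (emb u) {..<r} = diff_op (jacobian r \<tau>) u"
  for \<tau> :: "nat \<Rightarrow> nat \<Rightarrow> 'a::field_char_0 pm"
proof -
  have "sorted_list_of_set {..<r} = [0..<r]" by (simp add: lessThan_atLeast0)
  then have "mat r r (\<lambda>(a, b). \<tau> (0 + a) (sorted_list_of_set {..<r} ! b)) = mat r r (\<lambda>(i, j). \<tau> i j)"
    by (intro eq_matI) auto
  then show ?thesis using foldr_dst_emb[of "{..<r}" r 0 \<tau> u] by (simp add: jacobian_def)
qed

subsection \<open>Embedding finitely generated subfields into the complex numbers\<close>

text \<open>The homomorphism is a total function constrained on the carrier \<open>K\<close> only.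
  So \<open>K\<close> can grow inside a proof without new types, and complex conjugation is another
  instance.\<close>

locale subfield_hom =
  fixes K :: "'a::field_char_0 set" and \<phi> :: "'a \<Rightarrow> complex"
  assumes one_K [simp]: "1 \<in> K"
    and add_K [simp]: "x \<in> K \<Longrightarrow> y \<in> K \<Longrightarrow> x + y \<in> K"
    and uminus_K [simp]: "x \<in> K \<Longrightarrow> - x \<in> K"
    and mult_K [simp]: "x \<in> K \<Longrightarrow> y \<in> K \<Longrightarrow> x * y \<in> K"
    and inverse_K [simp]: "x \<in> K \<Longrightarrow> inverse x \<in> K"
    and hom_1 [simp]: "\<phi> 1 = 1"
    and hom_add [simp]: "x \<in> K \<Longrightarrow> y \<in> K \<Longrightarrow> \<phi> (x + y) = \<phi> x + \<phi> y"
    and hom_mult [simp]: "x \<in> K \<Longrightarrow> y \<in> K \<Longrightarrow> \<phi> (x * y) = \<phi> x * \<phi> y"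
begin

lemma zero_K [simp]: "0 \<in> K" using add_K[OF one_K uminus_K[OF one_K]] by simp
lemma hom_0 [simp]: "\<phi> 0 = 0" using hom_add[OF zero_K zero_K] by simp
lemma hom_uminus [simp]: "x \<in> K \<Longrightarrow> \<phi> (- x) = - \<phi> x"
  using hom_add[of x "- x"] by (simp add: add_eq_0_iff)
lemma diff_K [simp]: "x \<in> K \<Longrightarrow> y \<in> K \<Longrightarrow> x - y \<in> K"
  using add_K[of x "- y"] by simp
lemma divide_K [simp]: "x \<in> K \<Longrightarrow> y \<in> K \<Longrightarrow> x / y \<in> K"
  by (simp add: divide_inverse)
lemma sum_K [simp]: "(\<And>i. i \<in> S \<Longrightarrow> f i \<in> K) \<Longrightarrow> sum f S \<in> K"
  by (induction S rule: infinite_finite_induct) auto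
lemma prod_K [simp]: "(\<And>i. i \<in> S \<Longrightarrow> f i \<in> K) \<Longrightarrow> prod f S \<in> K"
  by (induction S rule: infinite_finite_induct) auto
lemma hom_sum: "(\<And>i. i \<in> S \<Longrightarrow> f i \<in> K) \<Longrightarrow> \<phi> (sum f S) = (\<Sum>i\<in>S. \<phi> (f i))"
  by (induction S rule: infinite_finite_induct) auto
lemma hom_prod: "(\<And>i. i \<in> S \<Longrightarrow> f i \<in> K) \<Longrightarrow> \<phi> (prod f S) = (\<Prod>i\<in>S. \<phi> (f i))"
  by (induction S rule: infinite_finite_induct) auto
lemma of_nat_K [simp]: "of_nat k \<in> K" by (induction k) auto
lemma hom_of_nat [simp]: "\<phi> (of_nat k) = of_nat k" by (induction k) auto
lemma hom_eq_0_iff [simp]: "x \<in> K \<Longrightarrow> \<phi> x = 0 \<longleftrightarrow> x = 0"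
  using hom_mult[of x "inverse x"] by (cases "x = 0") auto

definition PK :: "'a poly set" where "PK = {p. \<forall>i. poly.coeff p i \<in> K}"

lemma PK_add: "p \<in> PK \<Longrightarrow> q \<in> PK \<Longrightarrow> p + q \<in> PK"
  and PK_diff: "p \<in> PK \<Longrightarrow> q \<in> PK \<Longrightarrow> p - q \<in> PK"
  and PK_uminus: "p \<in> PK \<Longrightarrow> - p \<in> PK"
  and PK_0: "0 \<in> PK"
  by (auto simp: PK_def)

lemma PK_mult: "p \<in> PK \<Longrightarrow> q \<in> PK \<Longrightarrow> p * q \<in> PK"
  by (auto simp: PK_def coeff_mult)

lemma PK_monom: "c \<in> K \<Longrightarrow> Polynomial.monom c k \<in> PK"
  by (auto simp: PK_def)

lemma PK_const: "c \<in> K \<Longrightarrow> [:c:] \<in> PK"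
  by (auto simp: PK_def coeff_pCons split: nat.split)

abbreviation mp :: "'a poly \<Rightarrow> complex poly" where "mp \<equiv> map_poly \<phi>"

lemma coeff_mp [simp]: "poly.coeff (mp p) i = \<phi> (poly.coeff p i)"
  by (simp add: coeff_map_poly)

lemma mp_add: "p \<in> PK \<Longrightarrow> q \<in> PK \<Longrightarrow> mp (p + q) = mp p + mp q"
  by (rule poly_eqI) (auto simp: PK_def)

lemma mp_uminus: "p \<in> PK \<Longrightarrow> mp (- p) = - mp p"
  by (rule poly_eqI) (auto simp: PK_def)

lemma mp_mult: "p \<in> PK \<Longrightarrow> q \<in> PK \<Longrightarrow> mp (p * q) = mp p * mp q"
  by (rule poly_eqI) (auto simp: PK_def coeff_mult hom_sum)

lemma mp_diff: "p \<in> PK \<Longrightarrow> q \<in> PK \<Longrightarrow> mp (p - q) = mp p - mp q"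
  using mp_add[of p "- q"] PK_uminus[of q] mp_uminus[of q] by simp

lemma mp_const: "mp [:c:] = [:\<phi> c:]"
  by (rule poly_eqI) (auto simp: coeff_pCons split: nat.split)

lemma degree_mp: "p \<in> PK \<Longrightarrow> Polynomial.degree (mp p) = Polynomial.degree p"
  by (cases "p = 0") (auto simp: PK_def intro!: map_poly_degree_eq)

lemma mp_eq_0: "p \<in> PK \<Longrightarrow> mp p = 0 \<longleftrightarrow> p = 0"
  by (auto simp: PK_def poly_eq_iff)

text \<open>Long division divides by the leading coefficient of \<open>P\<close> only, so quotient
  and remainder keep their coefficients in \<open>K\<close>.\<close>

lemma PK_division:
  assumes P: "P \<in> PK" "P \<noteq> 0" and q: "q \<in> PK"
  shows "\<exists>s\<in>PK. \<exists>t\<in>PK. q = P * s + t \<and> (t = 0 \<or> Polynomial.degree t < Polynomial.degree P)"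
  using q
proof (induction "Polynomial.degree q" arbitrary: q rule: less_induct)
  case less
  show ?case
  proof (cases "q = 0 \<or> Polynomial.degree q < Polynomial.degree P")
    case True
    then show ?thesis using less.prems PK_0 by (intro bexI[of _ 0] bexI[of _ q]) auto
  next
    case False
    let ?m = "Polynomial.monom (lead_coeff q / lead_coeff P) (Polynomial.degree q - Polynomial.degree P)"
    let ?q' = "q - P * ?m"
    have m: "?m \<in> PK" using less.prems P(1) by (intro PK_monom divide_K) (auto simp: PK_def)
    have q': "?q' \<in> PK" using m less.prems P(1) by (intro PK_diff PK_mult) auto
    have m0: "?m \<noteq> 0" using False P by simp
    have dm: "Polynomial.degree ?m = Polynomial.degree q - Polynomial.degree P"
      using False P by (intro degree_monom_eq) simp
    have d: "Polynomial.degree (P * ?m) = Polynomial.degree q"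
      using degree_mult_eq[OF P(2) m0] dm False by simp
    have lc: "lead_coeff (P * ?m) = lead_coeff q"
      unfolding lead_coeff_mult using P by (simp only: lead_coeff_monom) simp
    show ?thesis
    proof (cases "?q' = 0")
      case True
      then show ?thesis using m PK_0 by (intro bexI[of _ ?m] bexI[of _ 0]) auto
    next
      case F: False
      have "Polynomial.degree ?q' \<le> Polynomial.degree q" using d by (metis degree_diff_le_max max.idem)
      moreover have "poly.coeff ?q' (Polynomial.degree q) = 0" using d lc by simp
      ultimately have "Polynomial.degree ?q' < Polynomial.degree q"
        using F by (metis leading_coeff_0_iff order_le_neq_trans)
      from less.hyps[OF this q'] obtain s t where st: "s \<in> PK" "t \<in> PK" "?q' = P * s + t"
          "t = 0 \<or> Polynomial.degree t < Polynomial.degree P" by blast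
      have "q = P * (s + ?m) + t" using st(3) by (simp add: algebra_simps)
      then show ?thesis using st m PK_add by blast
    qed
  qed
qed

text \<open>If \<open>a\<close> is algebraic over \<open>K\<close>, a complex root of the image of
  its minimal polynomial works. If it is transcendental, the countably many nonzero image
  polynomials have only countably many roots, and any other complex number works.\<close>

lemma exists_conjugate:
  assumes "countable K"
  shows "\<exists>z. \<forall>p\<in>PK. poly p a = 0 \<longleftrightarrow> poly (mp p) z = 0"
proof (cases "\<exists>p\<in>PK. p \<noteq> 0 \<and> poly p a = 0")
  case True
  define Q where "Q = (\<lambda>p. p \<in> PK \<and> p \<noteq> 0 \<and> poly p a = 0)"
  obtain p0 where "Q p0" using True by (auto simp: Q_def)
  then obtain P where P: "Q P" and Pmin: "\<And>p. Q p \<Longrightarrow> Polynomial.degree P \<le> Polynomial.degree p"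
    using ex_has_least_nat[of Q p0 Polynomial.degree] by blast
  have PP: "P \<in> PK" "P \<noteq> 0" "poly P a = 0" using P by (auto simp: Q_def)
  have "Polynomial.degree P \<noteq> 0"
  proof
    assume "Polynomial.degree P = 0"
    then obtain c where "P = [:c:]" by (rule degree_eq_zeroE)
    then show False using PP(2,3) by simp
  qed
  then have "Polynomial.degree (mp P) \<noteq> 0" by (simp add: degree_mp PP)
  then have "\<not> constant (poly (mp P))" by (simp add: constant_degree)
  then obtain z where z: "poly (mp P) z = 0" using fundamental_theorem_of_algebra by blast
  \<comment> \<open>Irreducibility is used in this form: the nonzero polynomial \<open>P'\<close> of
    least degree whose image vanishes at \<open>z\<close> divides \<open>P\<close>, and if it did
    not vanish at \<open>a\<close>, the cofactor would contradict the minimality of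
    \<open>P\<close>.\<close>
  define R where "R = (\<lambda>p. p \<in> PK \<and> p \<noteq> 0 \<and> poly (mp p) z = 0)"
  have "R P" using PP z by (simp add: R_def)
  then obtain P' where P': "R P'" and P'min: "\<And>p. R p \<Longrightarrow> Polynomial.degree P' \<le> Polynomial.degree p"
    using ex_has_least_nat[of R P Polynomial.degree] by blast
  have PP': "P' \<in> PK" "P' \<noteq> 0" "poly (mp P') z = 0" using P' by (auto simp: R_def)
  have div: "\<exists>s\<in>PK. p = P * s" if p: "p \<in> PK" "poly p a = 0" for p
  proof -
    obtain s t where st: "s \<in> PK" "t \<in> PK" "p = P * s + t" "t = 0 \<or> Polynomial.degree t < Polynomial.degree P"
      using PK_division[OF PP(1,2) p(1)] by blast
    then have "poly t a = 0" using p PP by simp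
    then have "t = 0" using st Pmin[of t] unfolding Q_def by force
    then show ?thesis using st by auto
  qed
  have div': "\<exists>s\<in>PK. p = P' * s" if p: "p \<in> PK" "poly (mp p) z = 0" for p
  proof -
    obtain s t where st: "s \<in> PK" "t \<in> PK" "p = P' * s + t" "t = 0 \<or> Polynomial.degree t < Polynomial.degree P'"
      using PK_division[OF PP'(1,2) p(1)] by blast
    then have "poly (mp t) z = 0" using p PP' by (simp add: mp_add mp_mult PK_mult)
    then have "t = 0" using st P'min[of t] unfolding R_def by force
    then show ?thesis using st by auto
  qed
  obtain s where s: "s \<in> PK" "P = P' * s" using div'[OF PP(1) z] by blast
  have "poly P' a = 0"
  proof (rule ccontr)
    assume "poly P' a \<noteq> 0"
    then have "poly s a = 0" "s \<noteq> 0" using PP s by auto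
    then have "Polynomial.degree P \<le> Polynomial.degree s" using Pmin[of s] s by (simp add: Q_def)
    moreover have "Polynomial.degree P = Polynomial.degree P' + Polynomial.degree s"
      using s PP'(2) \<open>s \<noteq> 0\<close> by (simp add: degree_mult_eq)
    ultimately have "Polynomial.degree (mp P') = 0" by (simp add: degree_mp PP')
    then obtain c where "mp P' = [:c:]" by (metis degree_eq_zeroE)
    moreover have "mp P' \<noteq> 0" by (simp add: mp_eq_0 PP')
    ultimately show False using PP'(3) by auto
  qed
  then have "poly p a = 0 \<longleftrightarrow> poly (mp p) z = 0" if p: "p \<in> PK" for p
    using div[OF p] div'[OF p] z PP(1) by (auto simp: mp_mult)
  then show ?thesis by blast
next
  case False
  have "PK \<subseteq> Poly ` lists K"
  proof
    fix p assume "p \<in> PK"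
    then have "set (coeffs p) \<subseteq> K" unfolding PK_def by (auto simp: coeffs_def split: if_splits)
    then show "p \<in> Poly ` lists K" by (intro image_eqI[of _ _ "coeffs p"]) auto
  qed
  then have "countable PK" by (rule countable_subset) (use assms in auto)
  then have "countable (\<Union>p\<in>PK - {0}. {z. poly (mp p) z = 0})"
    by (intro countable_UN) (auto intro!: countable_finite poly_roots_finite simp: mp_eq_0)
  then obtain z where "z \<notin> (\<Union>p\<in>PK - {0}. {z. poly (mp p) z = 0})"
    using uncountable_UNIV_complex by (metis UNIV_eq_I)
  then have "poly p a = 0 \<longleftrightarrow> poly (mp p) z = 0" if "p \<in> PK" for p
    using False that by (cases "p = 0") auto
  then show ?thesis by blast
qed

text \<open>The new field consists of the quotients of polynomial values at \<open>a\<close>, and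
  evaluation is moved to the conjugate \<open>z\<close>; well-definedness is the equality of
  relations satisfied by \<open>a\<close> and \<open>z\<close>. Countability is carried along for
  the next transcendental step.\<close>

lemma extend:
  assumes "countable K"
  shows "\<exists>K' \<phi>'. subfield_hom K' \<phi>' \<and> countable K' \<and> K \<subseteq> K' \<and> a \<in> K'"
proof -
  obtain z where z: "\<And>p. p \<in> PK \<Longrightarrow> poly p a = 0 \<longleftrightarrow> poly (mp p) z = 0"
    using exists_conjugate[OF assms] by blast
  define K' where "K' = {poly p a / poly q a | p q. p \<in> PK \<and> q \<in> PK \<and> poly q a \<noteq> 0}"
  define \<phi>' where "\<phi>' x = (THE y. \<exists>p\<in>PK. \<exists>q\<in>PK. poly q a \<noteq> 0 \<and> x = poly p a / poly q a \<and>
      y = poly (mp p) z / poly (mp q) z)" for x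
  have \<phi>': "\<phi>' (poly p a / poly q a) = poly (mp p) z / poly (mp q) z"
    if pq: "p \<in> PK" "q \<in> PK" "poly q a \<noteq> 0" for p q
    unfolding \<phi>'_def
  proof (rule the_equality)
    fix y assume "\<exists>p'\<in>PK. \<exists>q'\<in>PK. poly q' a \<noteq> 0 \<and> poly p a / poly q a = poly p' a / poly q' a \<and>
      y = poly (mp p') z / poly (mp q') z"
    then obtain p' q' where pq': "p' \<in> PK" "q' \<in> PK" "poly q' a \<noteq> 0"
      "poly p a / poly q a = poly p' a / poly q' a" "y = poly (mp p') z / poly (mp q') z" by blast
    have "poly (p * q' - p' * q) a = 0" using pq pq' by (simp add: field_simps)
    moreover have "p * q' - p' * q \<in> PK" by (intro PK_diff PK_mult pq pq')
    ultimately have "poly (mp (p * q' - p' * q)) z = 0" using z by blast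
    then have "poly (mp p) z * poly (mp q') z = poly (mp p') z * poly (mp q) z"
      using pq pq' by (simp add: mp_diff mp_mult PK_mult)
    moreover have "poly (mp q) z \<noteq> 0" "poly (mp q') z \<noteq> 0" using z[OF pq(2)] z[OF pq'(2)] pq(3) pq'(3) by auto
    ultimately show "y = poly (mp p) z / poly (mp q) z" unfolding pq'(5) by (simp add: field_simps)
  qed (use pq in blast)
  have inK': "poly p a / poly q a \<in> K'" if "p \<in> PK" "q \<in> PK" "poly q a \<noteq> 0" for p q
    using that unfolding K'_def by blast
  have P1: "[:1:] \<in> PK" by (rule PK_const) simp
  have "subfield_hom K' \<phi>'"
  proof
    show "1 \<in> K'" using inK'[OF P1 P1] by simp
    show "\<phi>' 1 = 1" using \<phi>'[OF P1 P1] by (simp add: mp_const)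
  next
    fix x assume "x \<in> K'"
    then obtain p q where pq: "p \<in> PK" "q \<in> PK" "poly q a \<noteq> 0" "x = poly p a / poly q a"
      unfolding K'_def by blast
    show "- x \<in> K'" using inK'[OF PK_uminus[OF pq(1)] pq(2,3)] pq by simp
    show "inverse x \<in> K'"
    proof (cases "poly p a = 0")
      case True
      then show ?thesis using inK'[OF PK_0 P1] pq by simp
    next
      case False
      then show ?thesis using inK'[OF pq(2,1)] pq by simp
    qed
    fix y assume "y \<in> K'"
    then obtain p' q' where pq': "p' \<in> PK" "q' \<in> PK" "poly q' a \<noteq> 0" "y = poly p' a / poly q' a"
      unfolding K'_def by blast
    have nz: "poly (q * q') a \<noteq> 0" "poly (mp q) z \<noteq> 0" "poly (mp q') z \<noteq> 0" using z[OF pq(2)] z[OF pq'(2)] pq(3) pq'(3) by auto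
    have M: "p * p' \<in> PK" "q * q' \<in> PK" "p * q' + p' * q \<in> PK" using pq pq' by (auto intro: PK_mult PK_add)
    have xy: "x * y = poly (p * p') a / poly (q * q') a" "x + y = poly (p * q' + p' * q) a / poly (q * q') a"
      unfolding pq(4) pq'(4) using pq(3) pq'(3) by (simp_all add: add_frac_eq)
    show "x * y \<in> K'" "x + y \<in> K'" unfolding xy by (intro inK' M nz)+
    show "\<phi>' (x * y) = \<phi>' x * \<phi>' y" unfolding xy(1) \<phi>'[OF M(1,2) nz(1)]
      unfolding pq pq' \<phi>'[OF pq(1-3)] \<phi>'[OF pq'(1-3)] using pq pq' by (simp add: mp_mult)
    show "\<phi>' (x + y) = \<phi>' x + \<phi>' y" unfolding xy(2) \<phi>'[OF M(3,2) nz(1)]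
      unfolding pq pq' \<phi>'[OF pq(1-3)] \<phi>'[OF pq'(1-3)] using pq pq' nz
      by (simp add: mp_mult mp_add PK_mult field_simps)
  qed
  moreover have "countable K'"
  proof -
    have "PK \<subseteq> Poly ` lists K"
    proof
      fix p assume "p \<in> PK"
      then have "set (coeffs p) \<subseteq> K" unfolding PK_def by (auto simp: coeffs_def split: if_splits)
      then show "p \<in> Poly ` lists K" by (intro image_eqI[of _ _ "coeffs p"]) auto
    qed
    then have "countable PK" by (rule countable_subset) (use assms in auto)
    then have "countable ((\<lambda>(p, q). poly p a / poly q a) ` (PK \<times> PK))" by blast
    then show ?thesis by (rule countable_subset[rotated]) (auto simp: K'_def)
  qed
  moreover have "K \<subseteq> K'"
  proof
    fix c assume "c \<in> K"
    then show "c \<in> K'" using inK'[OF PK_const[of c] P1] by simp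
  qed
  moreover have "a \<in> K'"
  proof -
    have "[:0, 1:] \<in> PK" by (auto simp: PK_def coeff_pCons split: nat.split)
    then show ?thesis using inK'[of "[:0, 1:]" "[:1:]"] P1 by simp
  qed
  ultimately show ?thesis by blast
qed

end

lemma exists_subfield_hom:
  fixes S :: "'a::field_char_0 set"
  assumes "finite S"
  shows "\<exists>K \<phi>. subfield_hom K \<phi> \<and> S \<subseteq> K"
proof -
  have "\<exists>K \<phi>. subfield_hom K \<phi> \<and> countable K \<and> S \<subseteq> K"
    using assms
  proof (induction S rule: finite_induct)
    case empty
    define \<psi> where "\<psi> x = (of_rat (inv_into UNIV of_rat x) :: complex)" for x :: 'a
    have \<psi>: "\<psi> (of_rat q) = of_rat q" for q
      unfolding \<psi>_def by (simp add: inv_f_f inj_def)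
    have "subfield_hom \<rat> \<psi>"
    proof
      show "\<psi> 1 = 1" using \<psi>[of 1] by simp
    next
      fix x y :: 'a assume "x \<in> \<rat>" "y \<in> \<rat>"
      then obtain p q where "x = of_rat p" "y = of_rat q" by (auto elim!: Rats_cases)
      then show "\<psi> (x + y) = \<psi> x + \<psi> y" "\<psi> (x * y) = \<psi> x * \<psi> y"
        using \<psi>[of "p + q"] \<psi>[of "p * q"] \<psi>[of p] \<psi>[of q] by (simp_all add: of_rat_add of_rat_mult)
    qed (auto simp: Rats_inverse)
    moreover have "countable (\<rat> :: 'a set)" unfolding Rats_def by simp
    ultimately show ?case by blast
  next
    case (insert a S)
    then obtain K \<phi> where K: "subfield_hom K \<phi>" "countable K" "S \<subseteq> K" by blast
    interpret subfield_hom K \<phi> by fact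
    show ?case using extend[OF K(2), of a] K(3) by blast
  qed
  then show ?thesis by blast
qed

subsection \<open>Base change of polynomials\<close>

lemma mult_as_sum:
  fixes p q :: "'a::comm_semiring_1 pm"
  assumes "finite S" "keys p \<subseteq> S" "finite T" "keys q \<subseteq> T"
  shows "p * q = (\<Sum>m\<in>S. \<Sum>m'\<in>T. sg (m + m') (lk p m * lk q m'))"
proof -
  have "(\<Sum>m\<in>S. sg m (lk p m)) * (\<Sum>m\<in>T. sg m (lk q m)) =
    (\<Sum>m\<in>S. \<Sum>m'\<in>T. sg (m + m') (lk p m * lk q m'))"
    by (simp add: sum_product mult_single)
  then show ?thesis
    using pm_sum_single_superset[OF assms(1,2)] pm_sum_single_superset[OF assms(3,4)] by argo
qed

lemma jacobian_def': "jacobian r \<omega> = (\<Sum>p\<in>{p. p permutes {0..<r}}. of_int (sign p) * (\<Prod>i=0..<r. \<omega> i (p i)))"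
  unfolding jacobian_def by (subst det_def'[of _ r]) (auto intro!: sum.cong prod.cong dest: permutes_in_image)

context subfield_hom
begin

definition KP :: "'a pm \<Rightarrow> bool" where "KP p \<longleftrightarrow> (\<forall>m. lk p m \<in> K)"

text \<open>Applies \<open>\<phi>\<close> to all coefficients. The algebraic rules hold only under
  \<open>KP\<close>, since \<open>\<phi>\<close> is arbitrary outside \<open>K\<close>.\<close>

definition Phi :: "'a pm \<Rightarrow> complex pm" where "Phi p = Poly_Mapping.map \<phi> p"

lemma lk_Phi [simp]: "lk (Phi p) m = \<phi> (lk p m)"
  unfolding Phi_def by (simp add: Poly_Mapping.map.rep_eq when_def)

lemma KP_0 [simp]: "KP 0" and KP_add: "KP p \<Longrightarrow> KP q \<Longrightarrow> KP (p + q)"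
  by (auto simp: KP_def lookup_add)
lemma KP_single: "c \<in> K \<Longrightarrow> KP (sg m c)" by (auto simp: KP_def lookup_single when_def)
lemma KP_Const: "c \<in> K \<Longrightarrow> KP (Const c)" unfolding Const_def by (rule KP_single)
lemma KP_Var: "KP (Var i)" unfolding Var_def by (rule KP_single) simp
lemma KP_sum: "(\<And>i. i \<in> S \<Longrightarrow> KP (f i)) \<Longrightarrow> KP (sum f S)"
  by (induction S rule: infinite_finite_induct) (auto simp: KP_add)
lemma KP_mult: "KP p \<Longrightarrow> KP q \<Longrightarrow> KP (p * q)"
  unfolding mult_as_sum[OF finite_keys order_refl finite_keys order_refl, of p q]
  by (intro KP_sum KP_single) (auto simp: KP_def)
lemma KP_1: "KP 1" using KP_Const[of 1] by simp
lemma KP_prod: "(\<And>i. i \<in> S \<Longrightarrow> KP (f i)) \<Longrightarrow> KP (prod f S)"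
  by (induction S rule: infinite_finite_induct) (auto simp: KP_mult KP_1)
lemma KP_power: "KP p \<Longrightarrow> KP (p ^ k)"
  by (induction k) (auto simp: KP_mult KP_1)
lemma KP_of_int: "KP (of_int k)"
proof -
  have "of_int k = (Const (of_int k) :: 'a pm)" unfolding Const_def by (simp add: single_of_int)
  moreover have "(of_int k :: 'a) \<in> K"
    by (cases k) (auto simp del: of_nat_Suc)
  ultimately show ?thesis by (simp add: KP_Const)
qed

lemma Phi_0 [simp]: "Phi 0 = 0" by (rule poly_mapping_eqI) simp
lemma Phi_add: "KP p \<Longrightarrow> KP q \<Longrightarrow> Phi (p + q) = Phi p + Phi q"
  by (rule poly_mapping_eqI) (auto simp: KP_def lookup_add)
lemma Phi_sum: "(\<And>i. i \<in> S \<Longrightarrow> KP (f i)) \<Longrightarrow> Phi (sum f S) = (\<Sum>i\<in>S. Phi (f i))"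
  by (induction S rule: infinite_finite_induct) (auto simp: Phi_add KP_sum)
lemma Phi_sum_eq: "(\<And>i. i \<in> S \<Longrightarrow> KP (f i)) \<Longrightarrow> (\<And>i. i \<in> S \<Longrightarrow> Phi (f i) = g i) \<Longrightarrow> Phi (sum f S) = sum g S"
  by (subst Phi_sum) auto
lemma Phi_single: "Phi (sg m c) = sg m (\<phi> c)"
  by (rule poly_mapping_eqI) (auto simp: lookup_single when_def)
lemma Phi_Const: "Phi (Const c) = Const (\<phi> c)" unfolding Const_def by (rule Phi_single)
lemma Phi_1 [simp]: "Phi 1 = 1" using Phi_Const[of 1] by simp
lemma Phi_Var [simp]: "Phi (Var i) = Var i" unfolding Var_def Phi_single by simp
lemma keys_Phi: "keys (Phi p) \<subseteq> keys p" by (auto simp: in_keys_iff)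
lemma Phi_mult:
  assumes "KP p" "KP q" shows "Phi (p * q) = Phi p * Phi q"
proof -
  have "Phi (p * q) = (\<Sum>m\<in>keys p. \<Sum>m'\<in>keys q. sg (m + m') (\<phi> (lk p m) * \<phi> (lk q m')))"
    unfolding mult_as_sum[OF finite_keys order_refl finite_keys order_refl, of p q]
    using assms by (intro Phi_sum_eq KP_sum KP_single) (auto simp: KP_def Phi_single)
  then show ?thesis
    unfolding mult_as_sum[OF finite_keys keys_Phi finite_keys keys_Phi, of p q] by simp
qed
lemma Phi_prod: "(\<And>i. i \<in> S \<Longrightarrow> KP (f i)) \<Longrightarrow> Phi (prod f S) = (\<Prod>i\<in>S. Phi (f i))"
  by (induction S rule: infinite_finite_induct) (auto simp: Phi_mult KP_prod)
lemma Phi_prod_eq: "(\<And>i. i \<in> S \<Longrightarrow> KP (f i)) \<Longrightarrow> (\<And>i. i \<in> S \<Longrightarrow> Phi (f i) = g i) \<Longrightarrow> Phi (prod f S) = prod g S"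
  by (subst Phi_prod) auto
lemma Phi_power: "KP p \<Longrightarrow> Phi (p ^ k) = Phi p ^ k"
  by (induction k) (auto simp: Phi_mult KP_power)
lemma Phi_of_int: "Phi (of_int k) = of_int k"
proof (cases k)
  case (nonneg n)
  have "Phi (of_nat n) = of_nat n" by (induction n) (auto simp: Phi_add KP_1 KP_of_int[of "int _", simplified])
  then show ?thesis using nonneg by simp
next
  case (neg n)
  have u: "Phi (- p) = - Phi p" if "KP p" for p
    using that by (intro poly_mapping_eqI) (auto simp: KP_def)
  have "Phi (of_nat n) = of_nat n" for n by (induction n) (auto simp: Phi_add KP_1 KP_of_int[of "int _", simplified])
  then show ?thesis using neg u[OF KP_of_int[of "int (Suc n)"]] by (simp del: of_nat_Suc)
qed

lemma KP_lsub:
  assumes p: "KP p" "in_vars n p" and A: "\<And>i k. i < n \<Longrightarrow> k < N \<Longrightarrow> A i k \<in> K"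
  shows "KP (lsub N A p)" "Phi (lsub N A p) = lsub N (\<lambda>i k. \<phi> (A i k)) (Phi p)"
proof -
  let ?s = "\<lambda>j. \<Sum>k<N. Const (A j k) * Var k" and ?s' = "\<lambda>j. \<Sum>k<N. Const (\<phi> (A j k)) * Var k"
  have s: "KP (?s j)" "Phi (?s j) = ?s' j" if "j < n" for j
    using A that by (auto simp: Phi_mult KP_Const KP_Var KP_mult Phi_Const intro!: KP_sum Phi_sum_eq)
  have e: "KP (ev ?s m)" "Phi (ev ?s m) = ev ?s' m" if "m \<in> keys p" for m
  proof -
    have "i < n" if "i \<in> keys m" for i using that \<open>m \<in> keys p\<close> p(2) unfolding in_vars_def by blast
    then show "KP (ev ?s m)" "Phi (ev ?s m) = ev ?s' m"
      using s unfolding ev_def by (auto simp: Phi_power KP_power intro!: KP_prod Phi_prod_eq)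
  qed
  have *: "lsub N A p = (\<Sum>m\<in>keys p. Const (lk p m) * ev ?s m)"
    unfolding lsub_def by (rule psubst_superset) auto
  have c: "lk p m \<in> K" for m using p(1) by (simp add: KP_def)
  show "KP (lsub N A p)" unfolding * using e c by (intro KP_sum KP_mult KP_Const) auto
  have "lsub N (\<lambda>i k. \<phi> (A i k)) (Phi p) = (\<Sum>m\<in>keys p. Const (lk (Phi p) m) * ev ?s' m)"
    unfolding lsub_def by (rule psubst_superset) (auto simp: keys_Phi)
  then show "Phi (lsub N A p) = lsub N (\<lambda>i k. \<phi> (A i k)) (Phi p)"
    unfolding * using e c by (simp add: KP_mult KP_Const Phi_mult Phi_Const Phi_sum_eq)
qed

lemma hom_dc [simp]: "\<phi> (dc m m') = dc m m'" "dc m m' \<in> K"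
proof -
  have p: "pochhammer (of_nat a + 1) b = (of_nat (pochhammer (a + 1) b) :: 'b::comm_semiring_1)" for a b
    using pochhammer_of_nat[of "a + 1" b, where ?'a = 'b] by (simp add: add.commute)
  show "\<phi> (dc m m') = dc m m'" "dc m m' \<in> K"
    unfolding dc_def p by (simp_all add: hom_prod)
qed

lemma Phi_diff_op:
  assumes "KP s" "KP u"
  shows "Phi (diff_op s u) = diff_op (Phi s) (Phi u)"
proof (rule poly_mapping_eqI)
  fix m'
  have "lk s m \<in> K" "lk u m \<in> K" for m using assms by (auto simp: KP_def)
  then show "lk (Phi (diff_op s u)) m' = lk (diff_op (Phi s) (Phi u)) m'"
    by (simp add: lk_diff_op[of s] lk_diff_op_superset[OF finite_keys keys_Phi] hom_sum)
qed

lemma Phi_eq_0_iff: "KP u \<Longrightarrow> Phi u = 0 \<longleftrightarrow> u = 0"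
  by (auto simp: poly_mapping_eq_iff KP_def fun_eq_iff)

lemma in_vars_Phi: "in_vars n p \<Longrightarrow> in_vars n (Phi p)"
  using keys_Phi[of p] unfolding in_vars_def by blast

lemma homog_deg_Phi: "homog_deg d p \<Longrightarrow> homog_deg d (Phi p)"
  using keys_Phi[of p] unfolding homog_deg_def by blast

lemma KP_jacobian:
  assumes "\<And>i j. i < r \<Longrightarrow> j < r \<Longrightarrow> KP (\<omega> i j)"
  shows "KP (jacobian r \<omega>)" "Phi (jacobian r \<omega>) = jacobian r (\<lambda>i j. Phi (\<omega> i j))"
proof -
  have *: "KP (\<Prod>i = 0..<r. \<omega> i (p i))" "Phi (\<Prod>i = 0..<r. \<omega> i (p i)) = (\<Prod>i = 0..<r. Phi (\<omega> i (p i)))"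
    if "p permutes {0..<r}" for p
  proof -
    have "KP (\<omega> i (p i))" if "i \<in> {0..<r}" for i
      using assms that permutes_in_image[OF \<open>p permutes {0..<r}\<close>, of i] by auto
    then show "KP (\<Prod>i = 0..<r. \<omega> i (p i))" "Phi (\<Prod>i = 0..<r. \<omega> i (p i)) = (\<Prod>i = 0..<r. Phi (\<omega> i (p i)))"
      by (auto intro: KP_prod Phi_prod)
  qed
  show "KP (jacobian r \<omega>)" unfolding jacobian_def' using * by (intro KP_sum KP_mult KP_of_int) auto
  show "Phi (jacobian r \<omega>) = jacobian r (\<lambda>i j. Phi (\<omega> i j))"
    unfolding jacobian_def' using * by (intro Phi_sum_eq) (auto simp: KP_mult KP_of_int Phi_mult Phi_of_int)
qed

end

interpretation conj: subfield_hom "UNIV :: complex set" cnj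
  by unfold_locales auto

abbreviation "cj \<equiv> conj.Phi"

lemma conj_KP [simp]: "conj.KP p" by (simp add: conj.KP_def)

subsection \<open>Positivity\<close>

text \<open>The pairing equals the sum over all monomials of \<open>mfact m\<close> times the
  squared modulus of the coefficient, a sum of nonnegative reals.\<close>

lemma br_cj_eq_0_imp:
  assumes "br (cj u) u = 0"
  shows "u = 0"
proof -
  have k: "keys (cj u) = keys u" by (auto simp: in_keys_iff)
  have "br (cj u) u = (\<Sum>m\<in>keys u. complex_of_real (of_nat (mfact m) * (cmod (lk u m))\<^sup>2))"
    unfolding br_eq k by (intro sum.cong refl) (simp add: complex_norm_square[symmetric] mult_ac)
  also have "\<dots> = complex_of_real (\<Sum>m\<in>keys u. of_nat (mfact m) * (cmod (lk u m))\<^sup>2)"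
    by simp
  finally have "(\<Sum>m\<in>keys u. of_nat (mfact m) * (cmod (lk u m))\<^sup>2) = 0"
    using assms by (metis of_real_eq_0_iff)
  then have "\<forall>m\<in>keys u. of_nat (mfact m) * (cmod (lk u m))\<^sup>2 = 0"
    by (subst (asm) sum_nonneg_eq_0_iff) auto
  then have "lk u m = 0" if "m \<in> keys u" for m using that mfact_pos[of m] by fastforce
  then have "lk u m = 0" for m by (cases "m \<in> keys u") (auto simp: in_keys_iff)
  then show ?thesis by (intro poly_mapping_eqI) simp
qed

text \<open>Substituting \<open>B\<close>, into possibly more variables, reduces to the standard form, so that \<open>H\<close> need not
  be diagonalised.\<close>

lemma br_hermitian_eq_0_imp:
  fixes u :: "complex pm"
  assumes u: "in_vars n u" and fin: "finite Z"
    and H: "\<And>j i. j < n \<Longrightarrow> i < n \<Longrightarrow> H j i = (\<Sum>z\<in>Z. cnj (B j z) * B i z)"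
    and C: "\<And>j k. j < n \<Longrightarrow> k < n \<Longrightarrow> (\<Sum>z\<in>Z. B j z * C z k) = (if j = k then 1 else 0)"
    and 0: "br (lsub n H (cj u)) u = 0"
  shows "u = 0"
proof -
  obtain e where e: "bij_betw e {..<card Z} Z"
    using fin by (metis bij_betw_from_nat_into_finite)
  define B' where "B' j z = B j (e z)" for j z
  let ?N = "card Z"
  let ?v = "lsub ?N B' u"
  have sum_e: "(\<Sum>z<?N. f (e z)) = (\<Sum>z\<in>Z. f z)" for f :: "'a \<Rightarrow> complex"
    using e by (rule sum.reindex_bij_betw)
  have cju: "in_vars n (cj u)" using u by (rule conj.in_vars_Phi)
  have "br (cj ?v) ?v = br (lsub ?N (\<lambda>i k. cnj (B' i k)) (cj u)) ?v"
    using u by (simp add: conj.KP_lsub(2))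
  also have "\<dots> = br (cj u) (lsub n (\<lambda>j k. cnj (B' k j)) ?v)"
    using cju by (intro br_lsub) auto
  also have "lsub n (\<lambda>j k. cnj (B' k j)) ?v = lsub n (\<lambda>j k. H k j) u"
    unfolding lsub_compose[OF u]
    by (rule lsub_cong[OF u]) (simp add: H B'_def sum_e[of "\<lambda>z. B _ z * cnj (B _ z)"] mult.commute)
  also have "br (cj u) \<dots> = br (lsub n H (cj u)) u"
    using cju u by (rule br_lsub[symmetric])
  finally have "?v = 0" using 0 br_cj_eq_0_imp by simp
  \<comment> \<open>\<open>C\<close> is a right inverse of \<open>B\<close>, so substituting it
    recovers \<open>u\<close> from its image.\<close>
  then have "lsub n (\<lambda>z k. C (e z) k) ?v = 0" by simp
  moreover have "lsub n (\<lambda>z k. C (e z) k) ?v = u"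
    unfolding lsub_compose[OF u] by (rule lsub_id[OF u]) (simp add: B'_def sum_e[of "\<lambda>z. B _ z * C z _"] C)
  ultimately show ?thesis by simp
qed

text \<open>For a kernel vector v of \<open>H\<close> the Hermitian square is the sum of the squared
  moduli of the \<open>c z\<close>. All of these vanish, and \<open>C\<close> recovers v from them,
  so v is zero; the adjugate then gives the inverse.\<close>

lemma hermitian_invertible:
  fixes r :: nat
  assumes fin: "finite Z"
    and H: "\<And>j i. j < r \<Longrightarrow> i < r \<Longrightarrow> H j i = (\<Sum>z\<in>Z. cnj (B j z) * B i z)"
    and C: "\<And>j k. j < r \<Longrightarrow> k < r \<Longrightarrow> (\<Sum>z\<in>Z. B j z * C z k) = (if j = k then 1 else 0)"
  shows "\<exists>Q. \<forall>j<r. \<forall>k<r. (\<Sum>i<r. H j i * Q i k) = (if j = k then 1 else (0::complex))"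
proof -
  define A where "A = mat r r (\<lambda>(j, i). H j i)"
  have A: "A \<in> carrier_mat r r" by (simp add: A_def)
  have "det A \<noteq> 0"
  proof
    assume "det A = 0"
    then obtain v where v: "v \<in> carrier_vec r" "v \<noteq> 0\<^sub>v r" "A *\<^sub>v v = 0\<^sub>v r"
      using det_0_iff_vec_prod_zero_field[OF A] by blast
    define c where "c z = (\<Sum>i<r. B i z * v $ i)" for z
    have row: "(\<Sum>i<r. H j i * v $ i) = 0" if "j < r" for j
    proof -
      have "(A *\<^sub>v v) $ j = (\<Sum>i<r. H j i * v $ i)"
        using that v(1) A by (auto simp: A_def scalar_prod_def atLeast0LessThan)
      then show ?thesis using v(3) that by simp
    qed
    have "(\<Sum>z\<in>Z. complex_of_real ((cmod (c z))\<^sup>2)) = (\<Sum>z\<in>Z. cnj (c z) * c z)"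
      by (intro sum.cong refl) (simp only: complex_norm_square mult.commute)
    also have "\<dots> = (\<Sum>z\<in>Z. \<Sum>j<r. \<Sum>i<r. cnj (v $ j) * (cnj (B j z) * B i z * v $ i))"
      by (simp only: c_def cnj_sum sum_product) (simp add: mult_ac)
    also have "\<dots> = (\<Sum>j<r. \<Sum>i<r. \<Sum>z\<in>Z. cnj (v $ j) * (cnj (B j z) * B i z * v $ i))"
      by (subst sum.swap, intro sum.cong refl, rule sum.swap)
    also have "\<dots> = (\<Sum>j<r. cnj (v $ j) * (\<Sum>i<r. H j i * v $ i))"
      by (intro sum.cong refl) (simp add: H sum_distrib_left sum_distrib_right mult_ac)
    also have "\<dots> = 0" using row by simp
    finally have "(\<Sum>z\<in>Z. (cmod (c z))\<^sup>2) = 0" by (metis of_real_eq_0_iff of_real_sum)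
    then have c0: "c z = 0" if "z \<in> Z" for z
      using that fin by (subst (asm) sum_nonneg_eq_0_iff) auto
    have "v $ k = 0" if "k < r" for k
    proof -
      have "v $ k = (\<Sum>i<r. if i = k then v $ i else 0)" using that by simp
      also have "\<dots> = (\<Sum>i<r. (\<Sum>z\<in>Z. B i z * C z k) * v $ i)"
        by (intro sum.cong refl) (use C that in auto)
      also have "\<dots> = (\<Sum>z\<in>Z. \<Sum>i<r. B i z * C z k * v $ i)"
        unfolding sum_distrib_right by (rule sum.swap)
      also have "\<dots> = (\<Sum>z\<in>Z. C z k * c z)"
        by (simp add: c_def sum_distrib_left mult_ac)
      also have "\<dots> = 0" using c0 by simp
      finally show ?thesis .
    qed
    then have "v = 0\<^sub>v r" using v(1) by (intro eq_vecI) auto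
    then show False using v(2) by simp
  qed
  define Q where "Q i k = adj_mat A $$ (i, k) / det A" for i k
  have "(\<Sum>i<r. H j i * Q i k) = (if j = k then 1 else 0)" if "j < r" "k < r" for j k
  proof -
    have "(A * adj_mat A) $$ (j, k) = (\<Sum>i<r. H j i * adj_mat A $$ (i, k))"
      using that A adj_mat(1)[OF A] by (auto simp: A_def scalar_prod_def atLeast0LessThan)
    from this[symmetric] have "(\<Sum>i<r. H j i * adj_mat A $$ (i, k)) = (if j = k then det A else 0)"
      using adj_mat(2)[OF A] that by simp
    then show ?thesis using \<open>det A \<noteq> 0\<close> by (simp add: Q_def sum_divide_distrib[symmetric])
  qed
  then show ?thesis by blast
qed

section \<open>Multiplicativity and multilinearity of the Jacobian\<close>

lemma jacobian_row_mult:
  fixes r :: nat and w :: "nat \<Rightarrow> nat \<Rightarrow> 'a::comm_ring_1 pm"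
  shows "jacobian r (\<lambda>i k. \<Sum>j<r. w i j * q j k) = jacobian r w * jacobian r q"
proof -
  have "mat r r (\<lambda>(i, k). \<Sum>j<r. w i j * q j k) = mat r r (\<lambda>(i, j). w i j) * mat r r (\<lambda>(j, k). q j k)"
    by (intro eq_matI) (auto simp: scalar_prod_def atLeast0LessThan)
  then show ?thesis unfolding jacobian_def by (simp add: det_mult[of _ r])
qed

lemma jacobian_cong: "(\<And>i j. i < r \<Longrightarrow> j < r \<Longrightarrow> w i j = w' i j) \<Longrightarrow> jacobian r w = jacobian r w'"
  unfolding jacobian_def by (intro arg_cong[of _ _ det] eq_matI) auto

text \<open>Expansion in all rows at once. It reduces Jacobians of complex equivariant vectors to
  Jacobians of averaged monomials.\<close>

lemma jacobian_multilinear: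
  fixes v :: "nat \<Rightarrow> 'y \<Rightarrow> nat \<Rightarrow> 'a::comm_ring_1 pm"
  assumes "\<And>i. finite (Y i)"
  shows "jacobian r (\<lambda>i k. \<Sum>y\<in>Y i. c i y * v i y k) =
    (\<Sum>f\<in>PiE {0..<r} Y. (\<Prod>i=0..<r. c i (f i)) * jacobian r (\<lambda>i k. v i (f i) k))"
proof -
  have "(\<Prod>i=0..<r. \<Sum>y\<in>Y i. c i y * v i y (p i)) =
    (\<Sum>f\<in>PiE {0..<r} Y. (\<Prod>i=0..<r. c i (f i)) * (\<Prod>i=0..<r. v i (f i) (p i)))" for p
    using assms by (subst prod_sum_PiE) (auto simp: prod.distrib)
  then have "jacobian r (\<lambda>i k. \<Sum>y\<in>Y i. c i y * v i y k) =
     (\<Sum>p\<in>{p. p permutes {0..<r}}. \<Sum>f\<in>PiE {0..<r} Y. (\<Prod>i=0..<r. c i (f i)) * (of_int (sign p) * (\<Prod>i=0..<r. v i (f i) (p i))))"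
    unfolding jacobian_def' by (simp add: sum_distrib_left mult_ac)
  also have "\<dots> = (\<Sum>f\<in>PiE {0..<r} Y. (\<Prod>i=0..<r. c i (f i)) * jacobian r (\<lambda>i k. v i (f i) k))"
    unfolding jacobian_def' by (subst sum.swap) (simp add: sum_distrib_left)
  finally show ?thesis .
qed

subsection \<open>Dual pairs of representations\<close>

text \<open>The matrices \<open>a g\<close>, \<open>a' g\<close> give the action of \<open>g\<close> on the coordinates \<open>x\<^sub>j\<close> of \<open>S(V*)\<close> and \<open>y\<^sub>j\<close> of
  \<open>S(V)\<close>, by rows; \<open>b g\<close> and \<open>b' g\<close> give the action on \<open>M\<close> and \<open>M*\<close>, by columns. This makes the
  situation symmetric under exchanging the two pairs.\<close>

locale dual_rep =
  fixes n r :: nat and G :: "'g set" and mul :: "'g \<Rightarrow> 'g \<Rightarrow> 'g"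
    and a a' b b' :: "'g \<Rightarrow> nat \<Rightarrow> nat \<Rightarrow> 'a::field_char_0"
  assumes finite_G: "finite G" and nonempty_G: "G \<noteq> {}"
    and mul_left: "g \<in> G \<Longrightarrow> bij_betw (mul g) G G"
    and mul_right: "g \<in> G \<Longrightarrow> bij_betw (\<lambda>h. mul h g) G G"
    and a_mul: "g \<in> G \<Longrightarrow> h \<in> G \<Longrightarrow> i < n \<Longrightarrow> k < n \<Longrightarrow> a (mul g h) i k = (\<Sum>l<n. a h i l * a g l k)"
    and a'_mul: "g \<in> G \<Longrightarrow> h \<in> G \<Longrightarrow> i < n \<Longrightarrow> k < n \<Longrightarrow> a' (mul g h) i k = (\<Sum>l<n. a' h i l * a' g l k)"
    and b_mul: "g \<in> G \<Longrightarrow> h \<in> G \<Longrightarrow> i < r \<Longrightarrow> k < r \<Longrightarrow> b (mul g h) i k = (\<Sum>l<r. b g i l * b h l k)"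
    and b'_mul: "g \<in> G \<Longrightarrow> h \<in> G \<Longrightarrow> i < r \<Longrightarrow> k < r \<Longrightarrow> b' (mul g h) i k = (\<Sum>l<r. b' g i l * b' h l k)"
    and a_dual: "g \<in> G \<Longrightarrow> i < n \<Longrightarrow> k < n \<Longrightarrow> (\<Sum>l<n. a g i l * a' g k l) = (if i = k then 1 else 0)"
    and a_dual': "g \<in> G \<Longrightarrow> i < n \<Longrightarrow> k < n \<Longrightarrow> (\<Sum>l<n. a g l i * a' g l k) = (if i = k then 1 else 0)"
    and b_dual: "g \<in> G \<Longrightarrow> i < r \<Longrightarrow> k < r \<Longrightarrow> (\<Sum>l<r. b g i l * b' g k l) = (if i = k then 1 else 0)"
    and b_dual': "g \<in> G \<Longrightarrow> i < r \<Longrightarrow> k < r \<Longrightarrow> (\<Sum>l<r. b g l i * b' g l k) = (if i = k then 1 else 0)"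

lemma dual_rep_swap: "dual_rep n r G mul a a' b b' \<Longrightarrow> dual_rep n r G mul a' a b' b"
proof -
  assume "dual_rep n r G mul a a' b b'"
  then interpret dual_rep n r G mul a a' b b' .
  have "(\<Sum>l<n. a' g i l * a g k l) = (if i = k then 1 else 0)"
    "(\<Sum>l<n. a' g l i * a g l k) = (if i = k then 1 else 0)"
    if "g \<in> G" "i < n" "k < n" for g i k
    using a_dual[OF that(1,3,2)] a_dual'[OF that(1,3,2)] by (simp_all add: mult.commute[of "a' _ _ _"])
  moreover have "(\<Sum>l<r. b' g i l * b g k l) = (if i = k then 1 else 0)"
    "(\<Sum>l<r. b' g l i * b g l k) = (if i = k then 1 else 0)"
    if "g \<in> G" "i < r" "k < r" for g i k
    using b_dual[OF that(1,3,2)] b_dual'[OF that(1,3,2)] by (simp_all add: mult.commute[of "b' _ _ _"])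
  ultimately show ?thesis
    by unfold_locales (use finite_G nonempty_G mul_left mul_right a_mul a'_mul b_mul b'_mul in auto)
qed

lemma sum_swap23: "(\<Sum>x\<in>A. \<Sum>y\<in>B. \<Sum>z\<in>C. f x y z) = (\<Sum>x\<in>A. \<Sum>z\<in>C. \<Sum>y\<in>B. f x y z)"
  by (rule sum.cong[OF refl], rule sum.swap)

lemma sum_rotate: "(\<Sum>x\<in>A. \<Sum>y\<in>B. \<Sum>z\<in>C. f x y z) = (\<Sum>y\<in>B. \<Sum>z\<in>C. \<Sum>x\<in>A. f x y z)"
  by (subst sum.swap) (rule sum_swap23)

text \<open>One definition for both modules of invariants: exchanging the arrays turns
  \<open>inv_SVd_M\<close> into \<open>inv_SV_Mdual\<close>, so results on one side hold on the
  other.\<close>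

definition equivariant_vecs ::
  "nat \<Rightarrow> nat \<Rightarrow> 'g set \<Rightarrow> ('g \<Rightarrow> nat \<Rightarrow> nat \<Rightarrow> 'a::comm_ring_1) \<Rightarrow> ('g \<Rightarrow> nat \<Rightarrow> nat \<Rightarrow> 'a) \<Rightarrow> (nat \<Rightarrow> 'a pm) set" where
  "equivariant_vecs n r G a b = {w. (\<forall>j. in_vars n (w j)) \<and> (\<forall>j\<ge>r. w j = 0) \<and>
     (\<forall>g\<in>G. \<forall>j<r. (\<Sum>k<r. Const (b g j k) * lsub n (a g) (w k)) = w j)}"

context dual_rep
begin

abbreviation "X \<equiv> equivariant_vecs n r G a b"
abbreviation "X' \<equiv> equivariant_vecs n r G a' b'"

lemma X_D:
  assumes "w \<in> X"
  shows "in_vars n (w j)" "g \<in> G \<Longrightarrow> j < r \<Longrightarrow> (\<Sum>k<r. Const (b g j k) * lsub n (a g) (w k)) = w j"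
  using assms by (auto simp: equivariant_vecs_def)

lemma X_D':
  assumes "w \<in> X" "g \<in> G" "l < r"
  shows "lsub n (a g) (w l) = (\<Sum>m<r. Const (b' g m l) * w m)"
proof -
  have "(\<Sum>m<r. Const (b' g m l) * w m) = (\<Sum>m<r. Const (b' g m l) * (\<Sum>k<r. Const (b g m k) * lsub n (a g) (w k)))"
    by (intro sum.cong refl) (simp add: X_D(2)[OF assms(1,2)])
  also have "\<dots> = (\<Sum>m<r. \<Sum>k<r. Const (b g m k * b' g m l) * lsub n (a g) (w k))"
    by (simp add: sum_distrib_left Const_mult mult_ac)
  also have "\<dots> = (\<Sum>k<r. Const (\<Sum>m<r. b g m k * b' g m l) * lsub n (a g) (w k))"
    unfolding Const_sum sum_distrib_right by (rule sum.swap)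
  also have "\<dots> = (\<Sum>k<r. if k = l then lsub n (a g) (w k) else 0)"
    by (intro sum.cong refl) (use assms b_dual' in auto)
  also have "\<dots> = lsub n (a g) (w l)" using assms(3) by simp
  finally show ?thesis by simp
qed

text \<open>The unnormalised group average of the vector with the monomial \<open>m\<close> in place
  \<open>j\<close>. Its coefficients are polynomials in the entries of the arrays, so it is
  available over every field containing these.\<close>

definition av :: "(nat \<Rightarrow>\<^sub>0 nat) \<Rightarrow> nat \<Rightarrow> nat \<Rightarrow> 'a pm" where
  "av m j k = (if k < r then \<Sum>g\<in>G. Const (b g k j) * lsub n (a g) (sg m 1) else 0)"

lemma av_X:
  assumes m: "keys m \<subseteq> {..<n}" and j: "j < r"
  shows "av m j \<in> X"
  unfolding equivariant_vecs_def
proof (intro CollectI conjI ballI allI impI)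
  fix k show "in_vars n (av m j k)" by (auto simp: av_def intro!: in_vars_sum in_vars_mult)
next
  fix k assume "r \<le> k" then show "av m j k = 0" by (simp add: av_def)
next
  fix g i assume g: "g \<in> G" and i: "i < r"
  let ?s = "sg m (1::'a)"
  have s: "in_vars n ?s" using m by (rule in_vars_single)
  have "(\<Sum>k<r. Const (b g i k) * lsub n (a g) (av m j k)) =
     (\<Sum>k<r. \<Sum>h\<in>G. Const (b g i k * b h k j) * lsub n (a g) (lsub n (a h) ?s))"
    by (intro sum.cong refl) (simp add: av_def lsub_sum lsub_mult sum_distrib_left Const_mult mult.assoc)
  also have "\<dots> = (\<Sum>h\<in>G. Const (\<Sum>k<r. b g i k * b h k j) * lsub n (a g) (lsub n (a h) ?s))"
    unfolding Const_sum sum_distrib_right by (rule sum.swap)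
  also have "\<dots> = (\<Sum>h\<in>G. Const (b (mul g h) i j) * lsub n (a (mul g h)) ?s)"
  proof (intro sum.cong refl)
    fix h assume h: "h \<in> G"
    have "lsub n (a g) (lsub n (a h) ?s) = lsub n (a (mul g h)) ?s"
      unfolding lsub_compose[OF s] by (rule lsub_cong[OF s]) (simp add: a_mul g h)
    then show "Const (\<Sum>k<r. b g i k * b h k j) * lsub n (a g) (lsub n (a h) ?s) =
      Const (b (mul g h) i j) * lsub n (a (mul g h)) ?s" by (simp add: b_mul g h i j)
  qed
  also have "\<dots> = av m j i"
    using sum.reindex_bij_betw[OF mul_left[OF g], of "\<lambda>h. Const (b h i j) * lsub n (a h) ?s"] i
    by (simp add: av_def)
  finally show "(\<Sum>k<r. Const (b g i k) * lsub n (a g) (av m j k)) = av m j i" .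
qed

lemma homog_deg_av: "homog_deg (mdeg m) (av m j k)"
  by (auto simp: av_def intro!: homog_deg_sum homog_deg_Const_mult homog_deg_lsub homog_deg_single)

text \<open>Averaging reproduces an equivariant vector up to the factor \<open>card G\<close>, so
  the averages of its own monomials span it, without any new degrees.\<close>

lemma X_av:
  assumes w: "w \<in> X" and k: "k < r"
  shows "w k = (\<Sum>(j, m)\<in>(SIGMA j:{..<r}. keys (w j)). Const (inverse (of_nat (card G)) * lk (w j) m) * av m j k)"
proof -
  let ?c = "of_nat (card G) :: 'a"
  have c: "?c \<noteq> 0" using finite_G nonempty_G by simp
  have "Const ?c * w k = (\<Sum>g\<in>G. w k)"
    unfolding Const_def by simp
  also have "\<dots> = (\<Sum>g\<in>G. \<Sum>j<r. Const (b g k j) * lsub n (a g) (w j))"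
    using X_D(2)[OF w _ k] by simp
  also have "\<dots> = (\<Sum>g\<in>G. \<Sum>j<r. \<Sum>m\<in>keys (w j). Const (lk (w j) m) * (Const (b g k j) * lsub n (a g) (sg m 1)))"
  proof (intro sum.cong refl)
    fix g j
    have "w j = (\<Sum>m\<in>keys (w j). Const (lk (w j) m) * sg m 1)"
      using pm_sum_single[of "w j"] single_eq_Const_mult by (metis (no_types, lifting) sum.cong)
    then have "lsub n (a g) (w j) = (\<Sum>m\<in>keys (w j). Const (lk (w j) m) * lsub n (a g) (sg m 1))"
      by (metis (no_types, lifting) lsub_Const lsub_mult lsub_sum sum.cong)
    then show "Const (b g k j) * lsub n (a g) (w j) =
       (\<Sum>m\<in>keys (w j). Const (lk (w j) m) * (Const (b g k j) * lsub n (a g) (sg m 1)))"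
      by (simp add: sum_distrib_left mult.left_commute)
  qed
  also have "\<dots> = (\<Sum>j<r. \<Sum>m\<in>keys (w j). \<Sum>g\<in>G. Const (lk (w j) m) * (Const (b g k j) * lsub n (a g) (sg m 1)))"
    by (subst sum.swap, rule sum.cong[OF refl], rule sum.swap)
  also have "\<dots> = (\<Sum>j<r. \<Sum>m\<in>keys (w j). Const (lk (w j) m) * av m j k)"
    using k by (simp add: av_def sum_distrib_left)
  finally have *: "Const ?c * w k = (\<Sum>j<r. \<Sum>m\<in>keys (w j). Const (lk (w j) m) * av m j k)" .
  have "w k = Const (inverse ?c) * (Const ?c * w k)"
    using c by (simp add: mult.assoc[symmetric] Const_mult[symmetric])
  also have "\<dots> = (\<Sum>j<r. \<Sum>m\<in>keys (w j). Const (inverse ?c * lk (w j) m) * av m j k)"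
    unfolding * by (simp add: sum_distrib_left Const_mult mult.assoc)
  finally show ?thesis by (simp add: sum.Sigma)
qed

end

context dual_rep
begin

interpretation dual: dual_rep n r G mul a' a b' b
  by (rule dual_rep_swap) (rule dual_rep_axioms)

text \<open>Once the action is moved to the other argument, every group element contributes the same
  pairing with one monomial. Hence no nonzero equivariant vector is orthogonal to all dual
  averages.\<close>

lemma br_av:
  assumes w: "w \<in> X" and m: "keys m \<subseteq> {..<n}" and j: "j < r"
  shows "(\<Sum>k<r. br (dual.av m j k) (w k)) = of_nat (card G * mfact m) * lk (w j) m"
proof -
  let ?s = "sg m (1::'a)"
  have s: "in_vars n ?s" using m by (rule in_vars_single)
  have inv: "br (lsub n (a' g) ?s) (lsub n (a g) (w l)) = br ?s (w l)" if g: "g \<in> G" for g l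
  proof -
    have "lsub n (\<lambda>j k. a' g k j) (lsub n (a g) (w l)) = w l"
      unfolding lsub_compose[OF X_D(1)[OF w]]
      by (rule lsub_id[OF X_D(1)[OF w]]) (use a_dual g in auto)
    then show ?thesis using br_lsub[OF s, of n "lsub n (a g) (w l)" "a' g"] by simp
  qed
  have "(\<Sum>k<r. br (dual.av m j k) (w k)) = (\<Sum>k<r. \<Sum>g\<in>G. b' g k j * br (lsub n (a' g) ?s) (w k))"
    by (intro sum.cong refl) (simp add: dual.av_def br_sum_left br_Const_left)
  also have "\<dots> = (\<Sum>g\<in>G. \<Sum>k<r. b' g k j * br (lsub n (a' g) ?s) (w k))"
    by (rule sum.swap)
  also have "\<dots> = (\<Sum>g\<in>G. br ?s (w j))"
  proof (intro sum.cong refl)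
    fix g assume g: "g \<in> G"
    have "(\<Sum>k<r. b' g k j * br (lsub n (a' g) ?s) (w k)) =
      (\<Sum>k<r. b' g k j * br (lsub n (a' g) ?s) (\<Sum>l<r. Const (b g k l) * lsub n (a g) (w l)))"
      by (intro sum.cong refl) (simp add: X_D(2)[OF w g])
    also have "\<dots> = (\<Sum>k<r. \<Sum>l<r. b' g k j * (b g k l * br ?s (w l)))"
      by (simp add: br_sum_right br_Const_right inv[OF g] sum_distrib_left)
    also have "\<dots> = (\<Sum>l<r. \<Sum>k<r. b' g k j * (b g k l * br ?s (w l)))"
      by (rule sum.swap)
    also have "\<dots> = (\<Sum>l<r. (\<Sum>k<r. b g k l * b' g k j) * br ?s (w l))"
      by (simp only: sum_distrib_right) (simp add: mult_ac)
    also have "\<dots> = (\<Sum>l<r. if l = j then br ?s (w l) else 0)"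
      by (intro sum.cong refl) (use b_dual' g j in auto)
    finally show "(\<Sum>k<r. b' g k j * br (lsub n (a' g) ?s) (w k)) = br ?s (w j)" using j by simp
  qed
  finally show ?thesis by (simp add: br_single)
qed

end

lemma (in subfield_hom) dual_rep_image:
  assumes "dual_rep n r G mul a a' b b'"
    and K: "\<And>g i k. g \<in> G \<Longrightarrow> i < n \<Longrightarrow> k < n \<Longrightarrow> a g i k \<in> K \<and> a' g i k \<in> K"
      "\<And>g i k. g \<in> G \<Longrightarrow> i < r \<Longrightarrow> k < r \<Longrightarrow> b g i k \<in> K \<and> b' g i k \<in> K"
  shows "dual_rep n r G mul (\<lambda>g i k. \<phi> (a g i k)) (\<lambda>g i k. \<phi> (a' g i k)) (\<lambda>g i k. \<phi> (b g i k)) (\<lambda>g i k. \<phi> (b' g i k))"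
proof -
  interpret dual_rep n r G mul a a' b b' by fact
  have if1: "\<phi> (if P then 1 else 0) = (if P then 1 else 0)" for P by simp
  have s: "(\<Sum>l<N. \<phi> (x l) * \<phi> (y l)) = \<phi> (\<Sum>l<N. x l * y l)"
    if "\<And>l. l < N \<Longrightarrow> x l \<in> K" "\<And>l. l < N \<Longrightarrow> y l \<in> K" for N :: nat and x y
    by (subst hom_sum) (use that in auto)
  show ?thesis
  proof
    fix g h i k assume g: "g \<in> G" and h: "h \<in> G" and ik: "i < n" "k < n"
    show "\<phi> (a (mul g h) i k) = (\<Sum>l<n. \<phi> (a h i l) * \<phi> (a g l k))"
      by (subst s) (use g h ik K a_mul in auto)
    show "\<phi> (a' (mul g h) i k) = (\<Sum>l<n. \<phi> (a' h i l) * \<phi> (a' g l k))"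
      by (subst s) (use g h ik K a'_mul in auto)
  next
    fix g h i k assume g: "g \<in> G" and h: "h \<in> G" and ik: "i < r" "k < r"
    show "\<phi> (b (mul g h) i k) = (\<Sum>l<r. \<phi> (b g i l) * \<phi> (b h l k))"
      by (subst s) (use g h ik K b_mul in auto)
    show "\<phi> (b' (mul g h) i k) = (\<Sum>l<r. \<phi> (b' g i l) * \<phi> (b' h l k))"
      by (subst s) (use g h ik K b'_mul in auto)
  next
    fix g i k assume g: "g \<in> G" and ik: "i < n" "k < n"
    show "(\<Sum>l<n. \<phi> (a g i l) * \<phi> (a' g k l)) = (if i = k then 1 else 0)"
      by (subst s) (use g ik K a_dual in auto)
    show "(\<Sum>l<n. \<phi> (a g l i) * \<phi> (a' g l k)) = (if i = k then 1 else 0)"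
      by (subst s) (use g ik K a_dual' in auto)
  next
    fix g i k assume g: "g \<in> G" and ik: "i < r" "k < r"
    show "(\<Sum>l<r. \<phi> (b g i l) * \<phi> (b' g k l)) = (if i = k then 1 else 0)"
      by (subst s) (use g ik K b_dual in auto)
    show "(\<Sum>l<r. \<phi> (b g l i) * \<phi> (b' g l k)) = (if i = k then 1 else 0)"
      by (subst s) (use g ik K b_dual' in auto)
  qed (use finite_G nonempty_G mul_left mul_right in auto)
qed

subsection \<open>The conjugate-linear comparison over the complex numbers\<close>

locale complex_dual_rep = dual_rep n r G mul a a' b b'
  for n r :: nat and G :: "'g set" and mul and a a' b b' :: "'g \<Rightarrow> nat \<Rightarrow> nat \<Rightarrow> complex"
begin

text \<open>The standard Hermitian form summed over the group, as a Gram matrix. A sum over pairs of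
  a conjugate times its partner is the shape required by \<open>br_hermitian_eq_0_imp\<close>; the
  right inverse required there is taken from a single \<open>a' g\<close>.\<close>

definition HV :: "nat \<Rightarrow> nat \<Rightarrow> complex" where
  "HV j i = (\<Sum>(h, m)\<in>G \<times> {..<n}. cnj (a h j m) * a h i m)"

definition HM :: "nat \<Rightarrow> nat \<Rightarrow> complex" where
  "HM l j = (\<Sum>(h, t)\<in>G \<times> {..<r}. cnj (b' h l t) * b' h j t)"

text \<open>The conjugate-linear ring homomorphism that the invariant form induces from polynomials
  on V to those on its dual; \<open>theta_equivariant\<close> says that it intertwines
  \<open>a\<close> with \<open>a'\<close>.\<close>

definition theta :: "complex pm \<Rightarrow> complex pm" where
  "theta p = lsub n HV (cj p)"

lemma theta_add: "theta (p + q) = theta p + theta q"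
  and theta_mult: "theta (p * q) = theta p * theta q"
  and theta_Const: "theta (Const c) = Const (cnj c)"
  and theta_sum: "theta (sum f S) = (\<Sum>i\<in>S. theta (f i))"
  by (simp_all add: theta_def conj.Phi_add conj.Phi_mult conj.Phi_Const conj.Phi_sum lsub_add lsub_mult lsub_sum)

lemma theta_jacobian: "theta (jacobian r \<omega>) = jacobian r (\<lambda>i j. theta (\<omega> i j))"
proof -
  interpret L: comm_ring_hom "lsub n HV" by (rule lsub_hom)
  show ?thesis unfolding theta_def
    by (simp add: conj.KP_jacobian(2)) (simp add: jacobian_def' L.hom_sum L.hom_mult L.hom_prod)
qed

lemma homog_deg_theta: "homog_deg d p \<Longrightarrow> homog_deg d (theta p)"
  unfolding theta_def by (intro homog_deg_lsub conj.homog_deg_Phi)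

lemma theta_definite:
  assumes "in_vars n u" "br (theta u) u = 0"
  shows "u = 0"
proof -
  obtain g where g: "g \<in> G" using nonempty_G by blast
  have "(\<Sum>(h, m)\<in>G \<times> {..<n}. a h j m * (if h = g then a' g k m else 0)) = (if j = k then 1 else 0)"
    if "j < n" "k < n" for j k
  proof -
    have "(\<Sum>(h, m)\<in>G \<times> {..<n}. a h j m * (if h = g then a' g k m else 0)) =
      (\<Sum>h\<in>G. \<Sum>m<n. if h = g then a g j m * a' g k m else 0)"
      unfolding sum.cartesian_product[symmetric] by (intro sum.cong refl) auto
    also have "\<dots> = (\<Sum>m<n. \<Sum>h\<in>G. if h = g then a g j m * a' g k m else 0)"
      by (rule sum.swap)
    also have "\<dots> = (if j = k then 1 else 0)" using g finite_G a_dual[OF g that] by simp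
    finally show ?thesis .
  qed
  then show ?thesis
    using assms finite_G
    by (intro br_hermitian_eq_0_imp[where Z = "G \<times> {..<n}" and H = HV and n = n and
       B = "\<lambda>j (h, m). a h j m" and C = "\<lambda>(h, m) k. if h = g then a' g k m else 0" and u = u])
      (auto simp: HV_def theta_def case_prod_unfold)
qed

lemma HM_inverse: "\<exists>Q. \<forall>j<r. \<forall>k<r. (\<Sum>i<r. HM j i * Q i k) = (if j = k then 1 else 0)"
proof -
  obtain g where g: "g \<in> G" using nonempty_G by blast
  have "(\<Sum>(h, m)\<in>G \<times> {..<r}. b' h j m * (if h = g then b g k m else 0)) = (if j = k then 1 else 0)"
    if "j < r" "k < r" for j k
  proof -
    have "(\<Sum>(h, m)\<in>G \<times> {..<r}. b' h j m * (if h = g then b g k m else 0)) =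
      (\<Sum>h\<in>G. \<Sum>m<r. if h = g then b g k m * b' g j m else 0)"
      unfolding sum.cartesian_product[symmetric] by (intro sum.cong refl) auto
    also have "\<dots> = (\<Sum>m<r. \<Sum>h\<in>G. if h = g then b g k m * b' g j m else 0)"
      by (rule sum.swap)
    also have "\<dots> = (if j = k then 1 else 0)" using g finite_G b_dual[OF g that(2,1)] by auto
    finally show ?thesis .
  qed
  then show ?thesis
    using finite_G
    by (intro hermitian_invertible[where Z = "G \<times> {..<r}" and
       B = "\<lambda>j (h, m). b' h j m" and C = "\<lambda>(h, m) k. if h = g then b g k m else 0"])
      (auto simp: HM_def case_prod_unfold)
qed

text \<open>Right translation by \<open>g\<close> permutes the group. The conjugated factor becomes
  an entry for \<open>mul h g\<close> at once, and the other factor is brought there by undoing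
  \<open>g\<close> with \<open>a'\<close>.\<close>

lemma HV_equivariant:
  assumes g: "g \<in> G" and ji: "j < n" "i < n"
  shows "(\<Sum>k<n. cnj (a g j k) * HV k i) = (\<Sum>l<n. HV j l * a' g l i)"
proof -
  have "(\<Sum>k<n. cnj (a g j k) * HV k i) = (\<Sum>k<n. \<Sum>h\<in>G. \<Sum>m<n. cnj (a g j k * a h k m) * a h i m)"
    by (simp add: HV_def sum.cartesian_product[symmetric] sum_distrib_left mult.assoc)
  also have "\<dots> = (\<Sum>h\<in>G. \<Sum>m<n. \<Sum>k<n. cnj (a g j k * a h k m) * a h i m)"
    by (rule sum_rotate)
  also have "\<dots> = (\<Sum>h\<in>G. \<Sum>m<n. cnj (a (mul h g) j m) * a h i m)"
    by (intro sum.cong refl) (simp add: a_mul g ji sum_distrib_right)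
  also have "\<dots> = (\<Sum>h\<in>G. \<Sum>m<n. cnj (a (mul h g) j m) * (\<Sum>l<n. a (mul h g) l m * a' g l i))"
  proof (intro sum.cong refl)
    fix h m assume h: "h \<in> G" and m: "m \<in> {..<n}"
    have "(\<Sum>l<n. a (mul h g) l m * a' g l i) = (\<Sum>l<n. \<Sum>k<n. a g l k * a h k m * a' g l i)"
      using h m g by (intro sum.cong refl) (simp add: a_mul sum_distrib_right)
    also have "\<dots> = (\<Sum>k<n. \<Sum>l<n. a g l k * a h k m * a' g l i)" by (rule sum.swap)
    also have "\<dots> = (\<Sum>k<n. (\<Sum>l<n. a g l k * a' g l i) * a h k m)"
      by (simp only: sum_distrib_right) (simp add: mult_ac)
    also have "\<dots> = (\<Sum>k<n. if k = i then a h k m else 0)"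
      by (intro sum.cong refl) (use a_dual' g ji in auto)
    finally show "cnj (a (mul h g) j m) * a h i m = cnj (a (mul h g) j m) * (\<Sum>l<n. a (mul h g) l m * a' g l i)"
      using ji by simp
  qed
  also have "\<dots> = (\<Sum>h\<in>G. \<Sum>m<n. cnj (a h j m) * (\<Sum>l<n. a h l m * a' g l i))"
    by (rule sum.reindex_bij_betw[OF mul_right[OF g]])
  also have "\<dots> = (\<Sum>h\<in>G. \<Sum>m<n. \<Sum>l<n. cnj (a h j m) * a h l m * a' g l i)"
    by (simp add: sum_distrib_left mult.assoc)
  also have "\<dots> = (\<Sum>h\<in>G. \<Sum>l<n. \<Sum>m<n. cnj (a h j m) * a h l m * a' g l i)"
    by (rule sum_swap23)
  also have "\<dots> = (\<Sum>l<n. \<Sum>h\<in>G. \<Sum>m<n. cnj (a h j m) * a h l m * a' g l i)"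
    by (rule sum.swap)
  also have "\<dots> = (\<Sum>l<n. HV j l * a' g l i)"
    by (simp add: HV_def sum.cartesian_product[symmetric] sum_distrib_right)
  finally show ?thesis .
qed

lemma HM_equivariant:
  assumes g: "g \<in> G" and mk: "m < r" "k < r"
  shows "(\<Sum>j<r. \<Sum>l<r. b' g k j * HM l j * cnj (b' g m l)) = HM m k"
proof -
  have "(\<Sum>j<r. \<Sum>l<r. b' g k j * HM l j * cnj (b' g m l)) =
    (\<Sum>j<r. \<Sum>l<r. \<Sum>h\<in>G. \<Sum>t<r. cnj (b' g m l * b' h l t) * (b' g k j * b' h j t))"
    by (simp add: HM_def sum.cartesian_product[symmetric] sum_distrib_left sum_distrib_right mult_ac)
  also have "\<dots> = (\<Sum>j<r. \<Sum>h\<in>G. \<Sum>l<r. \<Sum>t<r. cnj (b' g m l * b' h l t) * (b' g k j * b' h j t))"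
    by (rule sum_swap23)
  also have "\<dots> = (\<Sum>h\<in>G. \<Sum>j<r. \<Sum>l<r. \<Sum>t<r. cnj (b' g m l * b' h l t) * (b' g k j * b' h j t))"
    by (rule sum.swap)
  also have "\<dots> = (\<Sum>h\<in>G. \<Sum>t<r. cnj (b' (mul g h) m t) * b' (mul g h) k t)"
  proof (rule sum.cong[OF refl])
    fix h assume h: "h \<in> G"
    let ?x = "\<lambda>l t. cnj (b' g m l * b' h l t)" and ?y = "\<lambda>j t. b' g k j * b' h j t"
    have "(\<Sum>j<r. \<Sum>l<r. \<Sum>t<r. ?x l t * ?y j t) = (\<Sum>t<r. \<Sum>j<r. \<Sum>l<r. ?x l t * ?y j t)"
      by (rule sum_rotate[symmetric])
    also have "\<dots> = (\<Sum>t<r. \<Sum>l<r. \<Sum>j<r. ?x l t * ?y j t)" by (rule sum_swap23)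
    also have "\<dots> = (\<Sum>t<r. (\<Sum>l<r. ?x l t) * (\<Sum>j<r. ?y j t))" by (simp only: sum_product)
    also have "\<dots> = (\<Sum>t<r. cnj (b' (mul g h) m t) * b' (mul g h) k t)"
      by (rule sum.cong[OF refl]) (simp add: b'_mul g h mk)
    finally show "(\<Sum>j<r. \<Sum>l<r. \<Sum>t<r. ?x l t * ?y j t) = (\<Sum>t<r. cnj (b' (mul g h) m t) * b' (mul g h) k t)" .
  qed
  also have "\<dots> = (\<Sum>h\<in>G. \<Sum>t<r. cnj (b' h m t) * b' h k t)"
    by (rule sum.reindex_bij_betw[OF mul_left[OF g]])
  also have "\<dots> = HM m k" by (simp add: HM_def sum.cartesian_product[symmetric])
  finally show ?thesis .
qed

lemma theta_equivariant:
  assumes g: "g \<in> G" and p: "in_vars n p"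
  shows "theta (lsub n (a g) p) = lsub n (a' g) (theta p)"
proof -
  have cp: "in_vars n (cj p)" using p by (rule conj.in_vars_Phi)
  show ?thesis unfolding theta_def using p
    by (simp add: conj.KP_lsub(2) lsub_compose[OF cp])
      (rule lsub_cong[OF cp], rule HV_equivariant[OF g])
qed

text \<open>\<open>HM\<close> identifies M conjugate-linearly with its dual, as \<open>HV\<close>
  does for V, so applying both turns an invariant vector of one module into one of the
  other.\<close>

lemma theta_X:
  assumes w: "w \<in> X"
  shows "(\<lambda>j. if j < r then \<Sum>l<r. theta (w l) * Const (HM l j) else 0) \<in> X'"
  unfolding equivariant_vecs_def
proof (intro CollectI conjI ballI allI impI)
  fix j show "in_vars n (if j < r then \<Sum>l<r. theta (w l) * Const (HM l j) else 0)"
    by (auto simp: theta_def intro!: in_vars_sum in_vars_mult)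
next
  fix j assume "r \<le> j" then show "(if j < r then \<Sum>l<r. theta (w l) * Const (HM l j) else 0) = 0" by simp
next
  fix g k assume g: "g \<in> G" and k: "k < r"
  have th: "lsub n (a' g) (theta (w l)) = (\<Sum>m<r. Const (cnj (b' g m l)) * theta (w m))" if "l < r" for l
    using theta_equivariant[OF g X_D(1)[OF w], of l, symmetric]
    by (simp add: X_D'[OF w g that] theta_sum theta_mult theta_Const)
  have "(\<Sum>j<r. Const (b' g k j) * lsub n (a' g) (if j < r then \<Sum>l<r. theta (w l) * Const (HM l j) else 0)) =
    (\<Sum>j<r. \<Sum>l<r. \<Sum>m<r. Const (b' g k j * HM l j * cnj (b' g m l)) * theta (w m))"
    by (simp add: lsub_sum lsub_mult th sum_distrib_left sum_distrib_right Const_mult mult_ac)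
  also have "\<dots> = (\<Sum>j<r. \<Sum>m<r. \<Sum>l<r. Const (b' g k j * HM l j * cnj (b' g m l)) * theta (w m))"
    by (rule sum_swap23)
  also have "\<dots> = (\<Sum>m<r. \<Sum>j<r. \<Sum>l<r. Const (b' g k j * HM l j * cnj (b' g m l)) * theta (w m))"
    by (rule sum.swap)
  also have "\<dots> = (\<Sum>m<r. Const (\<Sum>j<r. \<Sum>l<r. b' g k j * HM l j * cnj (b' g m l)) * theta (w m))"
    by (simp add: Const_sum sum_distrib_right)
  also have "\<dots> = (\<Sum>m<r. theta (w m) * Const (HM m k))"
    by (intro sum.cong refl) (simp only: lessThan_iff HM_equivariant[OF g _ k], simp add: mult.commute)
  finally show "(\<Sum>j<r. Const (b' g k j) * lsub n (a' g) (if j < r then \<Sum>l<r. theta (w l) * Const (HM l j) else 0)) =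
     (if k < r then \<Sum>l<r. theta (w l) * Const (HM l k) else 0)" using k by simp
qed

text \<open>The images of the \<open>\<omega> i\<close> lie in \<open>X'\<close> and keep their
  degrees, and inverting \<open>HM\<close> makes the conjugated Jacobian a constant times theirs.
  Assumption \<open>0\<close> ranges over all tuples of these degrees because the particular one
  exists only over the complex numbers.\<close>

lemma diff_op_theta_jacobian:
  assumes \<omega>: "\<And>i. i < r \<Longrightarrow> \<omega> i \<in> X" "\<And>i j. i < r \<Longrightarrow> j < r \<Longrightarrow> homog_deg (e i) (\<omega> i j)"
    and 0: "\<And>\<tau>. (\<And>i. i < r \<Longrightarrow> \<tau> i \<in> X') \<Longrightarrow> (\<And>i j. i < r \<Longrightarrow> j < r \<Longrightarrow> homog_deg (e i) (\<tau> i j)) \<Longrightarrow>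
      diff_op (jacobian r \<tau>) u = 0"
  shows "diff_op (theta (jacobian r \<omega>)) u = 0"
proof -
  define \<tau> where "\<tau> i j = (if j < r then \<Sum>l<r. theta (\<omega> i l) * Const (HM l j) else 0)" for i j
  have \<tau>: "\<tau> i \<in> X'" if "i < r" for i using theta_X[OF \<omega>(1)[OF that]] unfolding \<tau>_def .
  have "homog_deg (e i) (\<tau> i j)" if "i < r" "j < r" for i j
    using \<omega>(2) that by (auto simp: \<tau>_def mult.commute[of _ "Const _"]
      intro!: homog_deg_sum homog_deg_Const_mult homog_deg_theta)
  then have \<tau>0: "diff_op (jacobian r \<tau>) u = 0" using 0 \<tau> by blast
  obtain Q where Q: "\<And>j k. j < r \<Longrightarrow> k < r \<Longrightarrow> (\<Sum>i<r. HM j i * Q i k) = (if j = k then 1 else 0)"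
    using HM_inverse by blast
  have "jacobian r (\<lambda>i k. \<Sum>j<r. \<tau> i j * Const (Q j k)) = jacobian r (\<lambda>i j. theta (\<omega> i j))"
  proof (rule jacobian_cong)
    fix i k assume ik: "i < r" "k < r"
    have "(\<Sum>j<r. \<tau> i j * Const (Q j k)) = (\<Sum>j<r. \<Sum>l<r. theta (\<omega> i l) * Const (HM l j * Q j k))"
      by (simp add: \<tau>_def sum_distrib_right Const_mult mult.assoc)
    also have "\<dots> = (\<Sum>l<r. theta (\<omega> i l) * Const (\<Sum>j<r. HM l j * Q j k))"
      unfolding Const_sum sum_distrib_left by (rule sum.swap)
    also have "\<dots> = (\<Sum>l<r. if l = k then theta (\<omega> i l) else 0)"
      by (intro sum.cong refl) (use Q ik in auto)
    finally show "(\<Sum>j<r. \<tau> i j * Const (Q j k)) = theta (\<omega> i k)" using ik by simp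
  qed
  then have "theta (jacobian r \<omega>) = jacobian r (\<lambda>j k. Const (Q j k)) * jacobian r \<tau>"
    by (simp add: jacobian_row_mult theta_jacobian mult.commute)
  then show ?thesis using \<tau>0 by (simp add: diff_op_mult)
qed

end

subsection \<open>Positivity over an arbitrary field of characteristic zero\<close>

lemma (in subfield_hom) KP_I: "lk p ` keys p \<subseteq> K \<Longrightarrow> KP p"
  unfolding KP_def by (metis image_subset_iff in_keys_iff zero_K)

context dual_rep
begin

interpretation dual: dual_rep n r G mul a' a b' b
  by (rule dual_rep_swap) (rule dual_rep_axioms)

text \<open>All data generate a finitely generated subfield, which embeds into the complex numbers, where
  the invariant Hermitian form is definite. The conjugate of an equivariant vector is only defined
  there, but it is a complex combination of averaged monomials, which are defined over \<open>F\<close>.\<close>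

theorem jacobian_positivity:
  fixes J :: "'j set" and s :: "'j \<Rightarrow> 'a pm" and \<omega> :: "'j \<Rightarrow> nat \<Rightarrow> nat \<Rightarrow> 'a pm"
  assumes u: "in_vars n u" and J: "finite J"
    and u_eq: "u = (\<Sum>t\<in>J. jacobian r (\<omega> t) * s t)"
    and \<omega>: "\<And>t i. t \<in> J \<Longrightarrow> i < r \<Longrightarrow> \<omega> t i \<in> X"
    and hd: "\<And>t i j. t \<in> J \<Longrightarrow> i < r \<Longrightarrow> j < r \<Longrightarrow> homog_deg (e t i) (\<omega> t i j)"
    and 0: "\<And>t \<tau>. t \<in> J \<Longrightarrow> (\<And>i. i < r \<Longrightarrow> \<tau> i \<in> X') \<Longrightarrow>
      (\<And>i j. i < r \<Longrightarrow> j < r \<Longrightarrow> homog_deg (e t i) (\<tau> i j)) \<Longrightarrow> diff_op (jacobian r \<tau>) u = 0"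
  shows "u = 0"
proof -
  define E where "E A N = (\<lambda>(g, i, k). A g i k) ` (G \<times> {..<N} \<times> {..<N})"
    for A :: "'g \<Rightarrow> nat \<Rightarrow> nat \<Rightarrow> 'a" and N :: nat
  define U where "U = lk u ` keys u \<union> (\<Union>t\<in>J. lk (s t) ` keys (s t))
    \<union> (\<Union>t\<in>J. \<Union>i<r. \<Union>j<r. lk (\<omega> t i j) ` keys (\<omega> t i j))"
  have E: "A g i k \<in> E A N" if "g \<in> G" "i < N" "k < N" for A g i k N
    unfolding E_def by (rule image_eqI[of _ _ "(g, i, k)"]) (use that in auto)
  have "finite (E A N)" for A N unfolding E_def
    by (intro finite_imageI finite_cartesian_product finite_G finite_lessThan)
  moreover have "finite U" unfolding U_def
    by (intro finite_UnI finite_UN_I finite_imageI finite_keys finite_lessThan J)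
  ultimately have "finite (E a n \<union> E a' n \<union> E b r \<union> E b' r \<union> U)" by (intro finite_UnI)
  from exists_subfield_hom[OF this] obtain K \<phi> where K: "subfield_hom K \<phi>"
      "E a n \<union> E a' n \<union> E b r \<union> E b' r \<union> U \<subseteq> K" by (elim exE conjE)
  interpret subfield_hom K \<phi> by (rule K(1))
  have Ka: "a g i k \<in> K" "a' g i k \<in> K" if "g \<in> G" "i < n" "k < n" for g i k
    using E[OF that, of a] E[OF that, of a'] K(2) by auto
  have Kb: "b g i k \<in> K" "b' g i k \<in> K" if "g \<in> G" "i < r" "k < r" for g i k
    using E[OF that, of b] E[OF that, of b'] K(2) by auto
  have KU: "U \<subseteq> K" using K(2) by auto
  have KPu: "KP u" using KU unfolding U_def by (intro KP_I) auto
  have KPs: "KP (s t)" if "t \<in> J" for t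
  proof (rule KP_I)
    have "lk (s t) ` keys (s t) \<subseteq> U" unfolding U_def using that by force
    then show "lk (s t) ` keys (s t) \<subseteq> K" using KU by auto
  qed
  have KPw: "KP (\<omega> t i j)" if "t \<in> J" "i < r" "j < r" for t i j
  proof (rule KP_I)
    have "lk (\<omega> t i j) ` keys (\<omega> t i j) \<subseteq> U" unfolding U_def using that by force
    then show "lk (\<omega> t i j) ` keys (\<omega> t i j) \<subseteq> K" using KU by auto
  qed
  interpret C: complex_dual_rep n r G mul "\<lambda>g i k. \<phi> (a g i k)" "\<lambda>g i k. \<phi> (a' g i k)"
      "\<lambda>g i k. \<phi> (b g i k)" "\<lambda>g i k. \<phi> (b' g i k)"
    unfolding complex_dual_rep_def by (rule dual_rep_image[OF dual_rep_axioms]) (use Ka Kb in auto)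
  interpret C': dual_rep n r G mul "\<lambda>g i k. \<phi> (a' g i k)" "\<lambda>g i k. \<phi> (a g i k)"
      "\<lambda>g i k. \<phi> (b' g i k)" "\<lambda>g i k. \<phi> (b g i k)"
    by (rule dual_rep_swap) (rule C.dual_rep_axioms)
  have act: "KP (Const (b g j k) * lsub n (a g) p)"
      "Phi (Const (b g j k) * lsub n (a g) p) = Const (\<phi> (b g j k)) * lsub n (\<lambda>i k. \<phi> (a g i k)) (Phi p)"
    if "g \<in> G" "j < r" "k < r" "KP p" "in_vars n p" for g j k p
    using that Ka Kb by (auto simp: KP_mult KP_Const KP_lsub Phi_mult Phi_Const)
  have act': "KP (Const (b' g j k) * lsub n (a' g) p)"
      "Phi (Const (b' g j k) * lsub n (a' g) p) = Const (\<phi> (b' g j k)) * lsub n (\<lambda>i k. \<phi> (a' g i k)) (Phi p)"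
    if "g \<in> G" "j < r" "k < r" "KP p" "in_vars n p" for g j k p
    using that Ka Kb by (auto simp: KP_mult KP_Const KP_lsub Phi_mult Phi_Const)
  have wX: "(\<lambda>j. Phi (\<omega> t i j)) \<in> C.X" if t: "t \<in> J" and i: "i < r" for t i
  proof -
    note w = \<omega>[OF t i]
    have "(\<Sum>k<r. Const (\<phi> (b g j k)) * lsub n (\<lambda>i k. \<phi> (a g i k)) (Phi (\<omega> t i k))) = Phi (\<omega> t i j)"
      if "g \<in> G" "j < r" for g j
    proof -
      have "Phi (\<Sum>k<r. Const (b g j k) * lsub n (a g) (\<omega> t i k)) =
         (\<Sum>k<r. Const (\<phi> (b g j k)) * lsub n (\<lambda>i k. \<phi> (a g i k)) (Phi (\<omega> t i k)))"
        by (rule Phi_sum_eq) (use act that KPw[OF t i] X_D(1)[OF w] in auto)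
      then show ?thesis using X_D(2)[OF w that] by simp
    qed
    moreover have "\<omega> t i j = 0" if "r \<le> j" for j using w that by (auto simp: equivariant_vecs_def)
    ultimately show ?thesis
      using in_vars_Phi[OF X_D(1)[OF w]] unfolding equivariant_vecs_def by simp
  qed
  have avP: "KP (dual.av m j k) \<and> Phi (dual.av m j k) = C'.av m j k" if "j < r" "keys m \<subseteq> {..<n}" for m j k
  proof (cases "k < r")
    case True
    have m: "KP (sg m 1)" "in_vars n (sg m (1::'a))" using that by (auto intro: KP_single in_vars_single)
    have "KP (dual.av m j k)" using True that act'(1)[OF _ True that(1) m] by (auto simp: dual.av_def intro: KP_sum)
    moreover have "Phi (\<Sum>g\<in>G. Const (b' g k j) * lsub n (a' g) (sg m 1)) =
        (\<Sum>g\<in>G. Const (\<phi> (b' g k j)) * lsub n (\<lambda>i k. \<phi> (a' g i k)) (Phi (sg m 1)))"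
      by (rule Phi_sum_eq) (use act'[OF _ True that(1) m] in auto)
    ultimately show ?thesis using True by (simp add: dual.av_def C'.av_def Phi_single)
  qed (simp add: dual.av_def C'.av_def)
  have "diff_op (C.theta (Phi (jacobian r (\<omega> t)))) (Phi u) = 0" if t: "t \<in> J" for t
  proof (subst KP_jacobian(2), rule KPw[OF t], assumption+, rule C.diff_op_theta_jacobian[where e = "e t"])
    show "(\<lambda>j. Phi (\<omega> t i j)) \<in> C.X" if "i < r" for i using wX[OF t that] .
    show "homog_deg (e t i) (Phi (\<omega> t i j))" if "i < r" "j < r" for i j
      using hd[OF t that] by (rule homog_deg_Phi)
  next
    fix \<tau> assume \<tau>: "\<And>i. i < r \<Longrightarrow> \<tau> i \<in> C.X'" "\<And>i j. i < r \<Longrightarrow> j < r \<Longrightarrow> homog_deg (e t i) (\<tau> i j)"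
    \<comment> \<open>Each row is expanded over the monomials that occur in it, all of degree
      \<open>e t i\<close>. The Jacobian becomes a combination of Jacobians of averaged monomials,
      which come from \<open>F\<close> and to which the hypothesis over \<open>F\<close>
      applies.\<close>
    define Y where "Y i = (SIGMA j:{..<r}. keys (\<tau> i j))" for i
    define c where "c i = (\<lambda>(j, m). inverse (of_nat (card G)) * lk (\<tau> i j) m)" for i
    have Yfin: "finite (Y i)" for i by (auto simp: Y_def)
    have "\<tau> i k = (\<Sum>y\<in>Y i. Const (c i y) * C'.av (snd y) (fst y) k)" if "i < r" "k < r" for i k
      using C'.X_av[OF \<tau>(1)[OF that(1)] that(2)] by (simp add: Y_def c_def case_prod_unfold)
    then have "jacobian r \<tau> = jacobian r (\<lambda>i k. \<Sum>y\<in>Y i. Const (c i y) * C'.av (snd y) (fst y) k)"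
      by (rule jacobian_cong)
    also have "\<dots> = (\<Sum>f\<in>PiE {0..<r} Y. (\<Prod>i=0..<r. Const (c i (f i))) * jacobian r (\<lambda>i k. C'.av (snd (f i)) (fst (f i)) k))"
      by (rule jacobian_multilinear[OF Yfin])
    finally have jac: "jacobian r \<tau> = \<dots>" .
    have "diff_op (jacobian r (\<lambda>i k. C'.av (snd (f i)) (fst (f i)) k)) (Phi u) = 0" if f: "f \<in> PiE {0..<r} Y" for f
    proof -
      have fi: "fst (f i) < r \<and> keys (snd (f i)) \<subseteq> {..<n} \<and> mdeg (snd (f i)) = e t i" if "i < r" for i
      proof -
        have "f i \<in> Y i" using f that by auto
        then have y: "fst (f i) < r" "snd (f i) \<in> keys (\<tau> i (fst (f i)))" by (auto simp: Y_def)
        moreover have "in_vars n (\<tau> i (fst (f i)))" using C'.X_D(1)[OF \<tau>(1)[OF that]] .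
        ultimately show ?thesis using \<tau>(2)[OF that y(1)] unfolding in_vars_def homog_deg_def by blast
      qed
      have "jacobian r (\<lambda>i k. C'.av (snd (f i)) (fst (f i)) k) = Phi (jacobian r (\<lambda>i k. dual.av (snd (f i)) (fst (f i)) k))"
        using avP fi by (subst KP_jacobian(2)) (auto intro!: jacobian_cong)
      moreover have "KP (jacobian r (\<lambda>i k. dual.av (snd (f i)) (fst (f i)) k))"
        using avP fi by (intro KP_jacobian(1)) auto
      moreover have "diff_op (jacobian r (\<lambda>i k. dual.av (snd (f i)) (fst (f i)) k)) u = 0"
      proof (rule 0[OF t])
        show "dual.av (snd (f i)) (fst (f i)) \<in> X'" if "i < r" for i using fi[OF that] by (intro dual.av_X) auto
        show "homog_deg (e t i) (dual.av (snd (f i)) (fst (f i)) j)" if "i < r" "j < r" for i j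
          using fi[OF that(1)] dual.homog_deg_av by metis
      qed
      ultimately show ?thesis using KPu by (simp add: Phi_diff_op[symmetric])
    qed
    then show "diff_op (jacobian r \<tau>) (Phi u) = 0"
      unfolding jac by (simp add: diff_op_sum_left diff_op_mult Const_prod[symmetric])
  qed
  then have "br (C.theta (Phi u)) (Phi u) = 0"
  proof -
    assume *: "\<And>t. t \<in> J \<Longrightarrow> diff_op (C.theta (Phi (jacobian r (\<omega> t)))) (Phi u) = 0"
    \<comment> \<open>\<open>theta\<close> is multiplicative, so the image of \<open>u\<close> is a
      combination of the conjugated Jacobians, each of which annihilates \<open>u\<close>; the
      pairing of \<open>u\<close> with its own image is therefore zero.\<close>
    have "Phi u = (\<Sum>t\<in>J. Phi (s t) * Phi (jacobian r (\<omega> t)))"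
      unfolding u_eq using KPs KP_jacobian(1) KPw by (intro Phi_sum_eq) (auto simp: Phi_mult KP_mult mult.commute)
    then have "C.theta (Phi u) = (\<Sum>t\<in>J. C.theta (Phi (s t)) * C.theta (Phi (jacobian r (\<omega> t))))"
      by (simp only: C.theta_sum C.theta_mult)
    then show ?thesis using * by (simp add: br_sum_left br_mult)
  qed
  then have "Phi u = 0" by (intro C.theta_definite in_vars_Phi u)
  then show ?thesis using KPu by (simp add: Phi_eq_0_iff)
qed

end

subsection \<open>Linear systems and bases\<close>

text \<open>Gaussian elimination: one equation is solved for an unknown \<open>t0\<close> and
  removed together with it.\<close>

lemma exists_nontrivial_solution:
  fixes A :: "'s \<Rightarrow> 't \<Rightarrow> 'a::field"
  assumes "finite S" "finite T" "card S < card T"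
  shows "\<exists>c. (\<exists>t\<in>T. c t \<noteq> 0) \<and> (\<forall>s\<in>S. (\<Sum>t\<in>T. c t * A s t) = 0)"
  using assms
proof (induction S arbitrary: T A rule: finite_induct)
  case empty
  then obtain t where "t \<in> T" by (metis card.empty ex_in_conv less_irrefl)
  then show ?case by (intro exI[of _ "\<lambda>_. 1"]) auto
next
  case (insert s S)
  show ?case
  proof (cases "\<forall>t\<in>T. A s t = 0")
    case True
    have "card S < card T" using insert by simp
    from insert.IH[OF insert.prems(1) this, of A] True show ?thesis by auto
  next
    case False
    then obtain t0 where t0: "t0 \<in> T" "A s t0 \<noteq> 0" by blast
    define T' where "T' = T - {t0}"
    have T: "T = insert t0 T'" "t0 \<notin> T'" "finite T'" using t0 insert.prems by (auto simp: T'_def)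
    have "card S < card T'" using insert T by simp
    from insert.IH[OF T(3) this, of "\<lambda>s' t. A s' t - A s' t0 * (A s t / A s t0)"]
    obtain c where c: "\<exists>t\<in>T'. c t \<noteq> 0" "\<And>s'. s' \<in> S \<Longrightarrow> (\<Sum>t\<in>T'. c t * (A s' t - A s' t0 * (A s t / A s t0))) = 0"
      by blast
    define d where "d = (\<Sum>t\<in>T'. c t * A s t)"
    define c' where "c' = c(t0 := - d / A s t0)"
    have sum: "(\<Sum>t\<in>T. c' t * A s' t) = - d / A s t0 * A s' t0 + (\<Sum>t\<in>T'. c t * A s' t)" for s'
    proof -
      have "(\<Sum>t\<in>T'. c' t * A s' t) = (\<Sum>t\<in>T'. c t * A s' t)"
        using T(2) by (intro sum.cong) (auto simp: c'_def)
      then show ?thesis unfolding T(1) using T(2,3) by (simp add: c'_def)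
    qed
    have "(\<Sum>t\<in>T. c' t * A s' t) = 0" if "s' \<in> insert s S" for s'
    proof (cases "s' = s")
      case True
      then show ?thesis using sum[of s] t0 by (simp add: d_def)
    next
      case False
      then have "(\<Sum>t\<in>T'. c t * A s' t) = (\<Sum>t\<in>T'. c t * (A s' t0 * (A s t / A s t0)))"
        using c(2)[of s'] that by (simp add: right_diff_distrib sum_subtractf)
      also have "\<dots> = A s' t0 / A s t0 * d" unfolding d_def sum_distrib_left
        by (intro sum.cong) auto
      finally show ?thesis using sum[of s'] by simp
    qed
    moreover have "\<exists>t\<in>T. c' t \<noteq> 0" using c(1) T by (auto simp: c'_def)
    ultimately show ?thesis by blast
  qed
qed

text \<open>With \<open>y\<close> added as a column, indexed by \<open>None\<close>, there are more
  unknowns than equations. A nontrivial solution must involve the new column, since the kernel is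
  trivial, and can be divided by that coefficient.\<close>

lemma square_system_solvable:
  fixes A :: "'s \<Rightarrow> 't \<Rightarrow> 'a::field"
  assumes "finite S" "finite T" "card S \<le> card T"
    and ker: "\<And>c. (\<And>s. s \<in> S \<Longrightarrow> (\<Sum>t\<in>T. c t * A s t) = 0) \<Longrightarrow> \<forall>t\<in>T. c t = 0"
  shows "\<exists>c. \<forall>s\<in>S. (\<Sum>t\<in>T. c t * A s t) = y s"
proof -
  define T' where "T' = insert None (Some ` T)"
  define A' where "A' s t = (case t of None \<Rightarrow> y s | Some t \<Rightarrow> A s t)" for s t
  have card: "card S < card T'" using assms by (simp add: T'_def card_image)
  obtain c where c: "\<exists>t\<in>T'. c t \<noteq> 0" "\<And>s. s \<in> S \<Longrightarrow> (\<Sum>t\<in>T'. c t * A' s t) = 0"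
    using exists_nontrivial_solution[OF assms(1) _ card, of A'] assms(2) by (auto simp: T'_def)
  have sum: "(\<Sum>t\<in>T'. c t * A' s t) = c None * y s + (\<Sum>t\<in>T. c (Some t) * A s t)" for s
    using assms(2) by (simp add: T'_def A'_def sum.reindex)
  have c0: "c None \<noteq> 0"
  proof
    assume "c None = 0"
    then have "\<forall>t\<in>T. c (Some t) = 0" using c(2) sum by (intro ker) auto
    then show False using c(1) \<open>c None = 0\<close> by (auto simp: T'_def)
  qed
  have "(\<Sum>t\<in>T. (- c (Some t) / c None) * A s t) = y s" if "s \<in> S" for s
  proof -
    have "c None * y s = - (\<Sum>t\<in>T. c (Some t) * A s t)" using c(2)[OF that] sum[of s] by (simp add: eq_neg_iff_add_eq_0)
    then have "y s = - (\<Sum>t\<in>T. c (Some t) * A s t) / c None" using c0 by (simp add: field_simps)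
    then show ?thesis by (simp add: sum_divide_distrib sum_negf)
  qed
  then show ?thesis by (intro exI[of _ "\<lambda>t. - c (Some t) / c None"]) blast
qed

definition pm_basis :: "('i \<Rightarrow> 'a::field pm) set \<Rightarrow> 't set \<Rightarrow> ('t \<Rightarrow> 'i \<Rightarrow> 'a pm) \<Rightarrow> bool" where
  "pm_basis W T b \<longleftrightarrow> finite T \<and> (\<forall>t\<in>T. b t \<in> W) \<and>
     (\<forall>c. (\<forall>j. (\<Sum>t\<in>T. Const (c t) * b t j) = 0) \<longrightarrow> (\<forall>t\<in>T. c t = 0)) \<and>
     (\<forall>w\<in>W. \<exists>c. \<forall>j. w j = (\<Sum>t\<in>T. Const (c t) * b t j))"

text \<open>A longest independent tuple. Its length is bounded by the number of positions in
  \<open>S\<close> where coefficients can occur.\<close>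

lemma exists_pm_basis:
  fixes W :: "('i \<Rightarrow> 'a::field pm) set"
  assumes S: "finite S" "\<And>w j m. w \<in> W \<Longrightarrow> lk (w j) m \<noteq> 0 \<Longrightarrow> (j, m) \<in> S"
  shows "\<exists>k b. pm_basis W {..<k::nat} b"
proof -
  define ind where "ind k b \<longleftrightarrow> (\<forall>t<k. b t \<in> W) \<and>
     (\<forall>c. (\<forall>j. (\<Sum>t<k. Const (c t) * b t j) = 0) \<longrightarrow> (\<forall>t<k. c t = 0))" for k :: nat and b :: "nat \<Rightarrow> 'i \<Rightarrow> 'a pm"
  have bound: "k \<le> card S" if "ind k b" for k b
  proof (rule ccontr)
    assume "\<not> k \<le> card S"
    then obtain c where c: "\<exists>t<k. c t \<noteq> 0" "\<forall>(j, m)\<in>S. (\<Sum>t<k. c t * lk (b t j) m) = 0"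
      using exists_nontrivial_solution[OF S(1), of "{..<k}" "\<lambda>(j, m) t. lk (b t j) m"] by (force simp: case_prod_unfold)
    have "(\<Sum>t<k. Const (c t) * b t j) = 0" for j
    proof (rule poly_mapping_eqI)
      fix m
      show "lk (\<Sum>t<k. Const (c t) * b t j) m = lk 0 m"
      proof (cases "(j, m) \<in> S")
        case True
        then show ?thesis using c(2) by (auto simp: lookup_sum)
      next
        case False
        then have "lk (b t j) m = 0" if "t < k" for t using S(2) that \<open>ind k b\<close> by (auto simp: ind_def)
        then show ?thesis by (simp add: lookup_sum)
      qed
    qed
    then show False using c(1) that by (auto simp: ind_def)
  qed
  have "ind 0 b" for b by (simp add: ind_def)
  then have "\<exists>k. (\<exists>b. ind k b) \<and> (\<forall>k'. (\<exists>b. ind k' b) \<longrightarrow> k' \<le> k)"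
    using bound ex_has_greatest_nat[of "\<lambda>k. \<exists>b. ind k b" 0 id "Suc (card S)"] by (auto simp: less_Suc_eq_le)
  then obtain k b where b: "ind k b" and max: "\<And>k' b'. ind k' b' \<Longrightarrow> k' \<le> k" by blast
  have "\<exists>c. \<forall>j. w j = (\<Sum>t<k. Const (c t) * b t j)" if w: "w \<in> W" for w
  proof -
    have "\<not> ind (Suc k) (b(k := w))" using max[of "Suc k"] by auto
    moreover have "\<forall>t<Suc k. (b(k := w)) t \<in> W" using b w by (auto simp: ind_def less_Suc_eq)
    ultimately obtain c where c: "\<And>j. (\<Sum>t<Suc k. Const (c t) * (b(k := w)) t j) = 0" "\<exists>t<Suc k. c t \<noteq> 0"
      unfolding ind_def by blast
    have s: "(\<Sum>t<k. Const (c t) * b t j) + Const (c k) * w j = 0" for j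
    proof -
      have "(\<Sum>t<k. Const (c t) * (b(k := w)) t j) = (\<Sum>t<k. Const (c t) * b t j)" by (intro sum.cong) auto
      then show ?thesis using c(1)[of j] by simp
    qed
    have ck: "c k \<noteq> 0"
    proof
      assume "c k = 0"
      then have "\<forall>t<k. c t = 0" using s b by (simp add: ind_def)
      then show False using c(2) \<open>c k = 0\<close> by (auto simp: less_Suc_eq)
    qed
    have "w j = (\<Sum>t<k. Const (- c t / c k) * b t j)" for j
    proof -
      have "w j = Const (1 / c k) * (Const (c k) * w j)" using ck by (simp add: mult.assoc[symmetric] Const_mult[symmetric])
      also have "Const (c k) * w j = - (\<Sum>t<k. Const (c t) * b t j)" using s[of j] by (simp add: eq_neg_iff_add_eq_0 add.commute)
      also have "Const (1 / c k) * \<dots> = (\<Sum>t<k. Const (- c t / c k) * b t j)"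
        by (simp add: sum_distrib_left sum_negf[symmetric] mult.assoc[symmetric] Const_mult[symmetric] Const_uminus)
      finally show ?thesis .
    qed
    then show ?thesis by (intro exI[of _ "\<lambda>t. - c t / c k"]) blast
  qed
  then have "pm_basis W {..<k} b" using b by (simp add: pm_basis_def ind_def)
  then show ?thesis by blast
qed

lemma finite_monomials: "finite {m :: nat \<Rightarrow>\<^sub>0 nat. keys m \<subseteq> {..<n} \<and> mdeg m \<le> d}"
proof (rule inj_on_finite)
  show "inj_on (\<lambda>m. restrict (lk m) {..<n}) {m. keys m \<subseteq> {..<n} \<and> mdeg m \<le> d}"
  proof (rule inj_onI, rule poly_mapping_eqI)
    fix m m' :: "nat \<Rightarrow>\<^sub>0 nat" and i
    assume *: "m \<in> {m. keys m \<subseteq> {..<n} \<and> mdeg m \<le> d}" "m' \<in> {m. keys m \<subseteq> {..<n} \<and> mdeg m \<le> d}"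
      "restrict (lk m) {..<n} = restrict (lk m') {..<n}"
    show "lk m i = lk m' i"
    proof (cases "i < n")
      case True
      then show ?thesis using fun_cong[OF *(3), of i] by simp
    next
      case False
      then have "i \<notin> keys m" "i \<notin> keys m'" using * by auto
      then show ?thesis by (simp add: in_keys_iff)
    qed
  qed
  show "(\<lambda>m. restrict (lk m) {..<n}) ` {m. keys m \<subseteq> {..<n} \<and> mdeg m \<le> d} \<subseteq> PiE {..<n} (\<lambda>_. {..d})"
  proof (clarsimp)
    fix m :: "nat \<Rightarrow>\<^sub>0 nat" and i assume m: "keys m \<subseteq> {..<n}" "mdeg m \<le> d" "i < n"
    have "lk m i \<le> sum (lk m) {..<n}" using m(3) by (intro member_le_sum) auto
    then show "lk m i \<le> d" using m mdeg_superset[of "{..<n}" m] by simp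
  qed
qed (simp add: finite_PiE)

subsection \<open>Graded pieces of modules of equivariant vectors\<close>

definition graded_vecs :: "nat \<Rightarrow> nat \<Rightarrow> 'g set \<Rightarrow> ('g \<Rightarrow> nat \<Rightarrow> nat \<Rightarrow> 'a::comm_ring_1) \<Rightarrow> ('g \<Rightarrow> nat \<Rightarrow> nat \<Rightarrow> 'a) \<Rightarrow>
    nat \<Rightarrow> (nat \<Rightarrow> 'a pm) set" where
  "graded_vecs n r G a b d = {w \<in> equivariant_vecs n r G a b. \<forall>j. homog_deg d (w j)}"

lemma exists_graded_basis: "\<exists>k v. pm_basis (graded_vecs n r G a b d) {..<k::nat} v"
  for a :: "'g \<Rightarrow> nat \<Rightarrow> nat \<Rightarrow> 'a::field"
proof (rule exists_pm_basis)
  show "finite ({..<r} \<times> {m :: nat \<Rightarrow>\<^sub>0 nat. keys m \<subseteq> {..<n} \<and> mdeg m \<le> d})"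
    using finite_monomials by blast
  fix w :: "nat \<Rightarrow> 'a pm" and j m assume w: "w \<in> graded_vecs n r G a b d" and m: "lk (w j) m \<noteq> 0"
  then have "j < r" unfolding graded_vecs_def equivariant_vecs_def by (cases "j < r") auto
  moreover have "m \<in> keys (w j)" using m by (simp add: in_keys_iff)
  moreover have "in_vars n (w j)" "homog_deg d (w j)" using w by (auto simp: graded_vecs_def equivariant_vecs_def)
  ultimately show "(j, m) \<in> {..<r} \<times> {m. keys m \<subseteq> {..<n} \<and> mdeg m \<le> d}"
    by (auto simp: in_vars_def homog_deg_def)
qed

lemma equivariant_vecs_sum:
  assumes "\<And>t. t \<in> T \<Longrightarrow> v t \<in> equivariant_vecs n r G a b"
  shows "(\<lambda>j. \<Sum>t\<in>T. Const (c t) * v t j) \<in> equivariant_vecs n r G a b"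
  unfolding equivariant_vecs_def
proof (intro CollectI conjI ballI allI impI)
  fix j show "in_vars n (\<Sum>t\<in>T. Const (c t) * v t j)"
    using assms by (auto simp: equivariant_vecs_def intro!: in_vars_sum in_vars_mult)
next
  fix j assume "r \<le> j" then show "(\<Sum>t\<in>T. Const (c t) * v t j) = 0"
    using assms by (intro sum.neutral) (auto simp: equivariant_vecs_def)
next
  fix g j assume gj: "g \<in> G" "j < r"
  have "(\<Sum>k<r. Const (b g j k) * lsub n (a g) (\<Sum>t\<in>T. Const (c t) * v t k)) =
    (\<Sum>k<r. \<Sum>t\<in>T. Const (c t) * (Const (b g j k) * lsub n (a g) (v t k)))"
    by (simp add: lsub_sum lsub_mult sum_distrib_left mult.left_commute)
  also have "\<dots> = (\<Sum>t\<in>T. Const (c t) * (\<Sum>k<r. Const (b g j k) * lsub n (a g) (v t k)))"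
    unfolding sum_distrib_left by (rule sum.swap)
  also have "\<dots> = (\<Sum>t\<in>T. Const (c t) * v t j)"
    using assms gj by (intro sum.cong refl) (auto simp: equivariant_vecs_def)
  finally show "(\<Sum>k<r. Const (b g j k) * lsub n (a g) (\<Sum>t\<in>T. Const (c t) * v t k)) = (\<Sum>t\<in>T. Const (c t) * v t j)" .
qed

lemma graded_vecs_sum:
  assumes "\<And>t. t \<in> T \<Longrightarrow> v t \<in> graded_vecs n r G a b d"
  shows "(\<lambda>j. \<Sum>t\<in>T. Const (c t) * v t j) \<in> graded_vecs n r G a b d"
  unfolding graded_vecs_def
  using assms equivariant_vecs_sum[of T v n r G a b c]
  by (auto simp: graded_vecs_def intro!: homog_deg_sum homog_deg_Const_mult)

text \<open>Otherwise some nonzero \<open>w\<close> in the first graded piece would be orthogonal to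
  the second. That piece contains the dual averages of degree \<open>d\<close>, which read off the
  coefficients of \<open>w\<close> by \<open>br_av\<close>.\<close>

lemma (in dual_rep) graded_basis_card_le:
  assumes v: "pm_basis (graded_vecs n r G a b d) T v" and v': "pm_basis (graded_vecs n r G a' b' d) T' v'"
  shows "card T \<le> card T'"
proof (rule ccontr)
  interpret dual: dual_rep n r G mul a' a b' b
    by (rule dual_rep_swap) (rule dual_rep_axioms)
  assume "\<not> card T \<le> card T'"
  then obtain c where c: "\<exists>t\<in>T. c t \<noteq> 0" "\<And>s. s \<in> T' \<Longrightarrow> (\<Sum>t\<in>T. c t * (\<Sum>j<r. br (v' s j) (v t j))) = 0"
    using exists_nontrivial_solution[of T' T "\<lambda>s t. \<Sum>j<r. br (v' s j) (v t j)"] v v' by (auto simp: pm_basis_def not_le)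
  define w where "w j = (\<Sum>t\<in>T. Const (c t) * v t j)" for j
  have w: "w \<in> graded_vecs n r G a b d"
    unfolding w_def[abs_def] using v by (intro graded_vecs_sum) (auto simp: pm_basis_def)
  have s: "(\<Sum>j<r. br (v' s j) (w j)) = 0" if "s \<in> T'" for s
  proof -
    have "(\<Sum>j<r. br (v' s j) (w j)) = (\<Sum>j<r. \<Sum>t\<in>T. c t * br (v' s j) (v t j))"
      by (simp add: w_def br_sum_right br_Const_right)
    also have "\<dots> = (\<Sum>t\<in>T. c t * (\<Sum>j<r. br (v' s j) (v t j)))"
      unfolding sum_distrib_left by (rule sum.swap)
    finally show ?thesis using c(2)[OF that] by simp
  qed
  have all: "(\<Sum>j<r. br (x j) (w j)) = 0" if x: "x \<in> graded_vecs n r G a' b' d" for x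
  proof -
    obtain e where e: "\<And>j. x j = (\<Sum>t\<in>T'. Const (e t) * v' t j)" using v' x unfolding pm_basis_def by blast
    have "(\<Sum>j<r. br (x j) (w j)) = (\<Sum>j<r. \<Sum>t\<in>T'. e t * br (v' t j) (w j))"
      by (simp add: e br_sum_left br_Const_left)
    also have "\<dots> = (\<Sum>t\<in>T'. e t * (\<Sum>j<r. br (v' t j) (w j)))"
      unfolding sum_distrib_left by (rule sum.swap)
    finally show ?thesis using s by simp
  qed
  have wX: "w \<in> X" and wh: "homog_deg d (w j)" for j using w by (auto simp: graded_vecs_def)
  have "w j = 0" for j
  proof (rule poly_mapping_eqI)
    fix m
    show "lk (w j) m = lk 0 m"
    proof (cases "j < r \<and> m \<in> keys (w j)")
      case True
      then have m: "keys m \<subseteq> {..<n}" "mdeg m = d" using X_D(1)[OF wX, of j] wh[of j] by (auto simp: in_vars_def homog_deg_def)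
      have "dual.av m j \<in> graded_vecs n r G a' b' d"
        using dual.av_X[OF m(1), of j] dual.homog_deg_av[of m j] True m(2) by (auto simp: graded_vecs_def)
      then have "of_nat (card G * mfact m) * lk (w j) m = 0" using all br_av[OF wX m(1), of j] True by simp
      then show ?thesis using finite_G nonempty_G mfact_pos[of m] by simp
    next
      case False
      then show ?thesis using wX by (auto simp: equivariant_vecs_def in_keys_iff)
    qed
  qed
  then show False using c(1) v unfolding pm_basis_def w_def by blast
qed

lemma (in dual_rep) graded_basis_card_eq:
  assumes "pm_basis (graded_vecs n r G a b d) T v" "pm_basis (graded_vecs n r G a' b' d) T' v'"
  shows "card T = card T'"
proof -
  interpret dual: dual_rep n r G mul a' a b' b
    by (rule dual_rep_swap) (rule dual_rep_axioms)
  show ?thesis using graded_basis_card_le[OF assms] dual.graded_basis_card_le[OF assms(2,1)] by simp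
qed

definition inv_ring :: "nat \<Rightarrow> 'g set \<Rightarrow> ('g \<Rightarrow> nat \<Rightarrow> nat \<Rightarrow> 'a::comm_ring_1) \<Rightarrow> 'a pm set" where
  "inv_ring n G a = {p. in_vars n p \<and> (\<forall>g\<in>G. lsub n (a g) p = p)}"

lemma inv_ring_hcomp: "p \<in> inv_ring n G a \<Longrightarrow> hcomp d p \<in> inv_ring n G a"
  by (auto simp: inv_ring_def in_vars_hcomp hcomp_lsub[symmetric])

lemma inv_ring_zero [simp]: "0 \<in> inv_ring n G a" by (simp add: inv_ring_def)

lemma inv_ring_sum: "(\<And>t. t \<in> T \<Longrightarrow> f t \<in> inv_ring n G a) \<Longrightarrow> (\<Sum>t\<in>T. Const (c t) * f t) \<in> inv_ring n G a"
  by (auto simp: inv_ring_def lsub_sum lsub_mult intro!: in_vars_sum in_vars_mult)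

text \<open>The invariant ring is the module for the trivial one-dimensional representation, so the
  results on equivariant vectors apply to it.\<close>

lemma equivariant_vecs_trivial:
  "(\<lambda>j. if j = 0 then p else 0) \<in> equivariant_vecs n 1 G a (\<lambda>_ _ _. 1) \<longleftrightarrow> p \<in> inv_ring n G a"
  by (auto simp: equivariant_vecs_def inv_ring_def)

lemma equivariant_vecs_trivial_D: "w \<in> equivariant_vecs n 1 G a (\<lambda>_ _ _. 1) \<Longrightarrow> w = (\<lambda>j. if j = 0 then w 0 else 0) \<and> w 0 \<in> inv_ring n G a"
  by (auto simp: equivariant_vecs_def inv_ring_def)

lemma inv_ring_mult_vec: "p \<in> inv_ring n G a \<Longrightarrow> w \<in> equivariant_vecs n r G a b \<Longrightarrow>
   (\<lambda>j. p * w j) \<in> equivariant_vecs n r G a b"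
  by (auto simp: equivariant_vecs_def inv_ring_def lsub_mult mult.left_commute[of _ p] sum_distrib_left[symmetric] intro!: in_vars_mult)

text \<open>In degree \<open>d\<close> the coefficient of generator \<open>i\<close> has degree
  \<open>d - e i\<close>; generators of degree above \<open>d\<close> are excluded explicitly, as
  the subtraction is truncated. Counting members gives the Hilbert function of the module from that
  of the ring.\<close>

lemma free_module_graded_basis:
  fixes a :: "'g \<Rightarrow> nat \<Rightarrow> nat \<Rightarrow> 'a::field"
  assumes \<omega>: "\<And>i. i < r \<Longrightarrow> \<omega> i \<in> equivariant_vecs n r G a b"
    and hd: "\<And>i j. i < r \<Longrightarrow> j < r \<Longrightarrow> homog_deg (e i) (\<omega> i j)"
    and free: "\<And>w. w \<in> equivariant_vecs n r G a b \<Longrightarrow> \<exists>!q. (\<forall>i<r. q i \<in> inv_ring n G a) \<and> (\<forall>i\<ge>r. q i = 0) \<and>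
                   (\<forall>j<r. w j = (\<Sum>i<r. q i * \<omega> i j))"
    and \<beta>: "\<And>d. pm_basis (graded_vecs n 1 G a (\<lambda>_ _ _. 1) d) {..<k d :: nat} (\<beta> d)"
  shows "pm_basis (graded_vecs n r G a b d) (SIGMA i:{i\<in>{..<r}. e i \<le> d}. {..<k (d - e i)})
     (\<lambda>(i, t) j. \<beta> (d - e i) t 0 * \<omega> i j)"
  unfolding pm_basis_def
proof (intro conjI ballI allI impI)
  let ?T = "SIGMA i:{i\<in>{..<r}. e i \<le> d}. {..<k (d - e i)}"
  have \<beta>R: "\<beta> d t 0 \<in> inv_ring n G a" "homog_deg d (\<beta> d t 0)" if "t < k d" for d t
    using \<beta>[of d] that equivariant_vecs_trivial_D[of "\<beta> d t" n G a] unfolding pm_basis_def graded_vecs_def by auto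
  have \<omega>0: "\<omega> i j = 0" if "i < r" "r \<le> j" for i j using \<omega>[OF that(1)] that(2) by (simp add: equivariant_vecs_def)
  show "finite ?T" by auto
  {
    fix t assume "t \<in> ?T"
    then obtain i s where t: "t = (i, s)" "i < r" "e i \<le> d" "s < k (d - e i)" by auto
    have "homog_deg d (\<beta> (d - e i) s 0 * \<omega> i j)" for j
      using homog_deg_mult[OF \<beta>R(2)[OF t(4)], of "e i" "\<omega> i j"] hd[of i j] t \<omega>0[of i j] by (cases "j < r") auto
    then show "(case t of (i, t) \<Rightarrow> \<lambda>j. \<beta> (d - e i) t 0 * \<omega> i j) \<in> graded_vecs n r G a b d"
      using inv_ring_mult_vec[OF \<beta>R(1)[OF t(4)] \<omega>[OF t(2)]] by (simp add: t(1) graded_vecs_def)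
  }
  have sumT: "(\<Sum>t\<in>?T. Const (c t) * (case t of (i, t) \<Rightarrow> \<lambda>j. \<beta> (d - e i) t 0 * \<omega> i j) j) =
     (\<Sum>i<r. (if e i \<le> d then \<Sum>s<k (d - e i). Const (c (i, s)) * \<beta> (d - e i) s 0 else 0) * \<omega> i j)" for c j
  proof -
    have "(\<Sum>t\<in>?T. Const (c t) * (case t of (i, t) \<Rightarrow> \<lambda>j. \<beta> (d - e i) t 0 * \<omega> i j) j) =
       (\<Sum>i\<in>{i\<in>{..<r}. e i \<le> d}. \<Sum>s<k (d - e i). Const (c (i, s)) * (\<beta> (d - e i) s 0 * \<omega> i j))"
      by (subst sum.Sigma) (auto intro!: sum.cong)
    also have "\<dots> = (\<Sum>i\<in>{i\<in>{..<r}. e i \<le> d}. (\<Sum>s<k (d - e i). Const (c (i, s)) * \<beta> (d - e i) s 0) * \<omega> i j)"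
      by (simp add: sum_distrib_right mult.assoc)
    also have "\<dots> = (\<Sum>i<r. (if e i \<le> d then \<Sum>s<k (d - e i). Const (c (i, s)) * \<beta> (d - e i) s 0 else 0) * \<omega> i j)"
      by (rule sum.mono_neutral_cong_left) auto
    finally show ?thesis .
  qed
  {
    fix c t assume c: "\<forall>j. (\<Sum>t\<in>?T. Const (c t) * (case t of (i, t) \<Rightarrow> \<lambda>j. \<beta> (d - e i) t 0 * \<omega> i j) j) = 0" and "t \<in> ?T"
    then obtain i s where t: "t = (i, s)" "i < r" "e i \<le> d" "s < k (d - e i)" by auto
    define q where "q i = (if i < r \<and> e i \<le> d then \<Sum>s<k (d - e i). Const (c (i, s)) * \<beta> (d - e i) s 0 else 0)" for i
    have "(\<lambda>j. 0) \<in> equivariant_vecs n r G a b" by (simp add: equivariant_vecs_def)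
    from free[OF this] have uniq: "q = q'" if "\<forall>i<r. q i \<in> inv_ring n G a" "\<forall>i\<ge>r. q i = 0" "\<forall>j<r. 0 = (\<Sum>i<r. q i * \<omega> i j)"
      "\<forall>i<r. q' i \<in> inv_ring n G a" "\<forall>i\<ge>r. q' i = 0" "\<forall>j<r. 0 = (\<Sum>i<r. q' i * \<omega> i j)" for q q'
      using that by blast
    have "q = (\<lambda>_. 0)"
    proof (rule uniq)
      show "\<forall>i<r. q i \<in> inv_ring n G a" using \<beta>R(1) by (auto simp: q_def intro!: inv_ring_sum)
      have "(\<Sum>i<r. q i * \<omega> i j) = (\<Sum>i<r. (if e i \<le> d then \<Sum>s<k (d - e i). Const (c (i, s)) * \<beta> (d - e i) s 0 else 0) * \<omega> i j)" for j
        by (rule sum.cong) (auto simp: q_def)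
      then show "\<forall>j<r. 0 = (\<Sum>i<r. q i * \<omega> i j)" using c unfolding sumT by simp
    qed (auto simp: q_def)
    then have "(\<Sum>s<k (d - e i). Const (c (i, s)) * \<beta> (d - e i) s 0) = 0" using t fun_cong[of q "\<lambda>_. 0" i] unfolding q_def by simp
    moreover have "\<beta> (d - e i) s j = 0" if "j \<noteq> 0" "s < k (d - e i)" for s j
      using \<beta>[of "d - e i"] that equivariant_vecs_trivial_D[of "\<beta> (d - e i) s" n G a] unfolding pm_basis_def graded_vecs_def
      by (metis (no_types, lifting) lessThan_iff mem_Collect_eq)
    ultimately have "(\<Sum>s<k (d - e i). Const (c (i, s)) * \<beta> (d - e i) s j) = 0" for j by (cases "j = 0") auto
    then have "\<forall>s<k (d - e i). c (i, s) = 0" using \<beta>[of "d - e i"] unfolding pm_basis_def by fastforce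
    then show "c t = 0" using t by simp
  }
  {
    fix w assume w: "w \<in> graded_vecs n r G a b d"
    then have wX: "w \<in> equivariant_vecs n r G a b" and wh: "homog_deg d (w j)" for j by (auto simp: graded_vecs_def)
    obtain q where q: "\<And>i. i < r \<Longrightarrow> q i \<in> inv_ring n G a" "\<And>j. j < r \<Longrightarrow> w j = (\<Sum>i<r. q i * \<omega> i j)"
      using free[OF wX] by blast
    have "\<exists>c. hcomp (d - e i) (q i) = (\<Sum>s<k (d - e i). Const (c s) * \<beta> (d - e i) s 0)" if "i < r" for i
    proof -
      define v where "v = (\<lambda>j::nat. if j = 0 then hcomp (d - e i) (q i) else 0)"
      have "v \<in> graded_vecs n 1 G a (\<lambda>_ _ _. 1) (d - e i)"
        using inv_ring_hcomp[OF q(1)[OF that]] equivariant_vecs_trivial[of "hcomp (d - e i) (q i)" n G a]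
        by (simp add: graded_vecs_def v_def)
      moreover have "\<forall>w\<in>graded_vecs n 1 G a (\<lambda>_ _ _. 1) (d - e i). \<exists>c. \<forall>j. w j = (\<Sum>s<k (d - e i). Const (c s) * \<beta> (d - e i) s j)"
        using \<beta>[of "d - e i"] unfolding pm_basis_def by (elim conjE)
      ultimately obtain c where "\<forall>j. v j = (\<Sum>s<k (d - e i). Const (c s) * \<beta> (d - e i) s j)" by blast
      from this[rule_format, of 0] show ?thesis by (auto simp: v_def)
    qed
    then obtain c where c: "\<And>i. i < r \<Longrightarrow> hcomp (d - e i) (q i) = (\<Sum>s<k (d - e i). Const (c i s) * \<beta> (d - e i) s 0)"
      by metis
    have "w j = (\<Sum>t\<in>?T. Const (case t of (i, s) \<Rightarrow> c i s) * (case t of (i, t) \<Rightarrow> \<lambda>j. \<beta> (d - e i) t 0 * \<omega> i j) j)" for j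
    proof (cases "j < r")
      case True
      have "w j = hcomp d (w j)" using hcomp_homog[OF wh, of d j] by simp
      also have "\<dots> = (\<Sum>i<r. hcomp d (q i * \<omega> i j))" using q(2)[OF True] by (simp add: hcomp_sum)
      also have "\<dots> = (\<Sum>i<r. (if e i \<le> d then hcomp (d - e i) (q i) else 0) * \<omega> i j)"
        by (intro sum.cong refl, subst hcomp_mult_homog[OF hd]) (use True in auto)
      also have "\<dots> = (\<Sum>i<r. (if e i \<le> d then \<Sum>s<k (d - e i). Const (case (i, s) of (i, s) \<Rightarrow> c i s) * \<beta> (d - e i) s 0 else 0) * \<omega> i j)"
        using c by (intro sum.cong refl) auto
      finally show ?thesis unfolding sumT .
    next
      case False
      then have "w j = 0" using wX by (simp add: equivariant_vecs_def)
      then show ?thesis unfolding sumT using \<omega>0 False by (simp add: sum.neutral)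
    qed
    then show "\<exists>c. \<forall>j. w j = (\<Sum>t\<in>?T. Const (c t) * (case t of (i, t) \<Rightarrow> \<lambda>j. \<beta> (d - e i) t 0 * \<omega> i j) j)" by blast
  }
qed

text \<open>Two products of a degree polynomial with the same Hilbert series agree. As its constant
  term \<open>k 0\<close> is nonzero, the numbers of generators of each degree can be compared
  successively.\<close>

lemma degree_count_unique:
  fixes e e' k :: "nat \<Rightarrow> nat"
  assumes k: "k 0 \<noteq> 0"
    and eq: "\<And>d. (\<Sum>i\<in>{i\<in>{..<r}. e i \<le> d}. k (d - e i)) = (\<Sum>i\<in>{i\<in>{..<r}. e' i \<le> d}. k (d - e' i))"
  obtains p where "p permutes {..<r}" "\<And>i. i < r \<Longrightarrow> e i = e' (p i)"
proof -
  have count: "(\<Sum>i\<in>{i\<in>{..<r}. e i \<le> d}. k (d - e i)) = (\<Sum>j\<le>d. card {i\<in>{..<r}. e i = j} * k (d - j))" for e :: "nat \<Rightarrow> nat" and d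
  proof -
    have "(\<Sum>i\<in>{i\<in>{..<r}. e i \<le> d}. k (d - e i)) = (\<Sum>j\<in>{..d}. \<Sum>i\<in>{i\<in>{i\<in>{..<r}. e i \<le> d}. e i = j}. k (d - e i))"
      by (rule sum.group[symmetric]) auto
    also have "\<dots> = (\<Sum>j\<le>d. card {i\<in>{..<r}. e i = j} * k (d - j))"
    proof (rule sum.cong[OF refl])
      fix j assume "j \<in> {..d}"
      then have "{i\<in>{i\<in>{..<r}. e i \<le> d}. e i = j} = {i\<in>{..<r}. e i = j}" by auto
      then show "(\<Sum>i\<in>{i\<in>{i\<in>{..<r}. e i \<le> d}. e i = j}. k (d - e i)) = card {i\<in>{..<r}. e i = j} * k (d - j)"
        by simp
    qed
    finally show ?thesis .
  qed
  have cards: "card {i\<in>{..<r}. e i = d} = card {i\<in>{..<r}. e' i = d}" for d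
  proof (induction d rule: less_induct)
    case (less d)
    have "(\<Sum>j<d. card {i\<in>{..<r}. e i = j} * k (d - j)) = (\<Sum>j<d. card {i\<in>{..<r}. e' i = j} * k (d - j))"
      using less by (intro sum.cong) auto
    moreover have "(\<Sum>j\<le>d. card {i\<in>{..<r}. e i = j} * k (d - j)) = (\<Sum>j\<le>d. card {i\<in>{..<r}. e' i = j} * k (d - j))"
      using eq[of d] count by metis
    ultimately show ?case using k by (simp add: lessThan_Suc_atMost[symmetric])
  qed
  have "image_mset e (mset_set {..<r}) = image_mset e' (mset_set {..<r})"
    using cards by (intro multiset_eqI) (simp add: count_image_mset vimage_def Int_def conj_commute)
  from image_mset_eq_implies_permutes[OF finite_lessThan this] obtain p where
    "p permutes {..<r}" "\<forall>x\<in>{..<r}. e x = e' (p x)" .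
  then show thesis using that[of p] by simp
qed

lemma dual_rep_trivial:
  assumes "dual_rep n r G mul a a' b b'"
  shows "dual_rep n 1 G mul a a' (\<lambda>_ _ _. 1) (\<lambda>_ _ _. 1)"
proof -
  interpret dual_rep n r G mul a a' b b' by fact
  show ?thesis
    by unfold_locales (use finite_G nonempty_G mul_left mul_right a_mul a'_mul a_dual a_dual' in auto)
qed

text \<open>The two modules have equal graded dimensions, and so do the two invariant rings by the
  trivial representation. Freeness then forces equal degrees of the generators.\<close>

lemma (in dual_rep) degrees_permute:
  assumes \<omega>: "\<And>i. i < r \<Longrightarrow> \<omega> i \<in> X"
    and hd: "\<And>i j. i < r \<Longrightarrow> j < r \<Longrightarrow> homog_deg (e i) (\<omega> i j)"
    and free: "\<And>w. w \<in> X \<Longrightarrow> \<exists>!q. (\<forall>i<r. q i \<in> inv_ring n G a) \<and> (\<forall>i\<ge>r. q i = 0) \<and>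
                   (\<forall>j<r. w j = (\<Sum>i<r. q i * \<omega> i j))"
    and \<omega>': "\<And>i. i < r \<Longrightarrow> \<omega>' i \<in> X'"
    and hd': "\<And>i j. i < r \<Longrightarrow> j < r \<Longrightarrow> homog_deg (e' i) (\<omega>' i j)"
    and free': "\<And>w. w \<in> X' \<Longrightarrow> \<exists>!q. (\<forall>i<r. q i \<in> inv_ring n G a') \<and> (\<forall>i\<ge>r. q i = 0) \<and>
                   (\<forall>j<r. w j = (\<Sum>i<r. q i * \<omega>' i j))"
  obtains p where "p permutes {..<r}" "\<And>i. i < r \<Longrightarrow> e i = e' (p i)"
proof -
  interpret triv: dual_rep n 1 G mul a a' "\<lambda>_ _ _. 1" "\<lambda>_ _ _. 1"
    by (rule dual_rep_trivial) (rule dual_rep_axioms)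
  obtain k \<beta> where \<beta>: "\<And>d. pm_basis (graded_vecs n 1 G a (\<lambda>_ _ _. 1) d) {..<k d :: nat} (\<beta> d)"
    using exists_graded_basis[of n 1 G a "\<lambda>_ _ _. 1"] by metis
  obtain k' \<beta>' where \<beta>': "\<And>d. pm_basis (graded_vecs n 1 G a' (\<lambda>_ _ _. 1) d) {..<k' d :: nat} (\<beta>' d)"
    using exists_graded_basis[of n 1 G a' "\<lambda>_ _ _. 1"] by metis
  have kk: "k' d = k d" for d using triv.graded_basis_card_eq[OF \<beta> \<beta>', of d] by simp
  have k0: "k 0 \<noteq> 0"
  proof
    assume 0: "k 0 = 0"
    have "(\<lambda>j. if j = 0 then 1 else 0) \<in> graded_vecs n 1 G a (\<lambda>_ _ _. 1) 0"
      using equivariant_vecs_trivial[of "1::'a pm" n G a] lsub_Const[of n "a _" 1]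
      by (auto simp: graded_vecs_def homog_deg_1 inv_ring_def)
    then have "\<exists>c. \<forall>j. (if j = 0 then 1 else 0) = (\<Sum>t<k 0. Const (c t) * \<beta> 0 t j)"
      using \<beta>[of 0] unfolding pm_basis_def by (elim conjE) (drule bspec)
    then obtain c where "\<And>j::nat. (if j = 0 then 1 else 0 :: 'a pm) = (\<Sum>t<k 0. Const (c t) * \<beta> 0 t j)"
      by blast
    from this[of 0] show False using 0 by simp
  qed
  have "card (SIGMA i:{i\<in>{..<r}. e i \<le> d}. {..<k (d - e i)}) = card (SIGMA i:{i\<in>{..<r}. e' i \<le> d}. {..<k' (d - e' i)})" for d
    using graded_basis_card_eq[OF free_module_graded_basis[OF \<omega> hd free \<beta>] free_module_graded_basis[OF \<omega>' hd' free' \<beta>']] .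
  then have "(\<Sum>i\<in>{i\<in>{..<r}. e i \<le> d}. k (d - e i)) = (\<Sum>i\<in>{i\<in>{..<r}. e' i \<le> d}. k (d - e' i))" for d
    by (simp add: kk)
  then show thesis using degree_count_unique[where k = k and r = r and e = e and e' = e', OF k0] that by metis
qed

subsection \<open>The module of semi-invariant forms\<close>

lemma foldr_sum:
  assumes "\<And>i w. op i (\<lambda>K. \<Sum>t\<in>T. p t * w t K) = (\<lambda>K. \<Sum>t\<in>T. p t * op i (w t) K)"
  shows "foldr op xs (\<lambda>K. \<Sum>t\<in>T. p t * w t K) = (\<lambda>K. \<Sum>t\<in>T. p t * foldr op xs (w t) K)"
  by (induction xs) (auto simp: assms)

lemma iot_sum: "iot r v i (\<lambda>K. \<Sum>t\<in>T. p t * w t K) = (\<lambda>K. \<Sum>t\<in>T. p t * iot r v i (w t) K)"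
proof
  fix K
  have "iot r v i (\<lambda>K. \<Sum>t\<in>T. p t * w t K) K = (\<Sum>j<r. \<Sum>t\<in>T. p t * (v i j * inn j (w t) K))"
    by (simp add: iot_def inn_sum inn_mult sum_distrib_left mult.left_commute)
  also have "\<dots> = (\<Sum>t\<in>T. \<Sum>j<r. p t * (v i j * inn j (w t) K))" by (rule sum.swap)
  finally show "iot r v i (\<lambda>K. \<Sum>t\<in>T. p t * w t K) K = (\<Sum>t\<in>T. p t * iot r v i (w t) K)"
    by (simp add: iot_def sum_distrib_left)
qed

lemma dst_sum: "dst r v i (\<lambda>K. \<Sum>t\<in>T. Const (c t) * w t K) = (\<lambda>K. \<Sum>t\<in>T. Const (c t) * dst r v i (w t) K)"
proof
  fix K
  have "dst r v i (\<lambda>K. \<Sum>t\<in>T. Const (c t) * w t K) K = (\<Sum>j<r. \<Sum>t\<in>T. Const (c t) * eps j (\<lambda>I. diff_op (v i j) (w t I)) K)"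
    by (simp add: dst_def diff_op_sum_right diff_op_Const_mult_right eps_sum eps_mult)
  also have "\<dots> = (\<Sum>t\<in>T. \<Sum>j<r. Const (c t) * eps j (\<lambda>I. diff_op (v i j) (w t I)) K)" by (rule sum.swap)
  finally show "dst r v i (\<lambda>K. \<Sum>t\<in>T. Const (c t) * w t K) K = (\<Sum>t\<in>T. Const (c t) * dst r v i (w t) K)"
    by (simp add: dst_def sum_distrib_left)
qed

lemma dst_diff_op: "dst r v i (\<lambda>K. diff_op q (w K)) = (\<lambda>K. diff_op q (dst r v i w K))"
  by (auto simp: dst_def diff_op_sum_right diff_op_commute[of _ q] eps_diff_op)

lemma foldr_dst_diff_op: "foldr (dst r v) xs (\<lambda>K. diff_op q (w K)) = (\<lambda>K. diff_op q (foldr (dst r v) xs w K))"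
  by (induction xs) (auto simp: dst_diff_op)

lemma Tact_empty: "Tact n r a c w {} = lsub n a (w {})"
proof -
  have "EB r c I {} = 0" if "I \<noteq> {}" "finite I" for I
  proof -
    have "sorted_list_of_set I \<noteq> []" using that by (simp add: sorted_list_of_set_eq_Nil_iff)
    then obtain x xs where "sorted_list_of_set I = x # xs" by (cases "sorted_list_of_set I") auto
    then show ?thesis by (simp add: EB_def epsl_def eps_def)
  qed
  then have "Tact n r a c w {} = (\<Sum>I\<in>Pow {..<r}. if I = {} then lsub n a (w {}) else 0)"
    unfolding Tact_def by (intro sum.cong refl) (auto simp: EB_def ext_one_def finite_subset[of _ "{..<r}"])
  then show ?thesis by simp
qed

text \<open>In degree \<open>d\<close> the factor \<open>p\<close> contributes all of the degree, so
  only the constant term of \<open>q\<close> can take part.\<close>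

lemma lk_mult_lowest:
  fixes p q :: "'a::comm_semiring_1 pm"
  assumes p: "\<And>m. lk p m \<noteq> 0 \<Longrightarrow> d \<le> mdeg m" and m: "mdeg m = d"
  shows "lk (p * q) m = lk p m * lk q 0"
proof -
  have "lk (p * q) m = (\<Sum>m1\<in>keys p. \<Sum>m2\<in>keys q. if m1 + m2 = m then lk p m1 * lk q m2 else 0)"
    unfolding mult_as_sum[OF finite_keys order_refl finite_keys order_refl, of p q]
    by (simp add: lookup_sum lookup_single when_def)
  also have "\<dots> = (\<Sum>m1\<in>keys p. \<Sum>m2\<in>keys q. if m1 = m then (if m2 = 0 then lk p m * lk q 0 else 0) else 0)"
  proof (intro sum.cong refl)
    fix m1 m2 assume m1: "m1 \<in> keys p"
    have "m1 = m \<and> m2 = 0" if "m1 + m2 = m"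
    proof -
      have "mdeg m1 + mdeg m2 = d" using that m by (metis mdeg_add)
      moreover have "d \<le> mdeg m1" using p[of m1] m1 by (simp add: in_keys_iff)
      ultimately have "mdeg m2 = 0" by simp
      then have "m2 = 0" by (simp only: mdeg_eq_0_iff)
      then show ?thesis using that by simp
    qed
    then show "(if m1 + m2 = m then lk p m1 * lk q m2 else 0) = (if m1 = m then (if m2 = 0 then lk p m * lk q 0 else 0) else 0)"
      by auto
  qed
  also have "\<dots> = (if m \<in> keys p then (\<Sum>m2\<in>keys q. if m2 = 0 then lk p m * lk q 0 else 0) else 0)"
  proof -
    have "(\<Sum>m2\<in>keys q. if m1 = m then (if m2 = 0 then lk p m * lk q 0 else 0) else 0) =
      (if m1 = m then (\<Sum>m2\<in>keys q. if m2 = 0 then lk p m * lk q 0 else 0) else 0)" for m1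
      by (cases "m1 = m") auto
    then show ?thesis by simp
  qed
  also have "\<dots> = lk p m * lk q 0" by (auto simp: in_keys_iff)
  finally show ?thesis .
qed

text \<open>Degree \<open>h - s\<close>, written additively because the operators lower the degree
  and subtraction of naturals is truncated.\<close>

definition shift_homog :: "nat \<Rightarrow> nat \<Rightarrow> (nat set \<Rightarrow> 'a::zero pm) \<Rightarrow> bool" where
  "shift_homog s h w \<longleftrightarrow> (\<forall>K m. lk (w K) m \<noteq> 0 \<longrightarrow> mdeg m + s = h)"

lemma shift_homog_emb: "homog_deg h p \<Longrightarrow> shift_homog 0 h (emb p)"
  by (auto simp: shift_homog_def emb_def homog_deg_lk)

lemma shift_homog_dst:
  assumes w: "shift_homog s h w" and v: "\<And>j. j < r \<Longrightarrow> homog_deg e (v i j)"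
  shows "shift_homog (s + e) h (dst r v i w)"
  unfolding shift_homog_def
proof (intro allI impI)
  fix K m assume "lk (dst r v i w K) m \<noteq> 0"
  then obtain j where j: "j < r" "lk (eps j (\<lambda>I. diff_op (v i j) (w I)) K) m \<noteq> 0"
    unfolding dst_def lookup_sum by (auto elim: sum.not_neutral_contains_not_neutral)
  define I where "I = K - {j}"
  have "lk (diff_op (v i j) (w I)) m \<noteq> 0" using j(2) by (auto simp: I_def eps_def split: if_splits)
  then have "(\<Sum>m'\<in>keys (v i j). lk (v i j) m' * dc m' m * lk (w I) (m' + m)) \<noteq> 0"
    by (simp add: lk_diff_op)
  then obtain m' where "lk (v i j) m' * dc m' m * lk (w I) (m' + m) \<noteq> 0"
    by (rule sum.not_neutral_contains_not_neutral)
  then have m': "lk (v i j) m' \<noteq> 0" "lk (w I) (m' + m) \<noteq> 0" by auto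
  then have "mdeg m' = e" "mdeg (m' + m) + s = h" using v[OF j(1)] w by (auto simp: homog_deg_lk shift_homog_def)
  then show "mdeg m + (s + e) = h" by (simp add: mdeg_add)
qed

lemma shift_homog_foldr_dst:
  assumes w: "shift_homog 0 h w" and v: "\<And>i j. i < r \<Longrightarrow> j < r \<Longrightarrow> homog_deg (e i) (v i j)"
    and "distinct xs" "set xs \<subseteq> {..<r}"
  shows "shift_homog (\<Sum>i\<in>set xs. e i) h (foldr (dst r v) xs w)"
  using assms(3,4)
proof (induction xs)
  case (Cons x xs)
  then have "shift_homog ((\<Sum>i\<in>set xs. e i) + e x) h (dst r v x (foldr (dst r v) xs w))"
    using v by (intro shift_homog_dst) auto
  then show ?case using Cons.prems by (simp add: add.commute)
qed (use w in simp)

definition deg_le :: "nat \<Rightarrow> 'a::zero pm \<Rightarrow> bool" where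
  "deg_le D p \<longleftrightarrow> (\<forall>m. lk p m \<noteq> 0 \<longrightarrow> mdeg m \<le> D)"

lemma deg_le_sum: "(\<And>t. t \<in> T \<Longrightarrow> deg_le D (f t)) \<Longrightarrow> deg_le D (sum f T)"
  unfolding deg_le_def lookup_sum by (auto elim: sum.not_neutral_contains_not_neutral)

lemma deg_le_mult:
  assumes "deg_le D p" "deg_le E q" shows "deg_le (D + E) (p * q)"
  unfolding deg_le_def
proof (intro allI impI)
  fix m assume "lk (p * q) m \<noteq> 0"
  then obtain a b where "m = a + b" "a \<in> keys p" "b \<in> keys q" using keys_mult[of p q] by (auto simp: in_keys_iff)
  then show "mdeg m \<le> D + E" using assms by (auto simp: deg_le_def mdeg_add in_keys_iff add_mono)
qed

lemma deg_le_Const_mult: "deg_le D p \<Longrightarrow> deg_le D (Const c * p)"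
  unfolding deg_le_def by (metis lk_Const_mult mult_zero_right)

lemma homog_deg_imp_deg_le: "homog_deg d p \<Longrightarrow> deg_le d p"
  by (auto simp: homog_deg_lk deg_le_def)

lemma deg_le_iot:
  assumes "\<And>K. deg_le D (w K)" "\<And>j. j < r \<Longrightarrow> homog_deg e (v i j)"
  shows "deg_le (e + D) (iot r v i w K)"
  unfolding iot_def
proof (rule deg_le_sum)
  fix j assume "j \<in> {..<r}"
  moreover have "deg_le D (inn j w K)" using assms(1) by (auto simp: inn_def deg_le_Const_mult) (simp add: deg_le_def)
  ultimately show "deg_le (e + D) (v i j * inn j w K)" using assms(2)
    by (intro deg_le_mult[OF homog_deg_imp_deg_le]) auto
qed

lemma deg_le_foldr_iot:
  assumes w: "\<And>K. deg_le D (w K)" and v: "\<And>i j. i < r \<Longrightarrow> j < r \<Longrightarrow> homog_deg (e i) (v i j)"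
    and "distinct xs" "set xs \<subseteq> {..<r}"
  shows "deg_le (D + (\<Sum>i\<in>set xs. e i)) (foldr (iot r v) xs w K)"
  using assms(3,4)
proof (induction xs arbitrary: K)
  case (Cons x xs)
  then have "deg_le (e x + (D + (\<Sum>i\<in>set xs. e i))) (iot r v x (foldr (iot r v) xs w) K)"
    using v by (intro deg_le_iot) auto
  then show ?case using Cons.prems by (simp add: algebra_simps)
qed (use w in simp)

section \<open>The given group as a dual pair, and equivariance of the operators\<close>

locale invariant_setting =
  fixes n r :: nat
    and G :: "'a::field_char_0 mat set"
    and \<rho> :: "'a mat \<Rightarrow> 'a mat"
    and \<chi> :: "'a mat \<Rightarrow> 'a"
    and f :: "nat \<Rightarrow> 'a pm"
    and \<Delta> :: "'a pm"
    and \<omega> \<omega>t :: "nat \<Rightarrow> nat \<Rightarrow> 'a pm"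
  assumes group: "finite_mat_group n G"
    and rep: "representation n r G \<rho>"
    and basic: "basic_invariants n G f"
    and gen: "semi_inv_generator n G \<chi> \<Delta>"
    and basis: "homog_free_basis r (inv_SVd n G) (inv_SVd_M n r G \<rho>) \<omega>"
    and dual_basis: "homog_free_basis r (inv_SV n G) (inv_SV_Mdual n r G \<rho>) \<omega>t"
    and dvd: "jacobian r \<omega> dvd \<Delta>"
begin

lemma G_facts: "finite G" "1\<^sub>m n \<in> G" "g \<in> G \<Longrightarrow> g \<in> carrier_mat n n" "g \<in> G \<Longrightarrow> h \<in> G \<Longrightarrow> g * h \<in> G"
  using group by (auto simp: finite_mat_group_def)

text \<open>The group axioms supply right inverses only. The right inverse of \<open>h\<close> turns
  out to be \<open>g\<close> itself, so inverses are two-sided.\<close>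

lemma right_inverse:
  assumes g: "g \<in> G"
  obtains h where "h \<in> G" "g * h = 1\<^sub>m n" "h * g = 1\<^sub>m n"
proof -
  obtain h where h: "h \<in> G" "g * h = 1\<^sub>m n" using group g by (auto simp: finite_mat_group_def)
  obtain k where k: "k \<in> G" "h * k = 1\<^sub>m n" using group h by (auto simp: finite_mat_group_def)
  note c = G_facts(3)[OF g] G_facts(3)[OF h(1)] G_facts(3)[OF k(1)]
  have "g = g * (h * k)" using c k by simp
  also have "\<dots> = k" using c h by (simp add: assoc_mult_mat[symmetric, of _ n n _ n _ n])
  finally show thesis using that h k by simp
qed

lemma ginv_eq:
  assumes g: "g \<in> G" and h: "h \<in> G" "g * h = 1\<^sub>m n"
  shows "ginv n G g = h"
  unfolding ginv_def
proof (rule the_equality)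
  fix h' assume h': "h' \<in> G \<and> g * h' = 1\<^sub>m n"
  obtain k where k: "k \<in> G" "k * g = 1\<^sub>m n" using right_inverse[OF g] by metis
  note c = G_facts(3)[OF g] G_facts(3)[OF h(1)] G_facts(3)[OF k(1)] G_facts(3)[OF conjunct1[OF h']]
  have "h' = (k * g) * h'" using c k by simp
  also have "\<dots> = (k * g) * h" using c h h' by (simp only: assoc_mult_mat[of k n n g n _ n])
  also have "\<dots> = h" using c k by simp
  finally show "h' = h" .
qed (use h in simp)

lemma ginv:
  assumes "g \<in> G"
  shows "ginv n G g \<in> G" "g * ginv n G g = 1\<^sub>m n" "ginv n G g * g = 1\<^sub>m n"
proof -
  obtain h where "h \<in> G" "g * h = 1\<^sub>m n" "h * g = 1\<^sub>m n" using right_inverse[OF assms] .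
  then show "ginv n G g \<in> G" "g * ginv n G g = 1\<^sub>m n" "ginv n G g * g = 1\<^sub>m n"
    using ginv_eq[OF assms] by auto
qed

lemma ginv_mult:
  assumes g: "g \<in> G" and h: "h \<in> G"
  shows "ginv n G (g * h) = ginv n G h * ginv n G g"
proof (rule ginv_eq)
  note c = G_facts(3)[OF g] G_facts(3)[OF h] G_facts(3)[OF ginv(1)[OF g]] G_facts(3)[OF ginv(1)[OF h]]
  have "g * h * (ginv n G h * ginv n G g) = g * (h * ginv n G h) * ginv n G g"
    using c by (simp add: assoc_mult_mat[of _ n n _ n _ n])
  then show "g * h * (ginv n G h * ginv n G g) = 1\<^sub>m n" using c ginv(2)[OF g] ginv(2)[OF h] by simp
qed (use g h ginv G_facts in auto)

text \<open>The arrays \<open>aV\<close> and \<open>aV'\<close> list the images of the x_j and y_j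
  by rows. \<open>bM\<close> acts on coordinate vectors of M by columns, and \<open>bM'\<close>
  carries the transpose that makes it do the same for the dual of M.\<close>

definition aV :: "'a mat \<Rightarrow> nat \<Rightarrow> nat \<Rightarrow> 'a" where "aV g j k = ginv n G g $$ (j, k)"
definition aV' :: "'a mat \<Rightarrow> nat \<Rightarrow> nat \<Rightarrow> 'a" where "aV' g j k = g $$ (k, j)"
definition bM :: "'a mat \<Rightarrow> nat \<Rightarrow> nat \<Rightarrow> 'a" where "bM g j k = \<rho> g $$ (j, k)"
definition bM' :: "'a mat \<Rightarrow> nat \<Rightarrow> nat \<Rightarrow> 'a" where "bM' g k j = \<rho> (ginv n G g) $$ (j, k)"

lemma mat_mult_index:
  assumes "A \<in> carrier_mat N N" "B \<in> carrier_mat N N" "i < N" "k < N"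
  shows "(A * B) $$ (i, k) = (\<Sum>l<N. A $$ (i, l) * B $$ (l, k))"
  using assms by (auto simp: scalar_prod_def atLeast0LessThan)

lemma rho:
  assumes "g \<in> G"
  shows "\<rho> g \<in> carrier_mat r r" "h \<in> G \<Longrightarrow> \<rho> (g * h) = \<rho> g * \<rho> h"
    "\<rho> g * \<rho> (ginv n G g) = 1\<^sub>m r" "\<rho> (ginv n G g) * \<rho> g = 1\<^sub>m r"
proof -
  show *: "\<rho> g \<in> carrier_mat r r" "h \<in> G \<Longrightarrow> \<rho> (g * h) = \<rho> g * \<rho> h"
    using rep assms by (auto simp: representation_def)
  have "\<rho> (g * ginv n G g) = \<rho> g * \<rho> (ginv n G g)" "\<rho> (ginv n G g * g) = \<rho> (ginv n G g) * \<rho> g"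
    using rep assms ginv(1)[OF assms] by (auto simp: representation_def)
  moreover have "\<rho> (1\<^sub>m n) = 1\<^sub>m r" using rep by (simp add: representation_def)
  ultimately show "\<rho> g * \<rho> (ginv n G g) = 1\<^sub>m r" "\<rho> (ginv n G g) * \<rho> g = 1\<^sub>m r"
    using ginv(2,3)[OF assms] by auto
qed

sublocale dual_rep n r G "(*)" aV aV' bM bM'
proof
  show "finite G" "G \<noteq> {}" using G_facts by auto
next
  fix g assume g: "g \<in> G"
  note gc = G_facts(3)[OF g] G_facts(3)[OF ginv(1)[OF g]]
  have "inj_on ((*) g) G"
  proof (rule inj_on_inverseI[of _ "(*) (ginv n G g)"])
    fix h assume "h \<in> G"
    then have "ginv n G g * (g * h) = (ginv n G g * g) * h"
      using gc G_facts(3) by (simp add: assoc_mult_mat[of _ n n _ n _ n])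
    then show "ginv n G g * (g * h) = h" using ginv(3)[OF g] G_facts(3)[OF \<open>h \<in> G\<close>] by simp
  qed
  moreover have "(*) g ` G \<subseteq> G" using g G_facts by auto
  ultimately show "bij_betw ((*) g) G G" using endo_inj_surj[OF G_facts(1)] by (auto simp: bij_betw_def)
  have "inj_on (\<lambda>h. h * g) G"
  proof (rule inj_on_inverseI[of _ "\<lambda>h. h * ginv n G g"])
    fix h assume "h \<in> G"
    then have "h * g * ginv n G g = h * (g * ginv n G g)"
      using gc G_facts(3) by (simp add: assoc_mult_mat[of _ n n _ n _ n])
    then show "h * g * ginv n G g = h" using ginv(2)[OF g] G_facts(3)[OF \<open>h \<in> G\<close>] by simp
  qed
  moreover have "(\<lambda>h. h * g) ` G \<subseteq> G" using g G_facts by auto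
  ultimately show "bij_betw (\<lambda>h. h * g) G G" using endo_inj_surj[OF G_facts(1)] by (auto simp: bij_betw_def)
next
  fix g h i k assume g: "g \<in> G" and h: "h \<in> G" and ik: "i < n" "k < n"
  note c = G_facts(3)[OF g] G_facts(3)[OF h] G_facts(3)[OF ginv(1)[OF g]] G_facts(3)[OF ginv(1)[OF h]]
  show "aV (g * h) i k = (\<Sum>l<n. aV h i l * aV g l k)"
    unfolding aV_def ginv_mult[OF g h] by (rule mat_mult_index) (use c ik in auto)
  show "aV' (g * h) i k = (\<Sum>l<n. aV' h i l * aV' g l k)"
    unfolding aV'_def by (subst mat_mult_index[OF c(1,2)]) (use ik in \<open>auto simp: mult.commute\<close>)
next
  fix g h i k assume g: "g \<in> G" and h: "h \<in> G" and ik: "i < r" "k < r"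
  note c = rho(1)[OF g] rho(1)[OF h] rho(1)[OF ginv(1)[OF g]] rho(1)[OF ginv(1)[OF h]]
  show "bM (g * h) i k = (\<Sum>l<r. bM g i l * bM h l k)"
    unfolding bM_def rho(2)[OF g h] by (rule mat_mult_index) (use c ik in auto)
  show "bM' (g * h) i k = (\<Sum>l<r. bM' g i l * bM' h l k)"
    unfolding bM'_def ginv_mult[OF g h] rho(2)[OF ginv(1)[OF h] ginv(1)[OF g]]
    by (subst mat_mult_index[OF c(4,3)]) (use ik in \<open>auto simp: mult.commute\<close>)
next
  fix g i k assume g: "g \<in> G" and ik: "i < n" "k < n"
  note c = G_facts(3)[OF g] G_facts(3)[OF ginv(1)[OF g]]
  show "(\<Sum>l<n. aV g i l * aV' g k l) = (if i = k then 1 else 0)"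
    unfolding aV_def aV'_def using mat_mult_index[OF c(2,1) ik] ik by (simp add: ginv(3)[OF g])
  show "(\<Sum>l<n. aV g l i * aV' g l k) = (if i = k then 1 else 0)"
    unfolding aV_def aV'_def using mat_mult_index[OF c(1,2) ik(2,1)] ik by (auto simp: ginv(2)[OF g] mult.commute)
next
  fix g i k assume g: "g \<in> G" and ik: "i < r" "k < r"
  note c = rho(1)[OF g] rho(1)[OF ginv(1)[OF g]]
  show "(\<Sum>l<r. bM g i l * bM' g k l) = (if i = k then 1 else 0)"
    unfolding bM_def bM'_def using mat_mult_index[OF c ik] ik by (simp add: rho(3)[OF g])
  show "(\<Sum>l<r. bM g l i * bM' g l k) = (if i = k then 1 else 0)"
    unfolding bM_def bM'_def using mat_mult_index[OF c(2,1) ik(2,1)] ik by (auto simp: rho(4)[OF g] mult.commute)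
qed

lemma act_SVd_eq: "g \<in> G \<Longrightarrow> act_SVd n G g p = lsub n (aV g) p"
  using carrier_matD(2)[OF G_facts(3)[OF ginv(1)]] by (simp add: act_SVd_def lin_act_lsub aV_def[abs_def])

lemma act_SV_eq: "g \<in> G \<Longrightarrow> in_vars n p \<Longrightarrow> act_SV g p = lsub n (aV' g) p"
  using carrier_matD[OF G_facts(3)[of g]] by (auto simp: act_SV_def lin_act_lsub aV'_def intro!: lsub_cong)

abbreviation "R \<equiv> inv_ring n G aV"
abbreviation "R' \<equiv> inv_ring n G aV'"

lemma inv_SVd_eq: "inv_SVd n G = R"
  by (auto simp: inv_SVd_def inv_ring_def act_SVd_eq)

lemma inv_SV_eq: "inv_SV n G = R'"
  by (auto simp: inv_SV_def inv_ring_def act_SV_eq)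

lemma inv_SVd_M_eq: "inv_SVd_M n r G \<rho> = X"
  by (auto simp: inv_SVd_M_def equivariant_vecs_def act_SVd_eq bM_def)

lemma inv_SV_Mdual_eq: "inv_SV_Mdual n r G \<rho> = X'"
  by (auto simp: inv_SV_Mdual_def equivariant_vecs_def act_SV_eq bM'_def)

abbreviation "T g \<equiv> Tact n r (aV g) (\<lambda>i k. bM' g k i)"

lemma act_tens_eq: "g \<in> G \<Longrightarrow> act_tens n r G \<rho> g w = T g w"
  using carrier_matD(2)[OF rho(1)[OF ginv(1)[of g]]]
  by (simp add: act_tens_def Tact_def[abs_def] act_SVd_eq ext_basis_act_epsl[where r = r] EB_def bM'_def)

abbreviation "N \<equiv> chi_part n r G \<rho> \<chi>"

lemma N_iff: "w \<in> N \<longleftrightarrow> w \<in> tensor_space n r \<and> (\<forall>g\<in>G. T g w = (\<lambda>K. Const (\<chi> g) * w K))"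
  by (auto simp: chi_part_def act_tens_eq)

lemma N_sum:
  assumes "finite S" "\<And>t. t \<in> S \<Longrightarrow> w t \<in> N" "\<And>t. t \<in> S \<Longrightarrow> p t \<in> R"
  shows "(\<lambda>K. \<Sum>t\<in>S. p t * w t K) \<in> N"
proof -
  have "supp_in r (\<lambda>K. p t * w t K)" if "t \<in> S" for t
    by (rule supp_in_map[of r "w t"]) (use assms(2)[OF that] in \<open>auto simp: N_iff tensor_space_iff\<close>)
  then have "(\<lambda>K. \<Sum>t\<in>S. p t * w t K) \<in> tensor_space n r"
    using assms by (auto simp: N_iff tensor_space_iff inv_ring_def intro!: supp_in_sum in_vars_sum in_vars_mult)
  moreover have "T g (\<lambda>K. \<Sum>t\<in>S. p t * w t K) = (\<lambda>K. Const (\<chi> g) * (\<Sum>t\<in>S. p t * w t K))" if "g \<in> G" for g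
    using assms that by (auto simp: Tact_sum Tact_mult N_iff inv_ring_def sum_distrib_left mult.left_commute intro!: ext sum.cong)
  ultimately show ?thesis by (auto simp: N_iff)
qed

lemma Const_R [simp]: "Const c \<in> R" by (simp add: inv_ring_def)
lemma one_R [simp]: "1 \<in> R" using Const_R[of 1] by simp

lemma N_diff: "v \<in> N \<Longrightarrow> w \<in> N \<Longrightarrow> (\<lambda>K. v K - w K) \<in> N"
proof -
  assume "v \<in> N" "w \<in> N"
  then have "(\<lambda>K. \<Sum>t\<in>{True, False}. (if t then Const 1 else Const (- 1)) * (if t then v else w) K) \<in> N"
    by (intro N_sum) (auto simp del: Const_1)
  then show ?thesis by (simp add: Const_uminus)
qed

lemma \<omega>_X: "i < r \<Longrightarrow> \<omega> i \<in> X" and \<omega>t_X': "i < r \<Longrightarrow> \<omega>t i \<in> X'"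
  using basis dual_basis by (auto simp: homog_free_basis_def inv_SVd_M_eq inv_SV_Mdual_eq)

interpretation dual: dual_rep n r G "(*)" aV' aV bM' bM
  by (rule dual_rep_swap) (rule dual_rep_axioms)

lemma N_iot:
  assumes w: "w \<in> N" and i: "i < r"
  shows "iot r \<omega> i w \<in> N"
proof -
  have "T g (iot r \<omega> i w) = iot r \<omega> i (T g w)" if g: "g \<in> G" for g
  proof (rule Tact_iot[where R = "bM g"])
    show "supp_in r w" using w by (simp add: N_iff tensor_space_iff)
    show "(\<Sum>l<r. bM' g l i * bM g l k) = (if i = k then 1 else 0)" if "i < r" "k < r" for i k
      using b_dual'[OF g that(2,1)] by (auto simp: mult.commute)
    show "(\<Sum>j<r. Const (bM g k j) * lsub n (aV g) (\<omega> i j)) = \<omega> i k" if "k < r" for k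
      using X_D(2)[OF \<omega>_X[OF i] g that] .
  qed
  then show ?thesis using w X_D(1)[OF \<omega>_X[OF i]] by (auto simp: N_iff iot_mult intro: iot_tensor_space)
qed

lemma N_dst:
  assumes w: "w \<in> N" and i: "i < r"
  shows "dst r \<omega>t i w \<in> N"
proof -
  interpret D: anticommuting "dst r \<omega>t" by (rule anticommuting_dst)
  have "T g (dst r \<omega>t i w) = dst r \<omega>t i (T g w)" if g: "g \<in> G" for g
  proof (rule Tact_dst[where b = "aV' g"])
    show "diff_op (lsub n (aV' g) (\<omega>t i j)) (lsub n (aV g) (w I)) = lsub n (aV g) (diff_op (\<omega>t i j) (w I))" for I j
      using w dual.X_D(1)[OF \<omega>t_X'[OF i]] a_dual[OF g] a_dual'[OF g]
      by (intro diff_op_lsub) (auto simp: N_iff tensor_space_iff)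
    show "(\<Sum>j<r. Const (bM' g k j) * lsub n (aV' g) (\<omega>t i j)) = \<omega>t i k" if "k < r" for k
      using dual.X_D(2)[OF \<omega>t_X'[OF i] g that] .
  qed
  then show ?thesis using w by (auto simp: N_iff D.smult intro: dst_tensor_space)
qed

lemma \<Delta>_facts: "homogeneous \<Delta>" "\<Delta> \<noteq> 0" "in_vars n \<Delta>" "g \<in> G \<Longrightarrow> lsub n (aV g) \<Delta> = Const (\<chi> g) * \<Delta>"
proof -
  show "homogeneous \<Delta>" using gen by (simp add: semi_inv_generator_def)
  have "\<forall>q\<in>R. q * \<Delta> = 0 \<longrightarrow> q = 0" using gen by (simp add: semi_inv_generator_def inv_SVd_eq)
  from this[rule_format, OF one_R] show "\<Delta> \<noteq> 0" by auto
  have "1 * \<Delta> \<in> semi_inv_SVd n G \<chi>" using gen one_R unfolding semi_inv_generator_def inv_SVd_eq by blast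
  then show "in_vars n \<Delta>" "g \<in> G \<Longrightarrow> lsub n (aV g) \<Delta> = Const (\<chi> g) * \<Delta>"
    by (auto simp: semi_inv_SVd_def act_SVd_eq)
qed

lemma semi_invariant:
  assumes "in_vars n p" "\<And>g. g \<in> G \<Longrightarrow> lsub n (aV g) p = Const (\<chi> g) * p"
  obtains q where "q \<in> R" "p = q * \<Delta>"
proof -
  have "p \<in> semi_inv_SVd n G \<chi>" using assms by (simp add: semi_inv_SVd_def act_SVd_eq)
  then show thesis using gen that unfolding semi_inv_generator_def inv_SVd_eq by blast
qed

lemma N_emb:
  assumes "p \<in> R"
  shows "emb (p * \<Delta>) \<in> N"
proof -
  have p: "in_vars n p" "lsub n (aV g) p = p" if "g \<in> G" for g using assms that by (auto simp: inv_ring_def)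
  then have "in_vars n (p * \<Delta>)" using \<Delta>_facts nonempty_G by (auto intro: in_vars_mult)
  then have "emb (p * \<Delta>) \<in> tensor_space n r" by (simp add: tensor_space_iff supp_in_def emb_def)
  moreover have "T g (emb (p * \<Delta>)) = (\<lambda>K. Const (\<chi> g) * emb (p * \<Delta>) K)" if "g \<in> G" for g
    unfolding Tact_emb using p(2)[OF that] \<Delta>_facts(4)[OF that]
    by (auto simp: emb_def lsub_mult mult.left_commute)
  ultimately show ?thesis by (simp add: N_iff)
qed

text \<open>At the empty set the action is that on polynomials, so this coefficient is a
  semi-invariant. Contractions are evaluated there for this reason.\<close>

lemma N_empty:
  assumes "w \<in> N"
  obtains q where "q \<in> R" "w {} = q * \<Delta>"
proof (rule semi_invariant)
  show "in_vars n (w {})" using assms by (simp add: N_iff tensor_space_iff)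
  show "lsub n (aV g) (w {}) = Const (\<chi> g) * w {}" if "g \<in> G" for g
    using assms that Tact_empty[of n r "aV g" "\<lambda>i k. bM' g k i" w] by (simp add: N_iff)
qed (use that in blast)

end

subsection \<open>The basis theorem\<close>

definition mon :: "(nat \<Rightarrow> nat) \<Rightarrow> nat \<Rightarrow>\<^sub>0 nat" where "mon a = Abs_poly_mapping a"

lemma lk_mon: "a \<in> exponents n \<Longrightarrow> lk (mon a) = a"
proof -
  assume a: "a \<in> exponents n"
  have "finite {i. a i \<noteq> 0}"
    by (rule finite_subset[of _ "{..<n}"]) (use a in \<open>auto simp: exponents_def not_less[symmetric]\<close>)
  then show ?thesis by (simp add: mon_def)
qed

lemma keys_mon: "a \<in> exponents n \<Longrightarrow> keys (mon a) \<subseteq> {..<n}"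
  using lk_mon[of a n] by (auto simp: in_keys_iff exponents_def not_less[symmetric])

lemma mon_inj: "a \<in> exponents n \<Longrightarrow> b \<in> exponents n \<Longrightarrow> mon a = mon b \<longleftrightarrow> a = b"
  by (metis lk_mon)

lemma mon_lk: "keys m \<subseteq> {..<n} \<Longrightarrow> lk m \<in> exponents n \<and> mon (lk m) = m"
  by (auto simp: exponents_def mon_def in_keys_iff lookup_inverse)

lemma fmon_ev: "a \<in> exponents n \<Longrightarrow> fmon n f a = ev f (mon a)"
  using ev_superset[OF finite_lessThan keys_mon, where \<sigma> = f] lk_mon[of a n] by (simp add: fmon_def)

lemma psubst_diff: "psubst \<sigma> (p - q) = psubst \<sigma> p - psubst \<sigma> (q :: 'a::comm_ring_1 pm)"
  using psubst_add[of \<sigma> "p - q" q] by (simp add: algebra_simps)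

context invariant_setting
begin

lemma fmon_R: "a \<in> exponents n \<Longrightarrow> fmon n f a \<in> R"
proof -
  assume a: "a \<in> exponents n"
  have "fmon n f a = psubst f (sg (mon a) 1)" by (simp add: fmon_ev[OF a] psubst_single)
  moreover have "in_vars n (sg (mon a) (1::'a))" by (rule in_vars_single[OF keys_mon[OF a]])
  ultimately show ?thesis using basic by (auto simp: basic_invariants_def inv_SVd_eq)
qed

lemma f_indep: "in_vars n Q \<Longrightarrow> psubst f Q = 0 \<Longrightarrow> Q = 0"
  using basic by (auto simp: basic_invariants_def)

lemma R_psubst: "p \<in> R \<longleftrightarrow> (\<exists>Q. in_vars n Q \<and> p = psubst f Q)"
  using basic by (auto simp: basic_invariants_def inv_SVd_eq)

lemma R_mult: "p \<in> R \<Longrightarrow> q \<in> R \<Longrightarrow> p * q \<in> R"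
  by (auto simp: inv_ring_def lsub_mult in_vars_mult)

lemma R_sum: "(\<And>t. t \<in> S \<Longrightarrow> p t \<in> R) \<Longrightarrow> sum p S \<in> R"
  by (auto simp: inv_ring_def lsub_sum intro!: in_vars_sum)

lemma fmon_indep:
  assumes A: "finite A" "A \<subseteq> exponents n" and 0: "(\<Sum>a\<in>A. Const (c a) * fmon n f a) = 0"
  shows "\<forall>a\<in>A. c a = 0"
proof -
  define Q where "Q = (\<Sum>a\<in>A. sg (mon a) (c a))"
  have "psubst f Q = (\<Sum>a\<in>A. Const (c a) * fmon n f a)"
    unfolding Q_def psubst_sum psubst_single using A by (intro sum.cong) (auto simp: fmon_ev)
  moreover have "in_vars n Q" unfolding Q_def using A keys_mon by (intro in_vars_sum in_vars_single) auto
  ultimately have Q: "Q = 0" using f_indep 0 by simp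
  show ?thesis
  proof
    fix a assume a: "a \<in> A"
    have "mon b = mon a \<longleftrightarrow> b = a" if "b \<in> A" for b using mon_inj[of b n a] A a that by auto
    then have "lk Q (mon a) = (\<Sum>b\<in>A. if b = a then c a else 0)"
      unfolding Q_def lookup_sum by (intro sum.cong refl) (simp add: lookup_single when_def)
    then show "c a = 0" using Q a A(1) by simp
  qed
qed

section \<open>Degrees and weights of the homogeneous generators\<close>

definition df :: "nat \<Rightarrow> nat" where "df i = (SOME d. homog_deg d (f i))"
definition eD :: nat where "eD = (SOME d. homog_deg d \<Delta>)"
definition ew :: "nat \<Rightarrow> nat" where "ew i = (SOME d. \<forall>j<r. homog_deg d (\<omega> i j))"
definition et :: "nat \<Rightarrow> nat" where "et i = (SOME d. \<forall>j<r. homog_deg d (\<omega>t i j))"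

lemma df: "i < n \<Longrightarrow> homog_deg (df i) (f i)"
  unfolding df_def using basic by (intro someI_ex[of "\<lambda>d. homog_deg d (f i)"]) (auto simp: basic_invariants_def homogeneous_def)

lemma eD: "homog_deg eD \<Delta>"
  unfolding eD_def using \<Delta>_facts(1) by (intro someI_ex[of "\<lambda>d. homog_deg d \<Delta>"]) (auto simp: homogeneous_def)

lemma ew: "i < r \<Longrightarrow> j < r \<Longrightarrow> homog_deg (ew i) (\<omega> i j)"
proof -
  assume ij: "i < r" "j < r"
  have "\<exists>d. \<forall>j<r. homog_deg d (\<omega> i j)" using basis ij by (auto simp: homog_free_basis_def homogeneous_vec_def)
  from someI_ex[OF this] show ?thesis using ij unfolding ew_def by blast
qed

lemma et: "i < r \<Longrightarrow> j < r \<Longrightarrow> homog_deg (et i) (\<omega>t i j)"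
proof -
  assume ij: "i < r" "j < r"
  have "\<exists>d. \<forall>j<r. homog_deg d (\<omega>t i j)" using dual_basis ij by (auto simp: homog_free_basis_def homogeneous_vec_def)
  from someI_ex[OF this] show ?thesis using ij unfolding et_def by blast
qed

text \<open>A basic invariant of degree 0 would be a constant c, and x_i - c would be an algebraic
  relation. Positive degrees leave finitely many monomials in the f_i of bounded weight.\<close>

lemma df_pos: "i < n \<Longrightarrow> df i \<noteq> 0"
proof
  assume i: "i < n" and 0: "df i = 0"
  have "homog_deg 0 (f i)" using df[OF i] 0 by simp
  then have "lk (f i) m = 0" if "m \<noteq> 0" for m using that by (auto simp: homog_deg_lk mdeg_eq_0_iff)
  then have "f i = Const (lk (f i) 0)" by (intro poly_mapping_eqI) (auto simp: lk_Const when_def)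
  then obtain c where c: "f i = Const c" by blast
  then have "psubst f (Var i - Const c) = 0" by (simp add: psubst_diff)
  from f_indep[OF _ this] have "Var i - Const c = 0" using i by (simp add: in_vars_diff)
  then have "lk (Var i - Const c) (sg i 1) = 0" by simp
  moreover have "sg i 1 \<noteq> (0 :: nat \<Rightarrow>\<^sub>0 nat)" using mdeg_single[of i 1] by (metis mdeg_0 zero_neq_one)
  ultimately show False by (simp add: lookup_minus Var_def lk_Const when_def)
qed

definition wt :: "(nat \<Rightarrow> nat) \<Rightarrow> nat" where "wt a = (\<Sum>i<n. a i * df i)"

lemma homog_fmon: "homog_deg (wt a) (fmon n f a)"
  unfolding wt_def fmon_def by (intro homog_deg_prod homog_deg_power df) auto

lemma finite_wt: "finite {a \<in> exponents n. wt a \<le> D}"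
proof (rule inj_on_finite)
  show "inj_on mon {a \<in> exponents n. wt a \<le> D}" using mon_inj by (auto simp: inj_on_def)
  show "mon ` {a \<in> exponents n. wt a \<le> D} \<subseteq> {m. keys m \<subseteq> {..<n} \<and> mdeg m \<le> D}"
  proof clarify
    fix a assume a: "a \<in> exponents n" "wt a \<le> D"
    have "mdeg (mon a) = sum a {..<n}" using mdeg_superset[OF _ keys_mon[OF a(1)]] lk_mon[OF a(1)] by simp
    also have "\<dots> \<le> wt a" unfolding wt_def
    proof (rule sum_mono)
      fix i assume "i \<in> {..<n}"
      then show "a i \<le> a i * df i" using df_pos[of i] by (cases "df i") auto
    qed
    finally show "keys (mon a) \<subseteq> {..<n} \<and> mdeg (mon a) \<le> D" using a keys_mon by simp
  qed
qed (rule finite_monomials)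

section \<open>Coordinates of semi-invariant forms\<close>

text \<open>For a semi-invariant x, the polynomial Q for which x is Q(f) times
  \<open>\<Delta>\<close>. It is unique because the f_i are algebraically independent and
  \<open>\<Delta>\<close> is nonzero.\<close>

definition cQ :: "'a pm \<Rightarrow> 'a pm" where "cQ x = (SOME Q. in_vars n Q \<and> x = psubst f Q * \<Delta>)"

lemma cQ_eq: "in_vars n Q \<Longrightarrow> cQ (psubst f Q * \<Delta>) = Q"
  unfolding cQ_def
proof (rule some_equality)
  fix Q' assume Q: "in_vars n Q" and Q': "in_vars n Q' \<and> psubst f Q * \<Delta> = psubst f Q' * \<Delta>"
  then have "psubst f Q = psubst f Q'" using \<Delta>_facts(2) by simp
  then have "psubst f (Q' - Q) = 0" by (simp add: psubst_diff)
  from f_indep[OF _ this] have "Q' - Q = 0" using Q Q' by (simp add: in_vars_diff)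
  then show "Q' = Q" by simp
qed simp

lemma cQ:
  assumes "q \<in> R" "x = q * \<Delta>"
  shows "in_vars n (cQ x)" "x = psubst f (cQ x) * \<Delta>"
proof -
  obtain Q where Q: "in_vars n Q" "q = psubst f Q" using assms(1) R_psubst by blast
  then have "cQ x = Q" using cQ_eq assms(2) by simp
  then show "in_vars n (cQ x)" "x = psubst f (cQ x) * \<Delta>" using Q assms(2) by simp_all
qed

lemma cQ_sum:
  assumes "\<And>t. t \<in> S \<Longrightarrow> \<exists>q\<in>R. x t = q * \<Delta>"
  shows "cQ (\<Sum>t\<in>S. Const (c t) * x t) = (\<Sum>t\<in>S. Const (c t) * cQ (x t))"
proof -
  have x: "in_vars n (cQ (x t))" "x t = psubst f (cQ (x t)) * \<Delta>" if "t \<in> S" for t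
    using assms[OF that] cQ by auto
  have "(\<Sum>t\<in>S. Const (c t) * x t) = psubst f (\<Sum>t\<in>S. Const (c t) * cQ (x t)) * \<Delta>"
    unfolding psubst_sum sum_distrib_right using x(2) by (intro sum.cong) (auto simp: psubst_mult mult.assoc)
  then show ?thesis using x(1) by (simp add: cQ_eq in_vars_sum in_vars_mult)
qed

text \<open>Different weights land in different degrees, so the part of \<open>Q\<close> of weight
  \<open>wt a\<close> gives exactly the component of degree \<open>wt a + eD\<close>. Beyond
  \<open>D\<close> that component is zero, and independence of the f_i kills that part of
  \<open>Q\<close>.\<close>

lemma cQ_deg:
  assumes Q: "in_vars n Q" and d: "deg_le D (psubst f Q * \<Delta>)" and a: "a \<in> exponents n" "lk Q (mon a) \<noteq> 0"
  shows "wt a + eD \<le> D"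
proof (rule ccontr)
  assume *: "\<not> wt a + eD \<le> D"
  define S where "S = {m \<in> keys Q. wt (lk m) = wt a}"
  define Q' where "Q' = (\<Sum>m\<in>S. sg m (lk Q m))"
  have m: "lk m \<in> exponents n" "mon (lk m) = m" "homog_deg (wt (lk m)) (ev f m)" if "m \<in> keys Q" for m
  proof -
    have "keys m \<subseteq> {..<n}" using that Q by (auto simp: in_vars_def)
    from mon_lk[OF this] show "lk m \<in> exponents n" "mon (lk m) = m" by auto
    then show "homog_deg (wt (lk m)) (ev f m)" using homog_fmon[of "lk m"] fmon_ev[of "lk m" n f] by simp
  qed
  have "hcomp (wt a + eD) (psubst f Q * \<Delta>) = hcomp (wt a + eD) (\<Sum>m\<in>keys Q. Const (lk Q m) * ev f m * \<Delta>)"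
    by (simp add: psubst_superset[of "keys Q"] sum_distrib_right)
  also have "\<dots> = (\<Sum>m\<in>keys Q. if wt (lk m) = wt a then Const (lk Q m) * ev f m * \<Delta> else 0)"
    unfolding hcomp_sum
  proof (rule sum.cong[OF refl])
    fix m' assume "m' \<in> keys Q"
    then have "homog_deg (wt (lk m') + eD) (Const (lk Q m') * ev f m' * \<Delta>)"
      by (intro homog_deg_mult homog_deg_Const_mult m(3) eD)
    then show "hcomp (wt a + eD) (Const (lk Q m') * ev f m' * \<Delta>) =
        (if wt (lk m') = wt a then Const (lk Q m') * ev f m' * \<Delta> else 0)"
      by (auto simp: hcomp_homog)
  qed
  also have "\<dots> = psubst f Q' * \<Delta>"
    unfolding Q'_def S_def psubst_sum psubst_single sum_distrib_right by (simp add: sum.inter_filter)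
  finally have "hcomp (wt a + eD) (psubst f Q * \<Delta>) = psubst f Q' * \<Delta>" .
  moreover have "hcomp (wt a + eD) (psubst f Q * \<Delta>) = 0"
    using d * by (intro poly_mapping_eqI) (auto simp: lk_hcomp deg_le_def)
  ultimately have "psubst f Q' = 0" using \<Delta>_facts(2) by simp
  moreover have "in_vars n Q'" using Q unfolding Q'_def S_def by (intro in_vars_sum in_vars_single) (auto simp: in_vars_def)
  ultimately have "Q' = 0" by (rule f_indep[rotated])
  moreover have "lk Q' (mon a) = lk Q (mon a)"
  proof -
    have "mon a \<in> S" using a lk_mon[OF a(1)] by (simp add: S_def in_keys_iff)
    moreover have "finite S" by (simp add: S_def)
    moreover have "lk Q' (mon a) = (\<Sum>m\<in>S. if m = mon a then lk Q (mon a) else 0)"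
      unfolding Q'_def lookup_sum by (intro sum.cong) (auto simp: lookup_single when_def)
    ultimately show ?thesis by simp
  qed
  ultimately show False using a(2) by simp
qed

interpretation I: anticommuting "iot r \<omega>" by (rule anticommuting_iot)
interpretation D: anticommuting "dst r \<omega>t" by (rule anticommuting_dst)
interpretation dual: dual_rep n r G "(*)" aV' aV bM' bM
  by (rule dual_rep_swap) (rule dual_rep_axioms)

text \<open>Contraction with the ordered product of the \<open>\<omega> i\<close> for
  \<open>i\<close> in \<open>L\<close>. Evaluation at the empty set retains only the part of
  exterior degree \<open>card L\<close>. It is distinct from the coefficient map of
  \<open>subfield_hom\<close>.\<close>

definition Phi :: "nat set \<Rightarrow> (nat set \<Rightarrow> 'a pm) \<Rightarrow> 'a pm" where "Phi L w = I.opseq L w {}"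

lemma finite_Pow_r: "L \<in> Pow {..<r} \<Longrightarrow> finite L" by (auto intro: finite_subset)

lemma Phi_N:
  assumes "w \<in> N" "L \<in> Pow {..<r}"
  shows "\<exists>q\<in>R. Phi L w = q * \<Delta>"
proof -
  have "I.opseq L w \<in> N" using assms N_iot finite_Pow_r
    by (intro I.opseq_invariant[where P = "\<lambda>v. v \<in> N"]) auto
  then obtain q where "q \<in> R" "I.opseq L w {} = q * \<Delta>" by (rule N_empty)
  then show ?thesis unfolding Phi_def by blast
qed

lemma Phi_sum: "Phi L (\<lambda>K. \<Sum>t\<in>S. p t * w t K) = (\<Sum>t\<in>S. p t * Phi L (w t))"
  unfolding Phi_def I.opseq_def by (subst foldr_sum) (auto simp: iot_sum)

lemma Phi_diff: "Phi L (\<lambda>K. v K - w K) = Phi L v - Phi L w"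
  using Phi_sum[of L "\<lambda>b. if b then Const 1 else Const (- 1)" "\<lambda>b. if b then v else w" "{True, False}"]
  by (simp add: Const_uminus)

lemma J_nonzero: "jacobian r \<omega> \<noteq> 0" using dvd \<Delta>_facts(2) by auto

lemma Phi_injective:
  assumes w: "w \<in> N" and 0: "\<And>L. L \<in> Pow {..<r} \<Longrightarrow> Phi L w = 0"
  shows "w = (\<lambda>K. 0)"
proof (rule iot_foldr_eq_0_imp[OF J_nonzero])
  show "supp_in r w" using w by (simp add: N_iff tensor_space_iff)
  fix l assume l: "set l \<subseteq> {..<r}"
  obtain c where "foldr (iot r \<omega>) l w = (\<lambda>K. Const c * I.opseq (set l) w K)" using I.foldr_op_eq by blast
  then show "foldr (iot r \<omega>) l w {} = 0" using 0[of "set l"] l by (simp add: Phi_def)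
qed

lemma Phi_deg:
  assumes "\<And>K. deg_le D (w K)" "L \<in> Pow {..<r}"
  shows "deg_le (D + sum ew L) (Phi L w)"
  unfolding Phi_def I.opseq_def
  using deg_le_foldr_iot[where r = r and v = \<omega> and e = ew and xs = "sorted_list_of_set L" and K = "{}" and w = w, OF assms(1) ew]
    assms(2) finite_Pow_r[OF assms(2)]
  by simp

text \<open>The coordinate of \<open>w\<close> at \<open>(a, L)\<close>: the coefficient of the
  monomial with exponents \<open>a\<close> in the f_i, in the quotient of \<open>Phi L w\<close> by
  \<open>\<Delta>\<close>.\<close>

definition Psi :: "(nat \<Rightarrow> nat) \<times> nat set \<Rightarrow> (nat set \<Rightarrow> 'a pm) \<Rightarrow> 'a" where
  "Psi s w = lk (cQ (Phi (snd s) w)) (mon (fst s))"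

text \<open>The coordinates that a form of degree at most \<open>D\<close> can have, since
  contraction raises the degree by at most \<open>sum ew L\<close>. Likewise \<open>Tidx D\<close>
  lists the family members whose degree \<open>wt a + eD - sum et L\<close> is at most
  \<open>D\<close>.\<close>

definition Sidx :: "nat \<Rightarrow> ((nat \<Rightarrow> nat) \<times> nat set) set" where
  "Sidx D = {(a, L). a \<in> exponents n \<and> L \<in> Pow {..<r} \<and> wt a + eD \<le> D + sum ew L}"
definition Tidx :: "nat \<Rightarrow> ((nat \<Rightarrow> nat) \<times> nat set) set" where
  "Tidx D = {(a, L). a \<in> exponents n \<and> L \<in> Pow {..<r} \<and> wt a + eD \<le> D + sum et L}"

lemma finite_idx: "finite {(a, L). a \<in> exponents n \<and> L \<in> Pow {..<r} \<and> wt a + eD \<le> D + sum e L}"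
proof (rule finite_subset)
  show "{(a, L). a \<in> exponents n \<and> L \<in> Pow {..<r} \<and> wt a + eD \<le> D + sum e L} \<subseteq>
     {a \<in> exponents n. wt a \<le> D + sum e {..<r}} \<times> Pow {..<r}"
  proof clarsimp
    fix a L assume "L \<subseteq> {..<r}" "wt a + eD \<le> D + sum e L"
    moreover from this(1) have "sum e L \<le> sum e {..<r}" by (intro sum_mono2) auto
    ultimately show "wt a \<le> D + sum e {..<r}" by simp
  qed
qed (use finite_wt in blast)

lemma finite_Sidx: "finite (Sidx D)" and finite_Tidx: "finite (Tidx D)"
  unfolding Sidx_def Tidx_def by (rule finite_idx)+

text \<open>There are as many coordinates as family members of bounded degree because \<open>\<omega>\<close> and \<open>\<omega>t\<close> have the
  same degrees.\<close>

lemma card_idx: "card (Sidx D) = card (Tidx D)"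
proof -
  obtain p where p: "p permutes {..<r}" "\<And>i. i < r \<Longrightarrow> ew i = et (p i)"
  proof (rule degrees_permute[of \<omega> ew \<omega>t et])
    show "\<exists>!q. (\<forall>i<r. q i \<in> R) \<and> (\<forall>i\<ge>r. q i = 0) \<and> (\<forall>j<r. w j = (\<Sum>i<r. q i * \<omega> i j))" if "w \<in> X" for w
      using basis that by (simp add: homog_free_basis_def inv_SVd_eq inv_SVd_M_eq)
    show "\<exists>!q. (\<forall>i<r. q i \<in> R') \<and> (\<forall>i\<ge>r. q i = 0) \<and> (\<forall>j<r. w j = (\<Sum>i<r. q i * \<omega>t i j))" if "w \<in> X'" for w
      using dual_basis that by (simp add: homog_free_basis_def inv_SV_eq inv_SV_Mdual_eq)
  qed (use \<omega>_X \<omega>t_X' ew et in auto)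
  have inj: "inj p" using p(1) by (rule permutes_inj)
  have sum: "sum et (p ` L) = sum ew L" if "L \<subseteq> {..<r}" for L
  proof -
    have "sum et (p ` L) = (\<Sum>i\<in>L. et (p i))" using inj by (subst sum.reindex) (auto intro: inj_on_subset)
    also have "\<dots> = sum ew L" by (rule sum.cong[OF refl]) (use p(2) that in auto)
    finally show ?thesis .
  qed
  have img: "p ` L \<subseteq> {..<r} \<longleftrightarrow> L \<subseteq> {..<r}" for L
    using permutes_in_image[OF p(1)] by blast
  have "bij_betw (\<lambda>(a, L). (a, p ` L)) (Sidx D) (Tidx D)"
  proof (rule bij_betwI[of _ _ _ "\<lambda>(a, L). (a, inv_into UNIV p ` L)"])
    have pinv: "p ` inv_into UNIV p ` L = L" for L
      using surj_f_inv_f[OF permutes_surj[OF p(1)]] by (auto simp: image_image)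
    show "(\<lambda>(a, L). (a, p ` L)) \<in> Sidx D \<rightarrow> Tidx D"
      using sum img by (auto simp: Sidx_def Tidx_def)
    show "(\<lambda>(a, L). (a, inv_into UNIV p ` L)) \<in> Tidx D \<rightarrow> Sidx D"
    proof
      fix t assume "t \<in> Tidx D"
      then obtain a L where t: "t = (a, L)" "a \<in> exponents n" "L \<subseteq> {..<r}" "wt a + eD \<le> D + sum et L"
        by (auto simp: Tidx_def)
      have "inv_into UNIV p ` L \<subseteq> {..<r}" using img[of "inv_into UNIV p ` L"] pinv t by simp
      then show "(case t of (a, L) \<Rightarrow> (a, inv_into UNIV p ` L)) \<in> Sidx D"
        using t sum[of "inv_into UNIV p ` L"] pinv by (simp add: Sidx_def)
    qed
    show "(case case x of (a, L) \<Rightarrow> (a, p ` L) of (a, L) \<Rightarrow> (a, inv_into UNIV p ` L)) = x" for x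
      using inj by (auto simp: image_image split: prod.split)
    show "(case case y of (a, L) \<Rightarrow> (a, inv_into UNIV p ` L) of (a, L) \<Rightarrow> (a, p ` L)) = y" for y
      using pinv by (auto split: prod.split)
  qed
  then show ?thesis by (rule bij_betw_same_card)
qed

lemma Psi_sum:
  assumes "\<And>t. t \<in> S \<Longrightarrow> w t \<in> N" "snd s \<in> Pow {..<r}"
  shows "Psi s (\<lambda>K. \<Sum>t\<in>S. Const (c t) * w t K) = (\<Sum>t\<in>S. c t * Psi s (w t))"
  unfolding Psi_def Phi_sum using assms Phi_N by (subst cQ_sum) (auto simp: lookup_sum)

lemma Psi_0:
  assumes w: "w \<in> N" "\<And>K. deg_le D (w K)" and s: "fst s \<in> exponents n" "snd s \<in> Pow {..<r}" "s \<notin> Sidx D"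
  shows "Psi s w = 0"
proof (rule ccontr)
  assume *: "Psi s w \<noteq> 0"
  obtain q where q: "q \<in> R" "Phi (snd s) w = q * \<Delta>" using Phi_N[OF w(1) s(2)] by blast
  note c = cQ[OF q]
  have "deg_le (D + sum ew (snd s)) (psubst f (cQ (Phi (snd s) w)) * \<Delta>)"
    using Phi_deg[OF w(2) s(2)] c(2) by simp
  from cQ_deg[OF c(1) this s(1)] * have "wt (fst s) + eD \<le> D + sum ew (snd s)" by (simp add: Psi_def)
  then show False using s by (auto simp: Sidx_def)
qed

lemma Phi_from_Psi:
  assumes w: "w \<in> N" and L: "L \<in> Pow {..<r}" and Q: "in_vars n Q"
    and eq: "\<And>a. a \<in> exponents n \<Longrightarrow> Psi (a, L) w = lk Q (mon a)"
  shows "Phi L w = psubst f Q * \<Delta>"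
proof -
  obtain q where q: "q \<in> R" "Phi L w = q * \<Delta>" using Phi_N[OF w L] by blast
  note c = cQ[OF q]
  have "cQ (Phi L w) = Q"
  proof (rule poly_mapping_eqI)
    fix m
    show "lk (cQ (Phi L w)) m = lk Q m"
    proof (cases "keys m \<subseteq> {..<n}")
      case True
      then show ?thesis using eq[of "lk m"] mon_lk[OF True] by (simp add: Psi_def)
    next
      case False
      then have "m \<notin> keys Q" "m \<notin> keys (cQ (Phi L w))" using Q c(1) by (auto simp: in_vars_def)
      then show ?thesis by (simp add: in_keys_iff)
    qed
  qed
  then show ?thesis using c(2) by simp
qed

lemma Psi_injective:
  assumes w: "w \<in> N" "\<And>K. deg_le D (w K)" and 0: "\<And>s. s \<in> Sidx D \<Longrightarrow> Psi s w = 0"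
  shows "w = (\<lambda>K. 0)"
proof (rule Phi_injective[OF w(1)])
  fix L assume L: "L \<in> Pow {..<r}"
  have "Psi (a, L) w = 0" if "a \<in> exponents n" for a
    using 0[of "(a, L)"] Psi_0[OF w, of "(a, L)"] that L by (cases "(a, L) \<in> Sidx D") auto
  then show "Phi L w = 0" using Phi_from_Psi[OF w(1) L, of 0] by simp
qed

text \<open>What the count needs of a family: membership in \<open>N\<close>, the exact degree of
  each member, and linear independence.\<close>

definition indep_family :: "((nat \<Rightarrow> nat) \<times> nat set \<Rightarrow> nat set \<Rightarrow> 'a pm) \<Rightarrow> bool" where
  "indep_family B \<longleftrightarrow> (\<forall>t\<in>exponents n \<times> Pow {..<r}. B t \<in> N \<and> (\<forall>K m. lk (B t K) m \<noteq> 0 \<longrightarrow> mdeg m + sum et (snd t) = wt (fst t) + eD)) \<and>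
     (\<forall>S c. finite S \<and> S \<subseteq> exponents n \<times> Pow {..<r} \<and> (\<lambda>K. \<Sum>t\<in>S. Const (c t) * B t K) = (\<lambda>K. 0) \<longrightarrow> (\<forall>t\<in>S. c t = 0))"

lemma indep_familyD:
  assumes "indep_family B"
  shows "t \<in> exponents n \<times> Pow {..<r} \<Longrightarrow> B t \<in> N"
    "t \<in> exponents n \<times> Pow {..<r} \<Longrightarrow> lk (B t K) m \<noteq> 0 \<Longrightarrow> mdeg m + sum et (snd t) = wt (fst t) + eD"
    "finite S \<Longrightarrow> S \<subseteq> exponents n \<times> Pow {..<r} \<Longrightarrow> (\<lambda>K. \<Sum>t\<in>S. Const (c t) * B t K) = (\<lambda>K. 0) \<Longrightarrow> \<forall>t\<in>S. c t = 0"
proof -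
  note h = assms[unfolded indep_family_def]
  show "B t \<in> N" if "t \<in> exponents n \<times> Pow {..<r}" using bspec[OF conjunct1[OF h] that] by (rule conjunct1)
  show "mdeg m + sum et (snd t) = wt (fst t) + eD" if "t \<in> exponents n \<times> Pow {..<r}" "lk (B t K) m \<noteq> 0"
    using conjunct2[OF bspec[OF conjunct1[OF h] that(1)]] that(2) by blast
  show "\<forall>t\<in>S. c t = 0" if "finite S" "S \<subseteq> exponents n \<times> Pow {..<r}" "(\<lambda>K. \<Sum>t\<in>S. Const (c t) * B t K) = (\<lambda>K. 0)"
    using mp[OF spec[OF spec[OF conjunct2[OF h], of S], of c]] that by blast
qed

text \<open>Members of degree at most \<open>D\<close> are as many as the coordinates in
  \<open>Sidx D\<close>. Independence and the injectivity of the coordinates make the kernel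
  trivial, so every prescription of coordinates is attained.\<close>

lemma indep_family_solve:
  assumes B: "indep_family B"
  shows "\<exists>c. \<forall>s\<in>Sidx D. Psi s (\<lambda>K. \<Sum>t\<in>Tidx D. Const (c t) * B t K) = y s"
    "(\<lambda>K. \<Sum>t\<in>Tidx D. Const (c t) * B t K) \<in> N" "deg_le D (\<Sum>t\<in>Tidx D. Const (c t) * B t K)"
proof -
  have sub: "Tidx D \<subseteq> exponents n \<times> Pow {..<r}" by (auto simp: Tidx_def)
  have BN: "B t \<in> N" if "t \<in> Tidx D" for t using indep_familyD(1)[OF B] that sub by blast
  have Bd: "deg_le D (B t K)" if "t \<in> Tidx D" for t K
    unfolding deg_le_def
  proof (intro allI impI)
    fix m assume "lk (B t K) m \<noteq> 0"
    then have "mdeg m + sum et (snd t) = wt (fst t) + eD" using indep_familyD(2)[OF B] that sub by blast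
    then show "mdeg m \<le> D" using that by (auto simp: Tidx_def)
  qed
  show N: "(\<lambda>K. \<Sum>t\<in>Tidx D. Const (c t) * B t K) \<in> N" for c
    using BN by (intro N_sum finite_Tidx) auto
  show d: "deg_le D (\<Sum>t\<in>Tidx D. Const (c t) * B t K)" for c K
    using Bd by (intro deg_le_sum deg_le_Const_mult) auto
  have s: "Psi s (\<lambda>K. \<Sum>t\<in>Tidx D. Const (c t) * B t K) = (\<Sum>t\<in>Tidx D. c t * Psi s (B t))" if "s \<in> Sidx D" for s c
    using BN that by (intro Psi_sum) (auto simp: Sidx_def)
  have "\<exists>c. \<forall>s\<in>Sidx D. (\<Sum>t\<in>Tidx D. c t * Psi s (B t)) = y s"
  proof (rule square_system_solvable[OF finite_Sidx finite_Tidx])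
    show "card (Sidx D) \<le> card (Tidx D)" by (simp add: card_idx)
    fix c assume "\<And>s. s \<in> Sidx D \<Longrightarrow> (\<Sum>t\<in>Tidx D. c t * Psi s (B t)) = 0"
    then have "(\<lambda>K. \<Sum>t\<in>Tidx D. Const (c t) * B t K) = (\<lambda>K. 0)" using N d s by (intro Psi_injective[of _ D]) auto
    then show "\<forall>t\<in>Tidx D. c t = 0" by (rule indep_familyD(3)[OF B finite_Tidx sub])
  qed
  then show "\<exists>c. \<forall>s\<in>Sidx D. Psi s (\<lambda>K. \<Sum>t\<in>Tidx D. Const (c t) * B t K) = y s" using s by simp
qed

lemma N_deg_le:
  assumes "w \<in> N" shows "\<exists>D. \<forall>K. deg_le D (w K)"
proof -
  have "\<exists>D. \<forall>m\<in>keys (w K). mdeg m < D" for K by (rule mdeg_bound)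
  then obtain D where D: "\<And>K m. m \<in> keys (w K) \<Longrightarrow> mdeg m < D K" by metis
  have "deg_le (\<Sum>K\<in>Pow {..<r}. D K) (w K)" for K
  proof (cases "K \<in> Pow {..<r}")
    case True
    then have "D K \<le> (\<Sum>K\<in>Pow {..<r}. D K)" by (intro member_le_sum) auto
    then show ?thesis using D[of _ K] unfolding deg_le_def by (force simp: in_keys_iff)
  next
    case False
    then have "w K = 0" using assms by (auto simp: N_iff tensor_space_iff supp_in_def)
    then show ?thesis by (simp add: deg_le_def)
  qed
  then show ?thesis by blast
qed

text \<open>For spanning, the combination with the same coordinates as \<open>w\<close> is formed
  within the degree bound of \<open>w\<close>; injectivity of the coordinates makes it equal to
  \<open>w\<close>.\<close>

lemma indep_family_F_basis:
  assumes B: "indep_family B"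
  shows "F_basis N (exponents n \<times> Pow {..<r}) B"
  unfolding F_basis_def
proof (intro conjI)
  show "B ` (exponents n \<times> Pow {..<r}) \<subseteq> N" using B unfolding indep_family_def by blast
  show indep: "\<forall>T c. finite T \<and> T \<subseteq> exponents n \<times> Pow {..<r} \<and> (\<lambda>K. \<Sum>t\<in>T. Const (c t) * B t K) = (\<lambda>K. 0)
              \<longrightarrow> (\<forall>t\<in>T. c t = 0)" using B unfolding indep_family_def by blast
  show "inj_on B (exponents n \<times> Pow {..<r})"
  proof (rule inj_onI, rule ccontr)
    fix s t assume st: "s \<in> exponents n \<times> Pow {..<r}" "t \<in> exponents n \<times> Pow {..<r}" "B s = B t" "s \<noteq> t"
    have "(\<lambda>K. \<Sum>x\<in>{s, t}. Const (if x = s then 1 else - 1) * B x K) = (\<lambda>K. 0)"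
      using st by (auto simp: Const_uminus)
    from indep_familyD(3)[OF B _ _ this] have "\<forall>x\<in>{s, t}. (if x = s then 1 else - 1 :: 'a) = 0"
      using st by simp
    then show False by simp
  qed
  show "\<forall>w\<in>N. \<exists>T c. finite T \<and> T \<subseteq> exponents n \<times> Pow {..<r} \<and> w = (\<lambda>K. \<Sum>t\<in>T. Const (c t) * B t K)"
  proof
    fix w assume w: "w \<in> N"
    obtain D where D: "\<And>K. deg_le D (w K)" using N_deg_le[OF w] by blast
    obtain c where c: "\<And>s. s \<in> Sidx D \<Longrightarrow> Psi s (\<lambda>K. \<Sum>t\<in>Tidx D. Const (c t) * B t K) = Psi s w"
      using indep_family_solve(1)[OF B, where D = D and y = "\<lambda>s. Psi s w"] by blast
    define v where "v K = (\<Sum>t\<in>Tidx D. Const (c t) * B t K)" for K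
    have v: "v \<in> N" "deg_le D (v K)" for K
      using indep_family_solve(2,3)[OF B, where D = D and c = c] by (simp_all add: v_def[abs_def])
    have vw: "(\<lambda>K. v K - w K) = (\<lambda>K. \<Sum>b\<in>{True, False}. Const (if b then 1 else - 1) * (if b then v else w) K)"
      by (simp add: Const_uminus)
    have "(\<lambda>K. v K - w K) = (\<lambda>K. 0)"
    proof (rule Psi_injective)
      show "(\<lambda>K. v K - w K) \<in> N" using v(1) w by (rule N_diff)
      show "deg_le D (v K - w K)" for K using v(2)[of K] D[of K] unfolding deg_le_def
        by (metis diff_self lookup_minus)
      fix s assume s: "s \<in> Sidx D"
      have "Psi s (\<lambda>K. v K - w K) = (\<Sum>b\<in>{True, False}. (if b then 1 else - 1) * Psi s (if b then v else w))"
        unfolding vw by (rule Psi_sum) (use v w s in \<open>auto simp: Sidx_def\<close>)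
      then show "Psi s (\<lambda>K. v K - w K) = 0" using c[OF s] by (simp add: v_def[abs_def])
    qed
    then have "w = (\<lambda>K. \<Sum>t\<in>Tidx D. Const (c t) * B t K)" by (auto simp: v_def fun_eq_iff)
    then show "\<exists>T c. finite T \<and> T \<subseteq> exponents n \<times> Pow {..<r} \<and> w = (\<lambda>K. \<Sum>t\<in>T. Const (c t) * B t K)"
      using finite_Tidx[of D] by (intro exI[of _ "Tidx D"] exI[of _ c]) (auto simp: Tidx_def)
  qed
qed

text \<open>The dual system for the contractions: with it, a form is recovered from its values under
  \<open>Phi\<close> with invariant coefficients.\<close>

lemma indep_family_dual:
  assumes B: "indep_family B" and L: "L \<in> Pow {..<r}"
  shows "\<exists>v\<in>N. \<forall>L'\<in>Pow {..<r}. Phi L' v = (if L' = L then \<Delta> else 0)"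
proof -
  define z where "z = ((\<lambda>_. 0) :: nat \<Rightarrow> nat)"
  have z: "z \<in> exponents n" "mon z = 0" by (auto simp: z_def exponents_def mon_def)
  obtain c where c: "\<And>s. s \<in> Sidx eD \<Longrightarrow> Psi s (\<lambda>K. \<Sum>t\<in>Tidx eD. Const (c t) * B t K) = (if s = (z, L) then 1 else 0)"
    using indep_family_solve(1)[OF B, where D = eD and y = "\<lambda>s. if s = (z, L) then 1 else 0"] by blast
  define v where "v K = (\<Sum>t\<in>Tidx eD. Const (c t) * B t K)" for K
  have v: "v \<in> N" "deg_le eD (v K)" for K
    using indep_family_solve(2,3)[OF B, where D = eD and c = c] by (simp_all add: v_def[abs_def])
  have "Phi L' v = psubst f (if L' = L then 1 else 0) * \<Delta>" if L': "L' \<in> Pow {..<r}" for L'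
  proof (rule Phi_from_Psi[OF v(1) L'])
    show "in_vars n (if L' = L then 1 else 0 :: 'a pm)" by simp
    fix a assume a: "a \<in> exponents n"
    have m: "mon a = 0 \<longleftrightarrow> a = z" using mon_inj[OF a z(1)] z(2) by simp
    \<comment> \<open>The weight of \<open>z\<close> is 0, so the one nonzero prescribed coordinate
      lies within the bound \<open>eD\<close>; outside \<open>Sidx eD\<close> the coordinates of
      \<open>v\<close> vanish, as prescribed.\<close>
    have zS: "(z, L) \<in> Sidx eD" using z L by (auto simp: Sidx_def wt_def z_def)
    show "Psi (a, L') v = lk (if L' = L then 1 else 0) (mon a)"
    proof (cases "(a, L') \<in> Sidx eD")
      case True
      then show ?thesis using c[OF True] m by (auto simp: v_def[abs_def] lookup_one when_def)
    next
      case False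
      then show ?thesis using Psi_0[OF v, of "(a, L')"] a L' zS m by (auto simp: lookup_one when_def)
    qed
  qed
  then show ?thesis using v(1) by (intro bexI[of _ v]) auto
qed

end

section \<open>Linear independence of the two families\<close>

context invariant_setting
begin

interpretation I: anticommuting "iot r \<omega>" by (rule anticommuting_iot)
interpretation D: anticommuting "dst r \<omega>t" by (rule anticommuting_dst)
interpretation dual: dual_rep n r G "(*)" aV' aV bM' bM
  by (rule dual_rep_swap) (rule dual_rep_axioms)

text \<open>Rows in \<open>X'\<close> are combinations of the \<open>\<omega>t\<close> with
  invariant coefficients, and determinants multiply.\<close>

lemma jacobian_dual_factor:
  assumes "\<And>i. i < r \<Longrightarrow> \<tau> i \<in> X'"
  shows "\<exists>q. jacobian r \<tau> = q * jacobian r \<omega>t"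
proof -
  have "\<exists>q. \<forall>j<r. \<tau> i j = (\<Sum>l<r. q l * \<omega>t l j)" if "i < r" for i
    using dual_basis assms[OF that] unfolding homog_free_basis_def inv_SV_Mdual_eq by blast
  then obtain q where q: "\<And>i j. i < r \<Longrightarrow> j < r \<Longrightarrow> \<tau> i j = (\<Sum>l<r. q i l * \<omega>t l j)" by metis
  have "jacobian r \<tau> = jacobian r (\<lambda>i j. \<Sum>l<r. q i l * \<omega>t l j)" by (rule jacobian_cong) (rule q)
  also have "\<dots> = jacobian r q * jacobian r \<omega>t" by (rule jacobian_row_mult)
  finally show ?thesis by blast
qed

text \<open>Differentiating by the dual Jacobian is adjoint to multiplying by the (conjugate of the) Jacobian,
  which divides every semi-invariant.\<close>

lemma dual_jacobian_injective:
  assumes p: "p \<in> R" and 0: "diff_op (jacobian r \<omega>t) (p * \<Delta>) = 0"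
  shows "p = 0"
proof -
  obtain k where k: "\<Delta> = jacobian r \<omega> * k" using dvd by (auto elim: dvdE)
  have "p * \<Delta> = 0"
  proof (rule jacobian_positivity[where J = "{()}" and \<omega> = "\<lambda>_. \<omega>" and s = "\<lambda>_. p * k" and e = "\<lambda>_. ew"])
    show "in_vars n (p * \<Delta>)" using p \<Delta>_facts(3) by (auto simp: inv_ring_def intro: in_vars_mult)
    show "p * \<Delta> = (\<Sum>t\<in>{()}. jacobian r \<omega> * (p * k))" by (simp add: k mult_ac)
    fix \<tau> assume "\<And>i. i < r \<Longrightarrow> \<tau> i \<in> X'"
    then obtain q where "jacobian r \<tau> = q * jacobian r \<omega>t" using jacobian_dual_factor by blast
    then show "diff_op (jacobian r \<tau>) (p * \<Delta>) = 0" using 0 by (simp add: diff_op_mult)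
  qed (use \<omega>_X ew in auto)
  then show ?thesis using \<Delta>_facts(2) by simp
qed

lemma jacobian_1: "jacobian 1 w = w 0 0"
  unfolding jacobian_def by (subst det_single) auto

text \<open>For the trivial representation a Jacobian is a single invariant, so
  \<open>jacobian_positivity\<close>, with one summand per generator \<open>p t\<close>, applies.
  Only dual invariants of the degrees \<open>h t\<close> need to annihilate
  \<open>u\<close>.\<close>

lemma harmonic_ideal:
  assumes u: "in_vars n u" "finite S" "u = (\<Sum>t\<in>S. p t * s t)"
    and p: "\<And>t. t \<in> S \<Longrightarrow> p t \<in> R" "\<And>t. t \<in> S \<Longrightarrow> homog_deg (h t) (p t)"
    and 0: "\<And>t q. t \<in> S \<Longrightarrow> q \<in> R' \<Longrightarrow> homog_deg (h t) q \<Longrightarrow> diff_op q u = 0"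
  shows "u = 0"
proof -
  interpret triv: dual_rep n 1 G "(*)" aV aV' "\<lambda>_ _ _. 1" "\<lambda>_ _ _. 1"
    by (rule dual_rep_trivial) (rule dual_rep_axioms)
  show ?thesis
  proof (rule triv.jacobian_positivity[where J = S and \<omega> = "\<lambda>t i j. if j = 0 then p t else 0" and s = s and e = "\<lambda>t _. h t"])
    show "u = (\<Sum>t\<in>S. jacobian 1 (\<lambda>i j. if j = 0 then p t else 0) * s t)" unfolding jacobian_1 using u(3) by simp
    show "(\<lambda>j. if j = 0 then p t else 0) \<in> triv.X" if "t \<in> S" for t
      using p(1)[OF that] equivariant_vecs_trivial by blast
    show "homog_deg (h t) (if j = 0 then p t else 0)" if "t \<in> S" for t and j :: nat using p(2)[OF that] by simp
    show "diff_op (jacobian 1 \<tau>) u = 0" if "t \<in> S" "\<And>i. i < 1 \<Longrightarrow> \<tau> i \<in> triv.X'" "\<And>i j. i < 1 \<Longrightarrow> j < 1 \<Longrightarrow> homog_deg (h t) (\<tau> i j)" for t \<tau>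
      unfolding jacobian_1 using that equivariant_vecs_trivial_D[of "\<tau> 0" n G aV'] by (intro 0[of t]) auto
  qed (use u in auto)
qed

abbreviation "dI I \<equiv> D.opseq I"

lemma dI_sum: "dI I (\<lambda>K. \<Sum>t\<in>S. Const (c t) * w t K) = (\<lambda>K. \<Sum>t\<in>S. Const (c t) * dI I (w t) K)"
  unfolding D.opseq_def by (rule foldr_sum) (rule dst_sum)

lemma dI_N: "w \<in> N \<Longrightarrow> I \<in> Pow {..<r} \<Longrightarrow> dI I w \<in> N"
  using N_dst finite_Pow_r by (intro D.opseq_invariant[where P = "\<lambda>v. v \<in> N"]) auto

lemma emb_sum: "emb (\<Sum>t\<in>S. Const (c t) * p t) = (\<lambda>K. \<Sum>t\<in>S. Const (c t) * emb (p t) K)"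
  by (auto simp: emb_def)

lemma dI_0: "dI I (emb 0) = (\<lambda>K. 0)"
  using dI_sum[of I "\<lambda>_. 0" "\<lambda>_. emb 0" "{}::nat set"] by (simp add: emb_def cong: if_cong)

text \<open>Applying the operators of the complement of a minimal index set isolates one term.\<close>

lemma dI_independent:
  assumes p: "\<And>I. I \<in> Pow {..<r} \<Longrightarrow> p I \<in> R"
    and 0: "(\<lambda>K. \<Sum>I\<in>Pow {..<r}. dI I (emb (p I * \<Delta>)) K) = (\<lambda>K. 0)"
  shows "\<forall>I\<in>Pow {..<r}. p I = 0"
proof (rule ccontr)
  assume "\<not> (\<forall>I\<in>Pow {..<r}. p I = 0)"
  then obtain I1 where "I1 \<in> Pow {..<r} \<and> p I1 \<noteq> 0" by blast
  from ex_has_least_nat[of "\<lambda>I. I \<in> Pow {..<r} \<and> p I \<noteq> 0" I1 card, OF this]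
  obtain I0 where least: "(I0 \<in> Pow {..<r} \<and> p I0 \<noteq> 0) \<and> (\<forall>I. I \<in> Pow {..<r} \<and> p I \<noteq> 0 \<longrightarrow> card I0 \<le> card I)"
    by (rule exE)
  then have I0: "I0 \<in> Pow {..<r}" "p I0 \<noteq> 0" by simp_all
  have min: "card I0 \<le> card I" if "I \<in> Pow {..<r}" "p I \<noteq> 0" for I
    using mp[OF spec[OF conjunct2[OF least]] conjI[OF that]] .
  define A where "A = {..<r} - I0"
  have A: "finite A" "A \<inter> I0 = {}" "A \<union> I0 = {..<r}" using I0(1) by (auto simp: A_def)
  have other: "dI A (dI I (emb (p I * \<Delta>))) = (\<lambda>K. 0)" if I: "I \<in> Pow {..<r}" "I \<noteq> I0" for I
  proof (cases "p I = 0")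
    case True
    have "dI A (\<lambda>K. 0) = (\<lambda>K. 0)" using dI_sum[of A "\<lambda>_. 0" "\<lambda>_ _. 0" "{}::nat set"] by simp
    then show ?thesis using True by (simp add: dI_0)
  next
    case False
    \<comment> \<open>By minimality a different \<open>I\<close> with nonzero coefficient is at
      least as large as \<open>I0\<close>; it is not contained in \<open>I0\<close>, hence meets the
      complement \<open>A\<close> and its product with \<open>dI A\<close> repeats an
      operator.\<close>
    have "\<not> I \<subseteq> I0" using card_seteq[OF finite_Pow_r[OF I0(1)] _ min[OF I(1) False]] I(2) by auto
    then have "A \<inter> I \<noteq> {}" using I(1) by (auto simp: A_def)
    then show ?thesis by (rule D.opseq_opseq_overlap[OF A(1) finite_Pow_r[OF I(1)]])
  qed
  obtain c where c: "c \<noteq> 0" "dI A (dI I0 (emb (p I0 * \<Delta>))) = (\<lambda>K. Const c * dI (A \<union> I0) (emb (p I0 * \<Delta>)) K)"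
    using D.opseq_opseq_disjoint[OF A(1) finite_Pow_r[OF I0(1)] A(2)] by metis
  have "(\<lambda>K. \<Sum>I\<in>Pow {..<r}. dI A (dI I (emb (p I * \<Delta>))) K) = dI A (\<lambda>K. \<Sum>I\<in>Pow {..<r}. dI I (emb (p I * \<Delta>)) K)"
    using dI_sum[of A "\<lambda>_. 1" "\<lambda>I. dI I (emb (p I * \<Delta>))" "Pow {..<r}"] by simp
  also have "\<dots> = (\<lambda>K. 0)" unfolding 0 using dI_sum[of A "\<lambda>_. 0" "\<lambda>_ _. 0" "{}::nat set"] by simp
  finally have "(\<Sum>I\<in>Pow {..<r}. dI A (dI I (emb (p I * \<Delta>))) {..<r}) = 0" by (rule fun_cong)
  moreover have "(\<Sum>I\<in>Pow {..<r}. dI A (dI I (emb (p I * \<Delta>))) {..<r}) =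
      (\<Sum>I\<in>Pow {..<r}. if I = I0 then Const c * dI {..<r} (emb (p I0 * \<Delta>)) {..<r} else 0)"
    using other c(2) A(3) by (intro sum.cong refl) auto
  ultimately have "dI {..<r} (emb (p I0 * \<Delta>)) {..<r} = 0" using I0(1) c(1) by simp
  moreover have "dI {..<r} (emb (p I0 * \<Delta>)) {..<r} = diff_op (jacobian r \<omega>t) (p I0 * \<Delta>)"
    using dst_top[of r \<omega>t "p I0 * \<Delta>"] by (simp add: D.opseq_def lessThan_atLeast0)
  ultimately show False using dual_jacobian_injective[OF p[OF I0(1)]] I0(2) by simp
qed

text \<open>Grouping by \<open>I\<close> merges the monomials in the f_i that belong to one index
  set into a single invariant coefficient.\<close>

lemma sum_by_fibres:
  fixes g :: "(nat \<Rightarrow> nat) \<times> nat set \<Rightarrow> 'a pm"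
  assumes S: "finite S" "S \<subseteq> exponents n \<times> Pow {..<r}"
  shows "(\<Sum>t\<in>S. g t) = (\<Sum>I\<in>Pow {..<r}. \<Sum>a\<in>{a. (a, I) \<in> S}. g (a, I))"
proof -
  have fin: "finite {a. (a, I) \<in> S}" for I
    by (rule finite_subset[of _ "fst ` S"]) (use S in force)+
  have "(\<Sum>I\<in>Pow {..<r}. \<Sum>a\<in>{a. (a, I) \<in> S}. g (a, I)) = (\<Sum>t\<in>(SIGMA I:Pow {..<r}. {a. (a, I) \<in> S}). g (snd t, fst t))"
    using fin by (subst sum.Sigma) (auto simp: case_prod_unfold)
  also have "\<dots> = (\<Sum>t\<in>S. g t)"
    by (rule sum.reindex_bij_witness[of _ "\<lambda>(a, I). (I, a)" "\<lambda>(I, a). (a, I)"]) (use S in auto)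
  finally show ?thesis by simp
qed

lemma fibre_coefficients:
  assumes S: "finite S" "S \<subseteq> exponents n \<times> Pow {..<r}"
    and 0: "\<forall>I\<in>Pow {..<r}. (\<Sum>a\<in>{a. (a, I) \<in> S}. Const (c (a, I)) * fmon n f a) = 0"
  shows "\<forall>t\<in>S. c t = 0"
proof
  fix t assume t: "t \<in> S"
  obtain a I where aI: "t = (a, I)" by (cases t)
  have "finite {a. (a, I) \<in> S}" by (rule finite_subset[of _ "fst ` S"]) (use S in force)+
  moreover have "{a. (a, I) \<in> S} \<subseteq> exponents n" "I \<in> Pow {..<r}" using S t aI by auto
  ultimately have "\<forall>b\<in>{a. (a, I) \<in> S}. c (b, I) = 0" using 0 by (intro fmon_indep) auto
  then show "c t = 0" using t aI by simp
qed

lemma fibre_R: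
  assumes S: "finite S" "S \<subseteq> exponents n \<times> Pow {..<r}"
  shows "(\<Sum>a\<in>{a. (a, I) \<in> S}. Const (c (a, I)) * fmon n f a) \<in> R"
  using assms by (intro R_sum R_mult fmon_R) auto

lemma shift_homog_dI:
  assumes "I \<in> Pow {..<r}" "homog_deg h p"
  shows "shift_homog (sum et I) h (dI I (emb p))"
  using shift_homog_foldr_dst[where r = r and v = \<omega>t and e = et and xs = "sorted_list_of_set I", OF shift_homog_emb[OF assms(2)] et] assms(1) finite_Pow_r[OF assms(1)]
  by (simp add: D.opseq_def)

abbreviation "B2 \<equiv> \<lambda>(a, I). dI I (emb (fmon n f a * \<Delta>))"
abbreviation "B1 \<equiv> \<lambda>(a, I) K. fmon n f a * dI I (emb \<Delta>) K"

lemma indep_family_B2: "indep_family B2"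
  unfolding indep_family_def
proof (intro conjI ballI allI impI)
  fix t assume "t \<in> exponents n \<times> Pow {..<r}"
  then obtain a I where t: "t = (a, I)" "a \<in> exponents n" "I \<in> Pow {..<r}" by auto
  show "B2 t \<in> N" using dI_N[OF N_emb[OF fmon_R[OF t(2)]] t(3)] by (simp add: t(1))
  show "mdeg m + sum et (snd t) = wt (fst t) + eD" if "lk (B2 t K) m \<noteq> 0" for K m
    using shift_homog_dI[OF t(3) homog_deg_mult[OF homog_fmon[of a] eD]] that by (simp add: t(1) shift_homog_def)
next
  fix S c t assume *: "finite S \<and> S \<subseteq> exponents n \<times> Pow {..<r} \<and> (\<lambda>K. \<Sum>t\<in>S. Const (c t) * B2 t K) = (\<lambda>K. 0)"
  then have S: "finite S" "S \<subseteq> exponents n \<times> Pow {..<r}" by auto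
  define p where "p I = (\<Sum>a\<in>{a. (a, I) \<in> S}. Const (c (a, I)) * fmon n f a)" for I
  have "(\<Sum>I\<in>Pow {..<r}. dI I (emb (p I * \<Delta>)) K) = (\<Sum>t\<in>S. Const (c t) * B2 t K)" for K
  proof -
    have "p I * \<Delta> = (\<Sum>a\<in>{a. (a, I) \<in> S}. Const (c (a, I)) * (fmon n f a * \<Delta>))" for I
      by (simp add: p_def sum_distrib_right mult.assoc)
    then have "dI I (emb (p I * \<Delta>)) K = (\<Sum>a\<in>{a. (a, I) \<in> S}. Const (c (a, I)) * dI I (emb (fmon n f a * \<Delta>)) K)" for I
      by (simp add: emb_sum dI_sum)
    then show ?thesis using sum_by_fibres[OF S, of "\<lambda>t. Const (c t) * B2 t K"] by simp
  qed
  then have "(\<lambda>K. \<Sum>I\<in>Pow {..<r}. dI I (emb (p I * \<Delta>)) K) = (\<lambda>K. 0)" using * by simp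
  moreover have "p I \<in> R" for I unfolding p_def by (rule fibre_R[OF S])
  ultimately have "\<forall>I\<in>Pow {..<r}. p I = 0" by (intro dI_independent) auto
  then have "\<forall>t\<in>S. c t = 0" unfolding p_def by (rule fibre_coefficients[OF S])
  moreover assume "t \<in> S"
  ultimately show "c t = 0" by blast
qed

text \<open>\<open>\<Delta>\<close> has the lowest degree among the semi-invariants.\<close>

lemma diff_op_Delta:
  assumes q: "q \<in> R'" "homog_deg h q" and h: "h \<noteq> 0"
  shows "diff_op q \<Delta> = 0"
proof -
  have qv: "in_vars n q" "\<And>g. g \<in> G \<Longrightarrow> lsub n (aV' g) q = q" using q(1) by (auto simp: inv_ring_def)
  obtain p where p: "p \<in> R" "diff_op q \<Delta> = p * \<Delta>"
  proof (rule semi_invariant)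
    show "in_vars n (diff_op q \<Delta>)" by (rule in_vars_diff_op[OF \<Delta>_facts(3)])
    fix g assume g: "g \<in> G"
    have "lsub n (aV g) (diff_op q \<Delta>) = diff_op (lsub n (aV' g) q) (lsub n (aV g) \<Delta>)"
      by (rule diff_op_lsub[symmetric]) (use qv \<Delta>_facts(3) a_dual[OF g] a_dual'[OF g] in auto)
    then show "lsub n (aV g) (diff_op q \<Delta>) = Const (\<chi> g) * diff_op q \<Delta>"
      using qv(2)[OF g] \<Delta>_facts(4)[OF g] by (simp add: diff_op_Const_mult_right)
  qed
  show ?thesis
  proof (rule hcomp_eq_0_imp)
    fix d
    \<comment> \<open>Differentiation by \<open>q\<close> leaves only degrees below
      \<open>eD\<close>, whereas a multiple of \<open>\<Delta>\<close> has none there.\<close>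
    show "hcomp d (diff_op q \<Delta>) = 0"
    proof (cases "eD \<le> d")
      case True
      have "lk (diff_op q \<Delta>) m = 0" if "mdeg m = d" for m
        using diff_op_homog[OF q(2) eD, of m] that True h by (metis add_le_same_cancel2 le_zero_eq)
      then show ?thesis by (intro poly_mapping_eqI) (auto simp: lk_hcomp)
    next
      case False
      then show ?thesis using hcomp_mult_homog[OF eD, of d p] p(2) by simp
    qed
  qed
qed

lemma dI_emb_independent:
  assumes "(\<lambda>K. \<Sum>I\<in>Pow {..<r}. Const (c I) * dI I (emb \<Delta>) K) = (\<lambda>K. 0)"
  shows "\<forall>I\<in>Pow {..<r}. c I = 0"
proof -
  have "dI I (emb (Const (c I) * \<Delta>)) = (\<lambda>K. Const (c I) * dI I (emb \<Delta>) K)" for I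
    using dI_sum[of I "\<lambda>_. c I" "\<lambda>_. emb \<Delta>" "{()}"] emb_sum[of "\<lambda>_. c I" "\<lambda>_. \<Delta>" "{()}"] by simp
  then have "\<forall>I\<in>Pow {..<r}. Const (c I) = (0 :: 'a pm)"
    using assms by (intro dI_independent) auto
  then show ?thesis by simp
qed

text \<open>Constant-coefficient operators commute with the d_i^*, so the
  \<open>dI I (emb \<Delta>)\<close> inherit harmonicity from \<open>\<Delta>\<close>.\<close>

lemma diff_op_dI:
  assumes q: "q \<in> R'" "homog_deg h q" and h: "h \<noteq> 0"
  shows "diff_op q (dI I (emb \<Delta>) K) = 0"
proof -
  have "(\<lambda>K. diff_op q (dI I (emb \<Delta>) K)) = dI I (\<lambda>K. diff_op q (emb \<Delta> K))"
    unfolding D.opseq_def by (rule foldr_dst_diff_op[symmetric])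
  also have "(\<lambda>K. diff_op q (emb \<Delta> K)) = emb 0" using diff_op_Delta[OF assms] by (auto simp: emb_def)
  finally show ?thesis using dI_0 by (metis (mono_tags))
qed

text \<open>The matrix of coordinates of the \<open>dI I (emb \<Delta>)\<close> over the invariants.
  Its constant terms decide their independence.\<close>

definition acoef :: "nat set \<Rightarrow> nat set \<Rightarrow> 'a pm" where
  "acoef I L = (SOME q. q \<in> R \<and> Phi L (dI I (emb \<Delta>)) = q * \<Delta>)"

lemma dI_emb_N: "I \<in> Pow {..<r} \<Longrightarrow> dI I (emb \<Delta>) \<in> N"
  using dI_N[OF N_emb[OF one_R]] by simp

lemma acoef:
  assumes "I \<in> Pow {..<r}" "L \<in> Pow {..<r}"
  shows "acoef I L \<in> R" "Phi L (dI I (emb \<Delta>)) = acoef I L * \<Delta>"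
proof -
  have "\<exists>q. q \<in> R \<and> Phi L (dI I (emb \<Delta>)) = q * \<Delta>" using Phi_N[OF dI_emb_N[OF assms(1)] assms(2)] by blast
  from someI_ex[OF this] show "acoef I L \<in> R" "Phi L (dI I (emb \<Delta>)) = acoef I L * \<Delta>"
    unfolding acoef_def by auto
qed

text \<open>A combination of the \<open>d\<^sub>I \<Delta>\<close> whose coordinates have no constant terms is harmonic and lies in
  the ideal of the invariants of positive degree.\<close>

lemma acoef_rows_independent:
  assumes 0: "\<And>L. L \<in> Pow {..<r} \<Longrightarrow> (\<Sum>I\<in>Pow {..<r}. c I * lk (acoef I L) 0) = 0"
  shows "\<forall>I\<in>Pow {..<r}. c I = 0"
proof -
  let ?P = "Pow {..<r}"
  define w where "w K = (\<Sum>I\<in>?P. Const (c I) * dI I (emb \<Delta>) K)" for K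
  have w: "w \<in> N" unfolding w_def[abs_def] using dI_emb_N by (intro N_sum) auto
  \<comment> \<open>The coordinates of \<open>w\<close>; the assumption says exactly that they have
    no constant term.\<close>
  define p where "p L = (\<Sum>I\<in>?P. Const (c I) * acoef I L)" for L
  have p: "p L \<in> R" "lk (p L) 0 = 0" "Phi L w = p L * \<Delta>" if "L \<in> ?P" for L
  proof -
    show "p L \<in> R" unfolding p_def using acoef(1) that by (intro R_sum R_mult) auto
    show "lk (p L) 0 = 0" using 0[OF that] by (simp add: p_def lookup_sum)
    show "Phi L w = p L * \<Delta>" unfolding w_def[abs_def] Phi_sum p_def sum_distrib_right
      using acoef(2) that by (intro sum.cong refl) (simp add: mult.assoc)
  qed
  \<comment> \<open>The dual system comes from the other family, whose independence is already
    established. It expresses \<open>w\<close> as a combination of the \<open>v L\<close> with the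
    coefficients \<open>p L\<close>.\<close>
  have "\<exists>v. \<forall>L\<in>?P. v L \<in> N \<and> (\<forall>L'\<in>?P. Phi L' (v L) = (if L' = L then \<Delta> else 0))"
    using indep_family_dual[OF indep_family_B2] by (intro bchoice) blast
  then obtain v where v: "\<And>L. L \<in> ?P \<Longrightarrow> v L \<in> N" "\<And>L L'. L \<in> ?P \<Longrightarrow> L' \<in> ?P \<Longrightarrow> Phi L' (v L) = (if L' = L then \<Delta> else 0)"
    by blast
  define w' where "w' K = (\<Sum>L\<in>?P. p L * v L K)" for K
  have w': "w' \<in> N" unfolding w'_def[abs_def] using v(1) p(1) by (intro N_sum) auto
  have "(\<lambda>K. w K - w' K) = (\<lambda>K. 0)"
  proof (rule Phi_injective)
    show "(\<lambda>K. w K - w' K) \<in> N" using w w' by (rule N_diff)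
    fix L assume L: "L \<in> ?P"
    have "Phi L w' = (\<Sum>L'\<in>?P. if L' = L then p L * \<Delta> else 0)"
      unfolding w'_def[abs_def] Phi_sum using v(2) L by (intro sum.cong refl) auto
    also have "\<dots> = p L * \<Delta>" using L by simp
    finally show "Phi L (\<lambda>K. w K - w' K) = 0" unfolding Phi_diff using p(3)[OF L] by simp
  qed
  then have ww': "w K = w' K" for K by (simp add: fun_eq_iff)
  obtain D where D: "\<And>L m. m \<in> keys (p L) \<Longrightarrow> mdeg m < D L" using mdeg_bound[of "p _"] by metis
  have "w K = 0" for K
  proof (rule harmonic_ideal)
    \<comment> \<open>The homogeneous parts of the \<open>p L\<close> are indexed from 1, since
      harmonicity gives annihilation only by invariants of positive degree.\<close>
    let ?S = "SIGMA L:?P. {1..<D L}"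
    show "finite ?S" by auto
    show "in_vars n (w K)" using w by (simp add: N_iff tensor_space_iff)
    have "p L = (\<Sum>j\<in>{1..<D L}. hcomp j (p L))" if "L \<in> ?P" for L
    proof -
      have h0: "hcomp 0 (p L) = 0"
        using p(2)[OF that] by (intro poly_mapping_eqI) (auto simp: lk_hcomp mdeg_eq_0_iff)
      have "p L = (\<Sum>j<D L. hcomp j (p L))" using D by (rule sum_hcomp)
      also have "\<dots> = (\<Sum>j\<in>{1..<D L}. hcomp j (p L))"
        using h0 by (intro sum.mono_neutral_right) (auto simp: Suc_le_eq not_less)
      finally show ?thesis .
    qed
    then have "w K = (\<Sum>L\<in>?P. \<Sum>j\<in>{1..<D L}. hcomp j (p L) * v L K)"
      unfolding ww' w'_def by (intro sum.cong refl) (metis sum_distrib_right)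
    then show "w K = (\<Sum>t\<in>?S. hcomp (snd t) (p (fst t)) * v (fst t) K)"
      by (subst (asm) sum.Sigma) (auto simp: case_prod_unfold)
    fix t assume t: "t \<in> ?S"
    show "hcomp (snd t) (p (fst t)) \<in> R" using t p(1) by (auto intro: inv_ring_hcomp)
    show "homog_deg (snd t) (hcomp (snd t) (p (fst t)))" by simp
    fix q assume q: "q \<in> R'" "homog_deg (snd t) q"
    show "diff_op q (w K) = 0"
      unfolding w_def diff_op_sum_right diff_op_Const_mult_right using t diff_op_dI[OF q] by auto
  qed
  then have "(\<lambda>K. \<Sum>I\<in>?P. Const (c I) * dI I (emb \<Delta>) K) = (\<lambda>K. 0)" by (simp add: w_def[symmetric])
  then show ?thesis by (rule dI_emb_independent)
qed

lemma indep_family_B1: "indep_family B1"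
  unfolding indep_family_def
proof (intro conjI ballI allI impI)
  fix t assume "t \<in> exponents n \<times> Pow {..<r}"
  then obtain a I where t: "t = (a, I)" "a \<in> exponents n" "I \<in> Pow {..<r}" by auto
  show "B1 t \<in> N" using N_sum[of "{()}" "\<lambda>_. dI I (emb \<Delta>)" "\<lambda>_. fmon n f a"] dI_emb_N[OF t(3)] fmon_R[OF t(2)]
    by (simp add: t(1))
  show "mdeg m + sum et (snd t) = wt (fst t) + eD" if "lk (B1 t K) m \<noteq> 0" for K m
  proof -
    have "m \<in> keys (fmon n f a * dI I (emb \<Delta>) K)" using that by (simp add: t(1) in_keys_iff)
    then obtain x y where xy: "m = x + y" "lk (fmon n f a) x \<noteq> 0" "lk (dI I (emb \<Delta>) K) y \<noteq> 0"
      using keys_mult by (force simp: in_keys_iff)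
    have "mdeg x = wt a" using homog_fmon[of a] xy(2) by (simp add: homog_deg_lk)
    moreover have "mdeg y + sum et I = eD" using shift_homog_dI[OF t(3) eD] xy(3) by (simp add: shift_homog_def)
    ultimately show ?thesis by (simp add: t(1) xy(1) mdeg_add)
  qed
next
  fix S c t assume *: "finite S \<and> S \<subseteq> exponents n \<times> Pow {..<r} \<and> (\<lambda>K. \<Sum>t\<in>S. Const (c t) * B1 t K) = (\<lambda>K. 0)"
  then have S: "finite S" "S \<subseteq> exponents n \<times> Pow {..<r}" by auto
  let ?P = "Pow {..<r}"
  define p where "p I = (\<Sum>a\<in>{a. (a, I) \<in> S}. Const (c (a, I)) * fmon n f a)" for I
  have pR: "p I \<in> R" for I unfolding p_def by (rule fibre_R[OF S])
  have "(\<Sum>I\<in>?P. p I * dI I (emb \<Delta>) K) = (\<Sum>t\<in>S. Const (c t) * B1 t K)" for K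
    using sum_by_fibres[OF S, of "\<lambda>t. Const (c t) * B1 t K"] by (simp add: p_def sum_distrib_right mult.assoc)
  then have rel: "(\<lambda>K. \<Sum>I\<in>?P. p I * dI I (emb \<Delta>) K) = (\<lambda>K. 0)" using * by simp
  \<comment> \<open>Contractions are linear over polynomials and \<open>\<Delta>\<close> cancels,
    which turns the relation between forms into one between the rows of
    \<open>acoef\<close>.\<close>
  have rel': "(\<Sum>I\<in>?P. p I * acoef I L) = 0" if L: "L \<in> ?P" for L
  proof -
    have "(\<Sum>I\<in>?P. p I * acoef I L) * \<Delta> = (\<Sum>I\<in>?P. p I * Phi L (dI I (emb \<Delta>)))"
      unfolding sum_distrib_right using acoef(2)[OF _ L] by (intro sum.cong refl) (simp add: mult.assoc)
    also have "\<dots> = Phi L (\<lambda>K. \<Sum>I\<in>?P. p I * dI I (emb \<Delta>) K)" by (rule Phi_sum[symmetric])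
    also have "\<dots> = 0" unfolding rel using Phi_sum[of L "\<lambda>_. 0" "\<lambda>_ _. 0" "{}::nat set"] by simp
    finally show ?thesis using \<Delta>_facts(2) by simp
  qed
  have "\<forall>I\<in>?P. p I = 0"
  proof (rule ccontr)
    assume "\<not> (\<forall>I\<in>?P. p I = 0)"
    \<comment> \<open>Among the monomials occurring in some \<open>p I\<close>, one of least degree
      is taken. Its coefficients are constants, not all zero, that annihilate the constant terms of
      \<open>acoef\<close>.\<close>
    then obtain I1 m1 where "I1 \<in> ?P" "lk (p I1) m1 \<noteq> 0" by (metis poly_mapping_eqI lookup_zero)
    then have ex: "\<exists>I\<in>?P. lk (p I) m1 \<noteq> 0" by blast
    from ex_has_least_nat[of "\<lambda>m. \<exists>I\<in>?P. lk (p I) m \<noteq> 0" m1 mdeg, OF ex]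
    obtain m where least: "(\<exists>I\<in>?P. lk (p I) m \<noteq> 0) \<and> (\<forall>m'. (\<exists>I\<in>?P. lk (p I) m' \<noteq> 0) \<longrightarrow> mdeg m \<le> mdeg m')"
      by (rule exE)
    then have m: "\<exists>I\<in>?P. lk (p I) m \<noteq> 0" by simp
    have min: "mdeg m \<le> mdeg m'" if "\<exists>I\<in>?P. lk (p I) m' \<noteq> 0" for m' using least that by simp
    have "(\<Sum>I\<in>?P. lk (p I) m * lk (acoef I L) 0) = 0" if "L \<in> ?P" for L
    proof -
      have "(\<Sum>I\<in>?P. lk (p I) m * lk (acoef I L) 0) = (\<Sum>I\<in>?P. lk (p I * acoef I L) m)"
        using min by (intro sum.cong refl lk_mult_lowest[symmetric]) auto
      also have "\<dots> = lk (\<Sum>I\<in>?P. p I * acoef I L) m" by (simp add: lookup_sum)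
      finally show ?thesis using rel'[OF that] by simp
    qed
    from acoef_rows_independent[OF this] m show False by blast
  qed
  then have "\<forall>t\<in>S. c t = 0" unfolding p_def by (rule fibre_coefficients[OF S])
  moreover assume "t \<in> S"
  ultimately show "c t = 0" by blast
qed

lemma dstar_seq_emb: "dstar_seq r \<omega>t I (emb p) = dI I (emb p)"
  unfolding D.opseq_def by (rule dstar_seq_dst) (auto simp: emb_def)

lemma F_bases:
  "F_basis N (exponents n \<times> Pow {..<r}) (\<lambda>(a, I). (\<lambda>K. fmon n f a * dstar_seq r \<omega>t I (emb \<Delta>) K))"
  "F_basis N (exponents n \<times> Pow {..<r}) (\<lambda>(a, I). dstar_seq r \<omega>t I (emb (fmon n f a * \<Delta>)))"
  unfolding dstar_seq_emb by (rule indep_family_F_basis[OF indep_family_B1], rule indep_family_F_basis[OF indep_family_B2])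

end

theorem theorem4p10:
  fixes n r :: nat
    and G :: "'a::field_char_0 mat set"
    and \<rho> :: "'a mat \<Rightarrow> 'a mat"
    and \<chi> :: "'a mat \<Rightarrow> 'a"
    and f :: "nat \<Rightarrow> 'a pm"
    and \<Delta> :: "'a pm"
    and \<omega> :: "nat \<Rightarrow> nat \<Rightarrow> 'a pm"
    and \<omega>t :: "nat \<Rightarrow> nat \<Rightarrow> 'a pm"
  assumes "finite_mat_group n G"
    and "generated_by_pseudo_reflections n G"
    and "representation n r G \<rho>"
    and "linear_character G \<chi>"
    and "basic_invariants n G f"
    and "semi_inv_generator n G \<chi> \<Delta>"
    and "homog_free_basis r (inv_SVd n G) (inv_SVd_M n r G \<rho>) \<omega>"
    and "homog_free_basis r (inv_SV n G) (inv_SV_Mdual n r G \<rho>) \<omega>t"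
    and "jacobian r \<omega> dvd \<Delta>"
  shows "F_basis (chi_part n r G \<rho> \<chi>) (exponents n \<times> Pow {..<r})
           (\<lambda>(a, I). (\<lambda>K. fmon n f a * dstar_seq r \<omega>t I (emb \<Delta>) K))
       \<and> F_basis (chi_part n r G \<rho> \<chi>) (exponents n \<times> Pow {..<r})
           (\<lambda>(a, I). dstar_seq r \<omega>t I (emb (fmon n f a * \<Delta>)))"
proof -
  interpret invariant_setting n r G \<rho> \<chi> f \<Delta> \<omega> \<omega>t
    by unfold_locales fact+
  show ?thesis using F_bases by blast
qed

end
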